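(* Let $\Gamma$ be a charmenable discrete group with trivial amenable radical. Let $\pi$ be a unitary representation of $\Gamma$ and denote $A := C^*_\pi(\Gamma)$. If $\pi$ is non-amenable then the following facts are true. 1. $\pi$ weakly contains the regular representation, the regular trace $\tau$ is the unique trace on $A$, and every proper (two-sided, closed) ideal of $A$ is contained in $I_\tau := \{x \in A \mid \tau(x^*x) = 0\}$. 2. The regular trace $\tau$ on $A$ satisfies a Powers property: for every $x \in A$, $\tau(x)1$ belongs to the norm closure of the convex hull of $\{\pi(g)x\pi(g)^* \mid g \in \Gamma\}$. 3. There exists a probability measure $\mu$ on $\Gamma$ whose support generates $\Gamma$ and such that the only $\mu$-stationary state on $A$ is $\tau$.
   Context: $C^*_\pi(\Gamma)$ is the norm closed linear span of $\pi(\Gamma)$ in $B(H_\pi)$. A unitary representation $\pi$ on $H$ is *amenable* if $\pi\otimes\overline{\pi}$ weakly contains the trivial representation, equivalently if there is a state on $B(H)$ invariant under $\mathrm{Ad}(\pi(g))$, $g\in\Gamma$. A trace means a tracial state. If $\pi$ weakly contains the left regular representation, the *regular trace* on $C^*_\pi(\Gamma)$ is the tracial state $\tau$ with $\tau(\pi(g))=\delta_{g,e}$. $\Gamma$ acts on $A$ by $\mathrm{Ad}(\pi(g))$; a state $\phi$ on $A$ is *$\mu$-stationary* if $\sum_{g}\mu(g)\,\phi\circ \mathrm{Ad}(\pi(g))^{-1}=\phi$. For a countable discrete group $\Gamma$, $\mathrm{PD}_1(\Gamma)\subset \ell^\infty(\Gamma)$ is the compact convex set of positive definite functions $\phi$ on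 $\Gamma$ with $\phi(e)=1$, with the topology of pointwise convergence and the $\Gamma$-action coming from conjugation. A *character* is a conjugation-invariant element of $\mathrm{PD}_1(\Gamma)$; extreme points of the compact convex set of characters are the *extremal characters*. A character with GNS triple $(\pi_\phi,H_\phi,\xi_\phi)$ is *von Neumann amenable* if $\pi_\phi$ is amenable and $\pi_\phi(\Gamma)''$ is an amenable (injective) von Neumann algebra. $\mathrm{Rad}(\Gamma)$ is the amenable radical. $\Gamma$ is *charmenable* if: (1) every non-empty compact convex $\Gamma$-invariant subset of $\mathrm{PD}_1(\Gamma)$ contains a character; (2) every extremal character of $\Gamma$ is either supported on $\mathrm{Rad}(\Gamma)$ (vanishes outside it) or von Neumann amenable. *)

theory Defs
  imports
    "HOL-Analysis.Analysis"
    "HOL-Library.Function_Algebras"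
    "HOL-Algebra.Generated_Groups"
    "HOL-Probability.Probability_Mass_Function"
begin

section \<open>Complex vector spaces\<close>

class scaleC = scaleR +
  fixes scaleC :: "complex \<Rightarrow> 'a \<Rightarrow> 'a"  (infixr \<open>*\<^sub>C\<close> 75)

class complex_vector = real_vector + scaleC +
  assumes scaleC_add_right: "a *\<^sub>C (x + y) = a *\<^sub>C x + a *\<^sub>C y"
    and scaleC_add_left: "(a + b) *\<^sub>C x = a *\<^sub>C x + b *\<^sub>C x"
    and scaleC_scaleC: "a *\<^sub>C b *\<^sub>C x = (a * b) *\<^sub>C x"
    and scaleC_one: "1 *\<^sub>C x = x"
    and scaleR_scaleC: "r *\<^sub>R x = complex_of_real r *\<^sub>C x"

instantiation complex :: complex_vector
begin
definition scaleC_complex :: "complex \<Rightarrow> complex \<Rightarrow> complex" where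
  "scaleC_complex a x = a * x"
instance
  by standard (auto simp: scaleC_complex_def algebra_simps scaleR_conv_of_real)
end

instantiation "fun" :: (type, real_vector) real_vector
begin
definition scaleR_fun :: "real \<Rightarrow> ('a \<Rightarrow> 'b) \<Rightarrow> 'a \<Rightarrow> 'b" where
  "scaleR_fun r f = (\<lambda>x. r *\<^sub>R f x)"
instance
  by standard (auto simp: scaleR_fun_def fun_eq_iff algebra_simps)
end

instantiation "fun" :: (type, complex_vector) complex_vector
begin
definition scaleC_fun :: "complex \<Rightarrow> ('a \<Rightarrow> 'b) \<Rightarrow> 'a \<Rightarrow> 'b" where
  "scaleC_fun c f = (\<lambda>x. c *\<^sub>C f x)"
instance
  by standard
    (auto simp: scaleC_fun_def scaleR_fun_def fun_eq_iff
      scaleC_add_right scaleC_add_left scaleC_scaleC scaleC_one scaleR_scaleC)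
end

abbreviation csubspace :: "'a::complex_vector set \<Rightarrow> bool" where
  "csubspace \<equiv> module.subspace scaleC"

abbreviation cspan :: "'a::complex_vector set \<Rightarrow> 'a set" where
  "cspan \<equiv> module.span scaleC"

text \<open>
  Functions on a subset \<open>X\<close> of a type (functions on a group, operators on a Hilbert space,
  functionals on an algebra of operators) are represented throughout by total functions that
  vanish outside \<open>X\<close>. This keeps them closed under the pointwise vector space operations and
  makes equality of functions on \<open>X\<close> the equality of HOL.
\<close>

definition vanishes_off :: "'a set \<Rightarrow> ('a \<Rightarrow> 'b::zero) \<Rightarrow> bool" where
  "vanishes_off X f \<longleftrightarrow> (\<forall>x. x \<notin> X \<longrightarrow> f x = 0)"


section \<open>Hilbert spaces\<close>

text \<open>
  The underlying vector space of a Hilbert space is a complex subspace of an ambient type, so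
  that both a whole type and function spaces such as \<open>\<ell>\<^sup>2(\<Gamma>) \<subseteq> (\<Gamma> \<Rightarrow> \<complex>)\<close> qualify.
  The inner product is linear in the first variable; only its values on the subspace matter.
\<close>

record 'v hilbert =
  vecs :: "'v set"
  ip :: "'v \<Rightarrow> 'v \<Rightarrow> complex"

definition hnorm :: "'v hilbert \<Rightarrow> 'v \<Rightarrow> real" where
  "hnorm H x = sqrt (Re (ip H x x))"

definition hilbert_space :: "'v::complex_vector hilbert \<Rightarrow> bool" where
  "hilbert_space H \<longleftrightarrow>
     csubspace (vecs H) \<and>
     (\<forall>x\<in>vecs H. \<forall>y\<in>vecs H. \<forall>z\<in>vecs H. ip H (x + y) z = ip H x z + ip H y z) \<and>
     (\<forall>c. \<forall>x\<in>vecs H. \<forall>y\<in>vecs H. ip H (c *\<^sub>C x) y = c * ip H x y) \<and>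
     (\<forall>x\<in>vecs H. \<forall>y\<in>vecs H. ip H y x = cnj (ip H x y)) \<and>
     (\<forall>x\<in>vecs H. ip H x x \<in> \<real>\<^sub>\<ge>\<^sub>0 \<and> (ip H x x = 0 \<longrightarrow> x = 0)) \<and>
     (\<forall>X :: nat \<Rightarrow> 'v.
        (\<forall>n. X n \<in> vecs H) \<and>
        (\<forall>e>0. \<exists>N. \<forall>m\<ge>N. \<forall>n\<ge>N. hnorm H (X m - X n) < e) \<longrightarrow>
        (\<exists>x\<in>vecs H. (\<lambda>n. hnorm H (X n - x)) \<longlonglongrightarrow> 0))"

definition hclosure :: "'v::complex_vector hilbert \<Rightarrow> 'v set \<Rightarrow> 'v set" where
  "hclosure H S = {x \<in> vecs H. \<forall>e>0. \<exists>y\<in>S. hnorm H (x - y) < e}"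


section \<open>Bounded operators\<close>

text \<open>\<open>bop H\<close> is $B(H)$; composition is \<open>\<circ>\<close>, and the linear structure is pointwise.\<close>

definition bop :: "'v::complex_vector hilbert \<Rightarrow> ('v \<Rightarrow> 'v) set" where
  "bop H = {T. vanishes_off (vecs H) T \<and>
     (\<forall>x\<in>vecs H. T x \<in> vecs H) \<and>
     (\<forall>x\<in>vecs H. \<forall>y\<in>vecs H. T (x + y) = T x + T y) \<and>
     (\<forall>c. \<forall>x\<in>vecs H. T (c *\<^sub>C x) = c *\<^sub>C T x) \<and>
     (\<exists>C. \<forall>x\<in>vecs H. hnorm H (T x) \<le> C * hnorm H x)}"

definition id_op :: "'v::complex_vector hilbert \<Rightarrow> 'v \<Rightarrow> 'v" where
  "id_op H = (\<lambda>x. if x \<in> vecs H then x else 0)"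

definition opnorm :: "'v::complex_vector hilbert \<Rightarrow> ('v \<Rightarrow> 'v) \<Rightarrow> real" where
  "opnorm H T = Sup {hnorm H (T x) |x. x \<in> vecs H \<and> hnorm H x \<le> 1}"

definition adj :: "'v::complex_vector hilbert \<Rightarrow> ('v \<Rightarrow> 'v) \<Rightarrow> 'v \<Rightarrow> 'v" where
  "adj H T = (THE S. S \<in> bop H \<and> (\<forall>x\<in>vecs H. \<forall>y\<in>vecs H. ip H (T x) y = ip H x (S y)))"

definition op_closure :: "'v::complex_vector hilbert \<Rightarrow> ('v \<Rightarrow> 'v) set \<Rightarrow> ('v \<Rightarrow> 'v) set" where
  "op_closure H X = {T \<in> bop H. \<forall>e>0. \<exists>S\<in>X. opnorm H (T - S) < e}"

definition commutant :: "'v::complex_vector hilbert \<Rightarrow> ('v \<Rightarrow> 'v) set \<Rightarrow> ('v \<Rightarrow> 'v) set" where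
  "commutant H X = {T \<in> bop H. \<forall>S\<in>X. T \<circ> S = S \<circ> T}"

definition Ad :: "'v::complex_vector hilbert \<Rightarrow> ('v \<Rightarrow> 'v) \<Rightarrow> ('v \<Rightarrow> 'v) \<Rightarrow> 'v \<Rightarrow> 'v" where
  "Ad H U T = U \<circ> T \<circ> adj H U"

text \<open>In the next definitions \<open>A\<close> is a unital C*-subalgebra of $B(H)$.\<close>

definition state :: "'v::complex_vector hilbert \<Rightarrow> ('v \<Rightarrow> 'v) set \<Rightarrow> (('v \<Rightarrow> 'v) \<Rightarrow> complex) \<Rightarrow> bool"
  where
  "state H A \<phi> \<longleftrightarrow>
     vanishes_off A \<phi> \<and>
     (\<forall>S\<in>A. \<forall>T\<in>A. \<phi> (S + T) = \<phi> S + \<phi> T) \<and>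
     (\<forall>c. \<forall>T\<in>A. \<phi> (c *\<^sub>C T) = c * \<phi> T) \<and>
     (\<forall>T\<in>A. \<phi> (adj H T \<circ> T) \<in> \<real>\<^sub>\<ge>\<^sub>0) \<and>
     \<phi> (id_op H) = 1"

definition tracial_state ::
  "'v::complex_vector hilbert \<Rightarrow> ('v \<Rightarrow> 'v) set \<Rightarrow> (('v \<Rightarrow> 'v) \<Rightarrow> complex) \<Rightarrow> bool" where
  "tracial_state H A \<phi> \<longleftrightarrow> state H A \<phi> \<and> (\<forall>S\<in>A. \<forall>T\<in>A. \<phi> (S \<circ> T) = \<phi> (T \<circ> S))"

definition closed_ideal :: "'v::complex_vector hilbert \<Rightarrow> ('v \<Rightarrow> 'v) set \<Rightarrow> ('v \<Rightarrow> 'v) set \<Rightarrow> bool"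
  where
  "closed_ideal H A J \<longleftrightarrow>
     J \<subseteq> A \<and> csubspace J \<and>
     (\<forall>T\<in>A. \<forall>S\<in>J. T \<circ> S \<in> J \<and> S \<circ> T \<in> J) \<and>
     op_closure H J = J"

text \<open>Amenability (injectivity) of a von Neumann algebra \<open>M\<close>: there is a norm one projection
  of $B(H)$ onto \<open>M\<close>.\<close>

definition injective_vN :: "'v::complex_vector hilbert \<Rightarrow> ('v \<Rightarrow> 'v) set \<Rightarrow> bool" where
  "injective_vN H M \<longleftrightarrow>
     (\<exists>E :: ('v \<Rightarrow> 'v) \<Rightarrow> 'v \<Rightarrow> 'v.
        (\<forall>S\<in>bop H. \<forall>T\<in>bop H. E (S + T) = E S + E T) \<and>
        (\<forall>c. \<forall>T\<in>bop H. E (c *\<^sub>C T) = c *\<^sub>C E T) \<and>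
        (\<forall>T\<in>bop H. E T \<in> M \<and> opnorm H (E T) \<le> opnorm H T) \<and>
        (\<forall>T\<in>M. E T = T))"


section \<open>Unitary representations\<close>

definition unitary_group :: "'v::complex_vector hilbert \<Rightarrow> ('v \<Rightarrow> 'v) monoid" where
  "unitary_group H =
     \<lparr>carrier = {U \<in> bop H. U ` vecs H = vecs H \<and>
                   (\<forall>x\<in>vecs H. \<forall>y\<in>vecs H. ip H (U x) (U y) = ip H x y)},
      monoid.mult = (\<circ>),
      one = id_op H\<rparr>"

definition unitary_rep ::
  "('g, 'b) monoid_scheme \<Rightarrow> 'v::complex_vector hilbert \<Rightarrow> ('g \<Rightarrow> 'v \<Rightarrow> 'v) \<Rightarrow> bool" where
  "unitary_rep G H \<pi> \<longleftrightarrow> \<pi> \<in> hom G (unitary_group H)"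

definition cstar_alg ::
  "('g, 'b) monoid_scheme \<Rightarrow> 'v::complex_vector hilbert \<Rightarrow> ('g \<Rightarrow> 'v \<Rightarrow> 'v) \<Rightarrow> ('v \<Rightarrow> 'v) set" where
  "cstar_alg G H \<pi> = op_closure H (cspan (\<pi> ` carrier G))"

definition amenable_rep ::
  "('g, 'b) monoid_scheme \<Rightarrow> 'v::complex_vector hilbert \<Rightarrow> ('g \<Rightarrow> 'v \<Rightarrow> 'v) \<Rightarrow> bool" where
  "amenable_rep G H \<pi> \<longleftrightarrow>
     (\<exists>\<omega>. state H (bop H) \<omega> \<and> (\<forall>g\<in>carrier G. \<forall>T\<in>bop H. \<omega> (Ad H (\<pi> g) T) = \<omega> T))"

text \<open>\<open>\<pi>\<close> weakly contains \<open>\<rho>\<close>: every positive definite function associated with \<open>\<rho>\<close> is, uniformly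
  on finite sets, a limit of finite sums of positive definite functions associated with \<open>\<pi>\<close>.\<close>

definition weakly_contains ::
  "('g, 'b) monoid_scheme \<Rightarrow> 'v::complex_vector hilbert \<Rightarrow> ('g \<Rightarrow> 'v \<Rightarrow> 'v) \<Rightarrow>
    'w::complex_vector hilbert \<Rightarrow> ('g \<Rightarrow> 'w \<Rightarrow> 'w) \<Rightarrow> bool" where
  "weakly_contains G H \<pi> K \<rho> \<longleftrightarrow>
     (\<forall>\<xi>\<in>vecs K. \<forall>F e. finite F \<and> F \<subseteq> carrier G \<and> e > 0 \<longrightarrow>
        (\<exists>(n::nat) \<eta>. (\<forall>i<n. \<eta> i \<in> vecs H) \<and>
           (\<forall>g\<in>F. cmod (ip K (\<rho> g \<xi>) \<xi> - (\<Sum>i<n. ip H (\<pi> g (\<eta> i)) (\<eta> i))) < e)))"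

definition ell2 :: "('g, 'b) monoid_scheme \<Rightarrow> ('g \<Rightarrow> complex) hilbert" where
  "ell2 G =
     \<lparr>vecs = {f. vanishes_off (carrier G) f \<and> (\<lambda>x. (cmod (f x))\<^sup>2) summable_on carrier G},
      ip = (\<lambda>f h. \<Sum>\<^sub>\<infinity>x\<in>carrier G. f x * cnj (h x))\<rparr>"

definition left_regular ::
  "('g, 'b) monoid_scheme \<Rightarrow> 'g \<Rightarrow> ('g \<Rightarrow> complex) \<Rightarrow> 'g \<Rightarrow> complex" where
  "left_regular G g f =
     (\<lambda>x. if f \<in> vecs (ell2 G) \<and> x \<in> carrier G then f (inv\<^bsub>G\<^esub> g \<otimes>\<^bsub>G\<^esub> x) else 0)"

definition regular_trace ::
  "('g, 'b) monoid_scheme \<Rightarrow> 'v::complex_vector hilbert \<Rightarrow> ('g \<Rightarrow> 'v \<Rightarrow> 'v) \<Rightarrow>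
    (('v \<Rightarrow> 'v) \<Rightarrow> complex) \<Rightarrow> bool" where
  "regular_trace G H \<pi> \<tau> \<longleftrightarrow>
     tracial_state H (cstar_alg G H \<pi>) \<tau> \<and>
     (\<forall>g\<in>carrier G. \<tau> (\<pi> g) = (if g = \<one>\<^bsub>G\<^esub> then 1 else 0))"

definition stationary ::
  "('g, 'b) monoid_scheme \<Rightarrow> 'v::complex_vector hilbert \<Rightarrow> ('g \<Rightarrow> 'v \<Rightarrow> 'v) \<Rightarrow> 'g pmf \<Rightarrow>
    (('v \<Rightarrow> 'v) \<Rightarrow> complex) \<Rightarrow> bool" where
  "stationary G H \<pi> \<mu> \<phi> \<longleftrightarrow>
     (\<forall>T\<in>cstar_alg G H \<pi>.
        ((\<lambda>g. complex_of_real (pmf \<mu> g) * \<phi> (Ad H (\<pi> (inv\<^bsub>G\<^esub> g)) T)) has_sum \<phi> T) (carrier G))"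


section \<open>Amenable radical\<close>

definition amenable_group :: "('g, 'b) monoid_scheme \<Rightarrow> bool" where
  "amenable_group G \<longleftrightarrow>
     (\<exists>m :: 'g set \<Rightarrow> real.
        m (carrier G) = 1 \<and>
        (\<forall>A\<subseteq>carrier G. 0 \<le> m A) \<and>
        (\<forall>A\<subseteq>carrier G. \<forall>B\<subseteq>carrier G. A \<inter> B = {} \<longrightarrow> m (A \<union> B) = m A + m B) \<and>
        (\<forall>g\<in>carrier G. \<forall>A\<subseteq>carrier G. m (g <#\<^bsub>G\<^esub> A) = m A))"

definition amenable_radical :: "('g, 'b) monoid_scheme \<Rightarrow> 'g set" where
  "amenable_radical G = generate G (\<Union>{N. N \<lhd> G \<and> amenable_group (G\<lparr>carrier := N\<rparr>)})"


section \<open>Characters and charmenability\<close>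

text \<open>The topology of pointwise convergence on functions on \<open>G\<close> is that of the type
  \<open>'g \<Rightarrow> complex\<close>.\<close>

definition PD1 :: "('g, 'b) monoid_scheme \<Rightarrow> ('g \<Rightarrow> complex) set" where
  "PD1 G = {\<phi>. vanishes_off (carrier G) \<phi> \<and> \<phi> \<one>\<^bsub>G\<^esub> = 1 \<and>
     (\<forall>F c. finite F \<and> F \<subseteq> carrier G \<longrightarrow>
        (\<Sum>g\<in>F. \<Sum>h\<in>F. cnj (c g) * c h * \<phi> (inv\<^bsub>G\<^esub> g \<otimes>\<^bsub>G\<^esub> h)) \<in> \<real>\<^sub>\<ge>\<^sub>0)}"

definition conj_act :: "('g, 'b) monoid_scheme \<Rightarrow> 'g \<Rightarrow> ('g \<Rightarrow> complex) \<Rightarrow> 'g \<Rightarrow> complex" where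
  "conj_act G g \<phi> =
     (\<lambda>h. if h \<in> carrier G then \<phi> (inv\<^bsub>G\<^esub> g \<otimes>\<^bsub>G\<^esub> h \<otimes>\<^bsub>G\<^esub> g) else 0)"

definition characters :: "('g, 'b) monoid_scheme \<Rightarrow> ('g \<Rightarrow> complex) set" where
  "characters G = {\<phi> \<in> PD1 G. \<forall>g\<in>carrier G. conj_act G g \<phi> = \<phi>}"

definition gns_triple ::
  "('g, 'b) monoid_scheme \<Rightarrow> ('g \<Rightarrow> complex) \<Rightarrow>
    'v::complex_vector hilbert \<Rightarrow> ('g \<Rightarrow> 'v \<Rightarrow> 'v) \<Rightarrow> 'v \<Rightarrow> bool" where
  "gns_triple G \<phi> H \<pi> \<xi> \<longleftrightarrow>
     hilbert_space H \<and> unitary_rep G H \<pi> \<and> \<xi> \<in> vecs H \<and>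
     hclosure H (cspan ((\<lambda>g. \<pi> g \<xi>) ` carrier G)) = vecs H \<and>
     (\<forall>g\<in>carrier G. ip H (\<pi> g \<xi>) \<xi> = \<phi> g)"

text \<open>The GNS triple is unique up to unitary equivalence, and it can always be realised on a
  Hilbert space of functions on \<open>G\<close>, sending a vector \<open>v\<close> to \<open>g \<mapsto> \<langle>v, \<pi>(g)\<xi>\<rangle>\<close> (the reproducing
  kernel Hilbert space of \<open>(g, h) \<mapsto> \<phi>(g\<^sup>-\<^sup>1 h)\<close>). Hence the ambient type \<open>'g \<Rightarrow> complex\<close> below
  is no restriction.\<close>

definition von_neumann_amenable :: "('g, 'b) monoid_scheme \<Rightarrow> ('g \<Rightarrow> complex) \<Rightarrow> bool" where
  "von_neumann_amenable G \<phi> \<longleftrightarrow>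
     (\<exists>(H :: ('g \<Rightarrow> complex) hilbert) \<pi> \<xi>.
        gns_triple G \<phi> H \<pi> \<xi> \<and>
        amenable_rep G H \<pi> \<and>
        injective_vN H (commutant H (commutant H (\<pi> ` carrier G))))"

definition charmenable :: "('g, 'b) monoid_scheme \<Rightarrow> bool" where
  "charmenable G \<longleftrightarrow>
     (\<forall>K. K \<noteq> {} \<and> K \<subseteq> PD1 G \<and> compact K \<and> convex K \<and>
        (\<forall>g\<in>carrier G. \<forall>\<phi>\<in>K. conj_act G g \<phi> \<in> K) \<longrightarrow>
        K \<inter> characters G \<noteq> {}) \<and>
     (\<forall>\<phi>. \<phi> extreme_point_of characters G \<longrightarrow>
        (\<forall>g\<in>carrier G - amenable_radical G. \<phi> g = 0) \<or> von_neumann_amenable G \<phi>)"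

end

theory Submission
  imports Defs
begin

text \<open>
  Everything is read off from states on \<open>B(H)\<close>. If \<open>f\<close> is such a state, then
  \<open>g \<mapsto> f (\<pi> g)\<close> is a normalised positive definite function, and this restriction map is affine,
  continuous and equivariant. The state space is compact, so the first half of charmenability
  turns every non-empty compact convex invariant set of states into a character of the form
  \<open>g \<mapsto> f (\<pi> g)\<close> with \<open>f\<close> in that set.

  The heart of the proof (\<open>character_regular\<close>) is that such a character must be \<open>\<delta>\<^sub>e\<close>. The characters
  arising from states form a face of the set of all characters: if \<open>f \<circ> \<pi>\<close> is a proper convex
  combination involving \<open>u\<close>, then \<open>u\<close> is dominated by a multiple of \<open>f \<circ> \<pi>\<close>, hence is bounded on
  the span of \<open>\<pi>(\<Gamma>)\<close> and extends to a state (\<open>dominated_is_state\<close>). If one of them were non-zero at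
  some \<open>g \<noteq> e\<close>, this compact convex set would have an extreme point that is non-zero at \<open>g\<close>. It is an
  extremal character of \<open>\<Gamma>\<close> not supported on the trivial radical, so its GNS representation \<open>\<rho>\<close> is
  amenable. Compressing operators on \<open>H\<close> to the GNS space by means of \<open>f\<close> is a positive, unital and
  equivariant map, and an invariant state pulls back along it, so \<open>\<pi>\<close> would be amenable as well
  (\<open>amenable_transfer\<close>).

  Consequently every non-empty compact convex invariant set of states contains a state that
  restricts to the regular trace \<open>\<tau>\<close> on \<open>A\<close> (\<open>invariant_contains_regular\<close>), and the assertions follow:

  \<^item> A tracial state extends to a state whose restriction to \<open>\<Gamma>\<close> is a character, so it is \<open>\<tau>\<close>.

  \<^item> Powers property (\<open>powers_finite\<close>): let \<open>y\<close> be self-adjoint. If no average of \<open>y\<close> under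
    \<open>\<Gamma>\<close> were below \<open>\<tau>(y) + \<epsilon>\<close> in all states, a minimax argument and compactness would give a state
    that is at least \<open>\<tau>(y) + \<epsilon>\<close> on all averages of \<open>y\<close>. Such states form an invariant set, which
    has to contain a state with value \<open>\<tau>(y)\<close> at \<open>y\<close>. The same for \<open>-y\<close> gives an average that is close
    to \<open>\<tau>(y) 1\<close> in norm.

  \<^item> A closed ideal containing \<open>x\<close> contains the averages of \<open>x\<^sup>* x\<close>, hence \<open>\<tau>(x\<^sup>* x) 1\<close>.

  \<^item> \<open>\<tau>\<close> is a pointwise limit of sums of vector functionals. Compressing by \<open>\<pi>(c)\<close> for a finitely
    supported \<open>c\<close> gives the coefficient of \<open>c\<close> in the regular representation, and such \<open>c\<close> are
    dense in \<open>\<ell>\<^sup>2(\<Gamma>)\<close>.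

  \<^item> The measure is \<open>\<mu> = \<Sum>\<^sub>k 2\<^sup>-\<^sup>k\<^sup>-\<^sup>1 \<nu>\<^sub>k\<close>, where the averaging maps \<open>P\<^sub>k\<close> of the \<open>\<nu>\<^sub>k\<close> are chosen one
    after the other. Put \<open>S\<^sub>j = \<Sum>\<^sub>k\<^sub><\<^sub>j 2\<^sup>-\<^sup>k\<^sup>-\<^sup>1 P\<^sub>k\<close>, which has norm less than \<open>1\<close>. For \<open>\<tau>(x) = 0\<close> a truncated
    Neumann series gives \<open>w\<close> with \<open>(1 - S\<^sub>j) w\<close> close to \<open>x\<close>, and by the Powers property the
    later \<open>P\<^sub>k\<close> can be chosen such that \<open>P\<^sub>k w\<close> has norm at most \<open>1\<close>. A stationary \<open>f\<close> satisfies
    \<open>f(w) = \<Sum>\<^sub>k 2\<^sup>-\<^sup>k\<^sup>-\<^sup>1 f(P\<^sub>k w)\<close>, so \<open>f(x)\<close> is close to the sum over \<open>k \<ge> j\<close>, which is at most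
    \<open>2\<^sup>-\<^sup>j\<close> (\<open>unique_stationary_measure\<close>).
\<close>

section \<open>Complex scalar multiplication\<close>

interpretation cvs: vector_space "scaleC :: complex \<Rightarrow> 'a::complex_vector \<Rightarrow> 'a"
  by standard (simp_all add: scaleC_add_right scaleC_add_left scaleC_scaleC scaleC_one)

lemma scaleC_fun_apply [simp]: "(c *\<^sub>C f) x = c *\<^sub>C f x"
  by (simp add: scaleC_fun_def)

lemma scaleR_fun_apply [simp]: "(c *\<^sub>R f) x = c *\<^sub>R f x"
  by (simp add: scaleR_fun_def)

lemma scaleC_complex_mult [simp]: "c *\<^sub>C (z::complex) = c * z"
  by (simp add: scaleC_complex_def)

section \<open>Positive sesquilinear forms\<close>

lemma positive_form_hermitian:
  fixes B :: "'a::complex_vector \<Rightarrow> 'a \<Rightarrow> complex"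
  assumes V: "csubspace V"
    and add1: "\<And>x y z. x \<in> V \<Longrightarrow> y \<in> V \<Longrightarrow> z \<in> V \<Longrightarrow> B (x + y) z = B x z + B y z"
    and add2: "\<And>x y z. x \<in> V \<Longrightarrow> y \<in> V \<Longrightarrow> z \<in> V \<Longrightarrow> B z (x + y) = B z x + B z y"
    and sc1: "\<And>c x y. x \<in> V \<Longrightarrow> y \<in> V \<Longrightarrow> B (c *\<^sub>C x) y = c * B x y"
    and sc2: "\<And>c x y. x \<in> V \<Longrightarrow> y \<in> V \<Longrightarrow> B x (c *\<^sub>C y) = cnj c * B x y"
    and pos: "\<And>x. x \<in> V \<Longrightarrow> B x x \<in> \<real>\<^sub>\<ge>\<^sub>0"
    and x: "x \<in> V" and y: "y \<in> V"
  shows "B y x = cnj (B x y)"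
proof -
  have iy: "\<i> *\<^sub>C y \<in> V" using V y by (rule cvs.subspace_scale)
  have re: "Im (B x x) = 0" "Im (B y y) = 0"
    using pos[OF x] pos[OF y] by (auto simp: complex_nonneg_Reals_iff)
  have "x + y \<in> V" using V x y by (rule cvs.subspace_add)
  from pos[OF this] have 1: "Im (B x y + B y x) = 0"
    using re by (simp add: add1 add2 x y cvs.subspace_add[OF V x y] complex_nonneg_Reals_iff)
  have "x + \<i> *\<^sub>C y \<in> V" using V x iy by (rule cvs.subspace_add)
  from pos[OF this] have 2: "- Re (B x y) + Re (B y x) = 0"
    using re by (simp add: add1 add2 x y iy sc1 sc2 cvs.subspace_add[OF V x iy] complex_nonneg_Reals_iff)
  show ?thesis using 1 2 by (simp add: complex_eq_iff)
qed

lemma positive_form_cauchy_schwarz: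
  fixes B :: "'a::complex_vector \<Rightarrow> 'a \<Rightarrow> complex"
  assumes V: "csubspace V"
    and add1: "\<And>x y z. x \<in> V \<Longrightarrow> y \<in> V \<Longrightarrow> z \<in> V \<Longrightarrow> B (x + y) z = B x z + B y z"
    and add2: "\<And>x y z. x \<in> V \<Longrightarrow> y \<in> V \<Longrightarrow> z \<in> V \<Longrightarrow> B z (x + y) = B z x + B z y"
    and sc1: "\<And>c x y. x \<in> V \<Longrightarrow> y \<in> V \<Longrightarrow> B (c *\<^sub>C x) y = c * B x y"
    and sc2: "\<And>c x y. x \<in> V \<Longrightarrow> y \<in> V \<Longrightarrow> B x (c *\<^sub>C y) = cnj c * B x y"
    and pos: "\<And>x. x \<in> V \<Longrightarrow> B x x \<in> \<real>\<^sub>\<ge>\<^sub>0"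
    and x: "x \<in> V" and y: "y \<in> V"
  shows "(cmod (B x y))\<^sup>2 \<le> Re (B x x) * Re (B y y)"
proof -
  have herm: "B y x = cnj (B x y)"
    by (rule positive_form_hermitian[OF V]) (use add1 add2 sc1 sc2 pos x y in auto)
  let ?b = "B x y"
  have *: "0 \<le> Re (B x x) + 2 * Re (cnj c * ?b) + (cmod c)\<^sup>2 * Re (B y y)" for c
  proof -
    have cy: "c *\<^sub>C y \<in> V" using V y by (rule cvs.subspace_scale)
    have "x + c *\<^sub>C y \<in> V" using V x cy by (rule cvs.subspace_add)
    from pos[OF this] have "0 \<le> Re (B (x + c *\<^sub>C y) (x + c *\<^sub>C y))"
      by (simp add: complex_nonneg_Reals_iff)
    also have "B (x + c *\<^sub>C y) (x + c *\<^sub>C y)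
        = B x x + (cnj c * ?b + cnj (cnj c * ?b)) + (c * cnj c) * B y y"
      using cvs.subspace_add[OF V x cy]
      by (simp add: add1 add2 x y cy sc1 sc2 herm algebra_simps)
    also have "Re \<dots> = Re (B x x) + 2 * Re (cnj c * ?b) + (cmod c)\<^sup>2 * Re (B y y)"
      by (simp add: complex_norm_square[symmetric] del: complex_cnj_mult)
    finally show ?thesis .
  qed
  have bb: "cnj (of_real t * ?b) * ?b = of_real (t * (cmod ?b)\<^sup>2)" for t
    using complex_norm_square[of ?b] by (simp add: algebra_simps)
  have **: "0 \<le> Re (B x x) + 2 * (t * (cmod ?b)\<^sup>2) + t\<^sup>2 * (cmod ?b)\<^sup>2 * Re (B y y)" for t
    using *[of "of_real t * ?b"] unfolding bb by (simp add: norm_mult power_mult_distrib)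
  have xx: "0 \<le> Re (B x x)" and yy: "0 \<le> Re (B y y)"
    using pos[OF x] pos[OF y] by (auto simp: complex_nonneg_Reals_iff)
  show ?thesis
  proof (cases "Re (B y y) = 0")
    case True
    have "cmod ?b = 0"
    proof (rule ccontr)
      assume n: "cmod ?b \<noteq> 0"
      then have "0 \<le> Re (B x x) + 2 * (- (Re (B x x) + 1) / (cmod ?b)\<^sup>2 * (cmod ?b)\<^sup>2)"
        using **[of "- (Re (B x x) + 1) / (cmod ?b)\<^sup>2"] True by simp
      also have "\<dots> = - Re (B x x) - 2" using n by simp
      finally show False using xx by simp
    qed
    then show ?thesis using xx yy by simp
  next
    case False
    then have p: "Re (B y y) > 0" using yy by simp
    have "0 \<le> Re (B x x) - (cmod ?b)\<^sup>2 / Re (B y y)"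
      using **[of "- 1 / Re (B y y)"] p by (simp add: power2_eq_square field_simps)
    then show ?thesis using p by (simp add: field_simps)
  qed
qed

section \<open>Hilbert spaces\<close>

locale hilb =
  fixes H :: "'v::complex_vector hilbert"
  assumes hilbert_space: "hilbert_space H"
begin

abbreviation V where "V \<equiv> vecs H"
abbreviation nrm where "nrm \<equiv> hnorm H"

lemma subspace: "csubspace V" using hilbert_space by (simp add: hilbert_space_def)
lemma zero_in [simp, intro]: "0 \<in> V" using subspace by (rule cvs.subspace_0)
lemma add_in [simp, intro]: "x \<in> V \<Longrightarrow> y \<in> V \<Longrightarrow> x + y \<in> V" using subspace by (rule cvs.subspace_add)
lemma scale_in [simp, intro]: "x \<in> V \<Longrightarrow> c *\<^sub>C x \<in> V" using subspace by (rule cvs.subspace_scale)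
lemma diff_in [simp, intro]: "x \<in> V \<Longrightarrow> y \<in> V \<Longrightarrow> x - y \<in> V" using subspace by (rule cvs.subspace_diff)

lemma ip_add_left [simp]: "x \<in> V \<Longrightarrow> y \<in> V \<Longrightarrow> z \<in> V \<Longrightarrow> ip H (x + y) z = ip H x z + ip H y z"
  and ip_scale_left [simp]: "x \<in> V \<Longrightarrow> y \<in> V \<Longrightarrow> ip H (c *\<^sub>C x) y = c * ip H x y"
  and ip_sym: "x \<in> V \<Longrightarrow> y \<in> V \<Longrightarrow> ip H y x = cnj (ip H x y)"
  and ip_self_nonneg: "x \<in> V \<Longrightarrow> ip H x x \<in> \<real>\<^sub>\<ge>\<^sub>0"
  and ip_self_eq_0: "x \<in> V \<Longrightarrow> ip H x x = 0 \<Longrightarrow> x = 0"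
proof -
  note hs = hilbert_space[unfolded hilbert_space_def]
  note r1 = hs[THEN conjunct2] note r2 = r1[THEN conjunct2] note r3 = r2[THEN conjunct2]
  note r4 = r3[THEN conjunct2]
  show "x \<in> V \<Longrightarrow> y \<in> V \<Longrightarrow> z \<in> V \<Longrightarrow> ip H (x + y) z = ip H x z + ip H y z"
    by (rule r1[THEN conjunct1, rule_format])
  show "x \<in> V \<Longrightarrow> y \<in> V \<Longrightarrow> ip H (c *\<^sub>C x) y = c * ip H x y"
    by (rule r2[THEN conjunct1, rule_format])
  show "x \<in> V \<Longrightarrow> y \<in> V \<Longrightarrow> ip H y x = cnj (ip H x y)"
    by (rule r3[THEN conjunct1, rule_format])
  show "x \<in> V \<Longrightarrow> ip H x x \<in> \<real>\<^sub>\<ge>\<^sub>0"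
    by (rule r4[THEN conjunct1, rule_format, THEN conjunct1])
  show "x \<in> V \<Longrightarrow> ip H x x = 0 \<Longrightarrow> x = 0"
    by (rule r4[THEN conjunct1, rule_format, THEN conjunct2, rule_format])
qed

lemma ip_add_right [simp]: "x \<in> V \<Longrightarrow> y \<in> V \<Longrightarrow> z \<in> V \<Longrightarrow> ip H z (x + y) = ip H z x + ip H z y"
  by (metis add_in complex_cnj_add ip_add_left ip_sym)

lemma ip_scale_right [simp]: "x \<in> V \<Longrightarrow> y \<in> V \<Longrightarrow> ip H x (c *\<^sub>C y) = cnj c * ip H x y"
  by (metis scale_in complex_cnj_mult ip_scale_left ip_sym)

lemma ip_zero_left [simp]: "x \<in> V \<Longrightarrow> ip H 0 x = 0"
  using ip_scale_left[of x x 0] by simp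

lemma ip_zero_right [simp]: "x \<in> V \<Longrightarrow> ip H x 0 = 0"
  using ip_scale_right[of x x 0] by simp

lemma ip_diff_left [simp]: "x \<in> V \<Longrightarrow> y \<in> V \<Longrightarrow> z \<in> V \<Longrightarrow> ip H (x - y) z = ip H x z - ip H y z"
  by (metis add_diff_cancel_right' diff_add_cancel diff_in ip_add_left)

lemma ip_diff_right [simp]: "x \<in> V \<Longrightarrow> y \<in> V \<Longrightarrow> z \<in> V \<Longrightarrow> ip H z (x - y) = ip H z x - ip H z y"
  by (metis add_diff_cancel_right' diff_add_cancel diff_in ip_add_right)

lemma ip_self: "x \<in> V \<Longrightarrow> ip H x x = of_real ((nrm x)\<^sup>2)"
  using ip_self_nonneg[of x] by (simp add: hnorm_def complex_nonneg_Reals_iff complex_eq_iff)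

lemma nrm_nonneg [simp]: "x \<in> V \<Longrightarrow> 0 \<le> nrm x"
  using ip_self_nonneg[of x] by (simp add: hnorm_def complex_nonneg_Reals_iff)

lemma nrm_eq_0 [simp]: "x \<in> V \<Longrightarrow> nrm x = 0 \<longleftrightarrow> x = 0"
  using ip_self[of x] ip_self_eq_0[of x] by (auto simp: hnorm_def)

lemma nrm_zero [simp]: "nrm 0 = 0" by simp

lemma cauchy_schwarz: "x \<in> V \<Longrightarrow> y \<in> V \<Longrightarrow> cmod (ip H x y) \<le> nrm x * nrm y"
proof -
  assume x: "x \<in> V" and y: "y \<in> V"
  have "(cmod (ip H x y))\<^sup>2 \<le> Re (ip H x x) * Re (ip H y y)"
    by (rule positive_form_cauchy_schwarz[OF subspace]) (auto simp: x y ip_self_nonneg)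
  also have "\<dots> = (nrm x * nrm y)\<^sup>2" by (simp add: ip_self x y power_mult_distrib)
  finally show ?thesis by (rule power2_le_imp_le) (simp add: x y)
qed

lemma nrm_scale [simp]: "x \<in> V \<Longrightarrow> nrm (c *\<^sub>C x) = cmod c * nrm x"
proof -
  assume x: "x \<in> V"
  have "of_real ((nrm (c *\<^sub>C x))\<^sup>2) = c * cnj c * of_real ((nrm x)\<^sup>2)"
    using ip_self[OF scale_in[OF x, of c]] ip_self[OF x] x by (simp add: mult_ac)
  also have "\<dots> = of_real ((cmod c * nrm x)\<^sup>2)"
    by (simp only: complex_norm_square[symmetric] power_mult_distrib of_real_mult)
  finally have "(nrm (c *\<^sub>C x))\<^sup>2 = (cmod c * nrm x)\<^sup>2" by (simp only: of_real_eq_iff)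
  then show ?thesis using x by (simp add: power2_eq_iff_nonneg)
qed

lemma nrm_add_sq: "x \<in> V \<Longrightarrow> y \<in> V \<Longrightarrow> (nrm (x + y))\<^sup>2 = (nrm x)\<^sup>2 + 2 * Re (ip H x y) + (nrm y)\<^sup>2"
proof -
  assume x: "x \<in> V" and y: "y \<in> V"
  have "(nrm (x + y))\<^sup>2 = Re (ip H (x + y) (x + y))" using x y by (simp only: ip_self add_in Re_complex_of_real)
  also have "ip H (x + y) (x + y) = ip H x x + (ip H x y + cnj (ip H x y)) + ip H y y"
    using x y ip_sym[of x y] by simp
  also have "Re \<dots> = (nrm x)\<^sup>2 + 2 * Re (ip H x y) + (nrm y)\<^sup>2"
    using x y by (simp add: ip_self del: of_real_power)
  finally show ?thesis .
qed

lemma nrm_diff_sq: "x \<in> V \<Longrightarrow> y \<in> V \<Longrightarrow> (nrm (x - y))\<^sup>2 = (nrm x)\<^sup>2 - 2 * Re (ip H x y) + (nrm y)\<^sup>2"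
proof -
  assume x: "x \<in> V" and y: "y \<in> V"
  have "(nrm (x - y))\<^sup>2 = Re (ip H (x - y) (x - y))" using x y by (simp only: ip_self diff_in Re_complex_of_real)
  also have "ip H (x - y) (x - y) = ip H x x - (ip H x y + cnj (ip H x y)) + ip H y y"
    using x y ip_sym[of x y] by simp
  also have "Re \<dots> = (nrm x)\<^sup>2 - 2 * Re (ip H x y) + (nrm y)\<^sup>2"
    using x y by (simp add: ip_self del: of_real_power)
  finally show ?thesis .
qed

lemma nrm_triangle: "x \<in> V \<Longrightarrow> y \<in> V \<Longrightarrow> nrm (x + y) \<le> nrm x + nrm y"
proof -
  assume x: "x \<in> V" and y: "y \<in> V"
  have "(nrm (x + y))\<^sup>2 \<le> (nrm x + nrm y)\<^sup>2"
    using nrm_add_sq[OF x y] cauchy_schwarz[OF x y] complex_Re_le_cmod[of "ip H x y"]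
    by (simp add: power2_sum)
  then show ?thesis by (rule power2_le_imp_le) (simp add: x y)
qed

lemma nrm_minus_commute: "x \<in> V \<Longrightarrow> y \<in> V \<Longrightarrow> nrm (x - y) = nrm (y - x)"
  using nrm_scale[of "y - x" "-1"] by simp

lemma nrm_triangle_diff: "x \<in> V \<Longrightarrow> y \<in> V \<Longrightarrow> z \<in> V \<Longrightarrow> nrm (x - z) \<le> nrm (x - y) + nrm (y - z)"
  using nrm_triangle[of "x - y" "y - z"] by simp

lemma nrm_le_add_diff: "x \<in> V \<Longrightarrow> y \<in> V \<Longrightarrow> nrm x \<le> nrm y + nrm (x - y)"
  using nrm_triangle[of y "x - y"] by simp

lemma complete:
  assumes "\<And>n::nat. X n \<in> V" and "\<And>e. e > 0 \<Longrightarrow> \<exists>N. \<forall>m\<ge>N. \<forall>n\<ge>N. nrm (X m - X n) < e"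
  obtains x where "x \<in> V" "(\<lambda>n. nrm (X n - x)) \<longlonglongrightarrow> 0"
proof -
  have "(\<forall>n. X n \<in> V) \<and> (\<forall>e>0. \<exists>N. \<forall>m\<ge>N. \<forall>n\<ge>N. nrm (X m - X n) < e)
      \<longrightarrow> (\<exists>x\<in>V. (\<lambda>n. nrm (X n - x)) \<longlonglongrightarrow> 0)"
    using hilbert_space[unfolded hilbert_space_def, THEN conjunct2, THEN conjunct2, THEN conjunct2,
      THEN conjunct2, THEN conjunct2] by (rule spec)
  moreover have "(\<forall>n. X n \<in> V) \<and> (\<forall>e>0. \<exists>N. \<forall>m\<ge>N. \<forall>n\<ge>N. nrm (X m - X n) < e)"
    using assms by (intro conjI allI impI)
  ultimately have "\<exists>x\<in>V. (\<lambda>n. nrm (X n - x)) \<longlonglongrightarrow> 0" by (rule mp)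
  then show thesis using that by (elim bexE)
qed

lemma tendsto_ip_right:
  assumes "\<And>n::nat. X n \<in> V" "x \<in> V" "y \<in> V" "(\<lambda>n. nrm (X n - x)) \<longlonglongrightarrow> 0"
  shows "(\<lambda>n. ip H y (X n)) \<longlonglongrightarrow> ip H y x"
proof (rule LIM_zero_cancel, rule Lim_null_comparison)
  show "\<forall>\<^sub>F n in sequentially. norm (ip H y (X n) - ip H y x) \<le> nrm y * nrm (X n - x)"
  proof (rule always_eventually, rule allI)
    fix n
    have "ip H y (X n) - ip H y x = ip H y (X n - x)" using assms by simp
    then show "norm (ip H y (X n) - ip H y x) \<le> nrm y * nrm (X n - x)"
      using cauchy_schwarz[of y "X n - x"] assms by simp
  qed
  show "(\<lambda>n. nrm y * nrm (X n - x)) \<longlonglongrightarrow> 0" using tendsto_mult_right_zero[OF assms(4)] .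
qed

lemma tendsto_nrm:
  assumes "\<And>n::nat. X n \<in> V" "x \<in> V" "(\<lambda>n. nrm (X n - x)) \<longlonglongrightarrow> 0"
  shows "(\<lambda>n. nrm (X n)) \<longlonglongrightarrow> nrm x"
proof (rule LIM_zero_cancel, rule Lim_null_comparison)
  show "\<forall>\<^sub>F n in sequentially. norm (nrm (X n) - nrm x) \<le> nrm (X n - x)"
  proof (rule always_eventually, rule allI)
    fix n
    show "norm (nrm (X n) - nrm x) \<le> nrm (X n - x)"
      using nrm_le_add_diff[of "X n" x] nrm_le_add_diff[of x "X n"] nrm_minus_commute[of x "X n"] assms
      by (simp add: abs_le_iff)
  qed
qed (rule assms)

text \<open>
  The Riesz representation theorem for a functional \<open>L\<close> on a vector space \<open>W\<close> that is bounded with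
  respect to the seminorm pulled back from \<open>H\<close> along a linear map \<open>e\<close>. Working along \<open>e\<close> serves the
  GNS construction, where \<open>W\<close> is the group algebra and \<open>e\<close> is neither injective nor onto. By the
  parallelogram law the images of a minimising sequence of \<open>\<parallel>e w\<parallel>\<^sup>2 - 2 Re L(w)\<close> form a Cauchy
  sequence, and its limit represents \<open>L\<close>.
\<close>

lemma riesz:
  fixes e :: "'c::complex_vector \<Rightarrow> 'v" and L :: "'c \<Rightarrow> complex"
  assumes W: "csubspace W" and eV: "\<And>w. w \<in> W \<Longrightarrow> e w \<in> V"
    and eadd: "\<And>v w. v \<in> W \<Longrightarrow> w \<in> W \<Longrightarrow> e (v + w) = e v + e w"
    and esc: "\<And>c w. w \<in> W \<Longrightarrow> e (c *\<^sub>C w) = c *\<^sub>C e w"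
    and Ladd: "\<And>v w. v \<in> W \<Longrightarrow> w \<in> W \<Longrightarrow> L (v + w) = L v + L w"
    and Lsc: "\<And>c w. w \<in> W \<Longrightarrow> L (c *\<^sub>C w) = c * L w"
    and bd: "\<And>w. w \<in> W \<Longrightarrow> cmod (L w) \<le> M * nrm (e w)"
    and M: "0 \<le> M"
  shows "\<exists>z\<in>V. (\<forall>w\<in>W. ip H (e w) z = L w) \<and> nrm z \<le> M"
proof -
  define J where "J w = (nrm (e w))\<^sup>2 - 2 * Re (L w)" for w
  have Jlow: "- M\<^sup>2 \<le> J w" if "w \<in> W" for w
  proof -
    have "Re (L w) \<le> M * nrm (e w)" using bd[OF that] complex_Re_le_cmod order_trans by blast
    moreover have "0 \<le> (nrm (e w) - M)\<^sup>2" by simp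
    ultimately show ?thesis unfolding J_def power2_diff mult.commute[of M] by linarith
  qed
  have W0: "0 \<in> W" using W by (rule cvs.subspace_0)
  define m where "m = Inf (J ` W)"
  have bdd: "bdd_below (J ` W)" by (rule bdd_belowI2[where m = "- M\<^sup>2"]) (rule Jlow)
  have mle: "m \<le> J w" if "w \<in> W" for w unfolding m_def using bdd that by (intro cInf_lower) auto
  have "\<exists>w\<in>W. J w < m + 1 / real (Suc n)" for n
  proof -
    have "Inf (J ` W) < m + 1 / real (Suc n)" unfolding m_def by simp
    then show ?thesis using cInf_less_iff[of "J ` W"] bdd W0 by auto
  qed
  then obtain w where wW: "\<And>n. w n \<in> W" and wJ: "\<And>n. J (w n) < m + 1 / real (Suc n)" by metis
  have par: "(nrm (e u - e v))\<^sup>2 \<le> 2 * (J u - m) + 2 * (J v - m)" if u: "u \<in> W" and v: "v \<in> W" for u v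
  proof -
    have uv: "u + v \<in> W" using W u v by (rule cvs.subspace_add)
    then have h: "(1/2) *\<^sub>C (u + v) \<in> W" using W by (intro cvs.subspace_scale)
    have eh: "e ((1/2) *\<^sub>C (u + v)) = (1/2) *\<^sub>C (e u + e v)" using u v uv by (simp add: eadd esc)
    have "(nrm (e ((1/2) *\<^sub>C (u + v))))\<^sup>2 = (nrm (e u + e v))\<^sup>2 / 4"
      unfolding eh using u v eV by (simp add: norm_divide power_divide)
    moreover have "2 * Re (L ((1/2) *\<^sub>C (u + v))) = Re (L u) + Re (L v)"
      using u v uv by (simp add: Ladd Lsc)
    ultimately have "m \<le> (nrm (e u + e v))\<^sup>2 / 4 - (Re (L u) + Re (L v))"
      using mle[OF h] by (simp add: J_def)
    then show ?thesis
      using nrm_add_sq[OF eV[OF u] eV[OF v]] nrm_diff_sq[OF eV[OF u] eV[OF v]] unfolding J_def by argo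
  qed
  have cau: "\<exists>N. \<forall>p\<ge>N. \<forall>q\<ge>N. nrm (e (w p) - e (w q)) < \<epsilon>" if "\<epsilon> > 0" for \<epsilon>
  proof -
    have "\<epsilon>\<^sup>2 / 4 > 0" using that by simp
    then obtain N where "inverse (real (Suc N)) < \<epsilon>\<^sup>2 / 4"
      using reals_Archimedean by blast
    then have N: "1 / real (Suc N) < \<epsilon>\<^sup>2 / 4" by (simp only: inverse_eq_divide)
    have "nrm (e (w p) - e (w q)) < \<epsilon>" if "p \<ge> N" "q \<ge> N" for p q
    proof -
      have "1 / real (Suc p) \<le> 1 / real (Suc N)" "1 / real (Suc q) \<le> 1 / real (Suc N)"
        using that by (auto simp: field_simps)
      then have "(nrm (e (w p) - e (w q)))\<^sup>2 < \<epsilon>\<^sup>2"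
        using par[OF wW[of p] wW[of q]] wJ[of p] wJ[of q] N by argo
      then show ?thesis using \<open>\<epsilon> > 0\<close> by (simp add: power_less_imp_less_base)
    qed
    then show ?thesis by blast
  qed
  obtain z where z: "z \<in> V" and lim: "(\<lambda>n. nrm (e (w n) - z)) \<longlonglongrightarrow> 0"
    using complete[of "\<lambda>n. e (w n)"] eV wW cau by blast
  have ipz: "ip H (e v) z = L v" if v: "v \<in> W" for v
  proof -
    define d where "d = ip H (e v) z - L v"
    have key: "- (1 / real (Suc n)) \<le> 2 * Re (c * (ip H (e v) (e (w n)) - L v)) + (cmod c)\<^sup>2 * (nrm (e v))\<^sup>2" for c n
    proof -
      have cv: "c *\<^sub>C v \<in> W" using W v by (rule cvs.subspace_scale)
      have "c *\<^sub>C v + w n \<in> W" using W cv wW by (intro cvs.subspace_add)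
      from mle[OF this] have "m \<le> J (c *\<^sub>C v + w n)" .
      also have "\<dots> = J (w n) + 2 * Re (c * (ip H (e v) (e (w n)) - L v)) + (cmod c)\<^sup>2 * (nrm (e v))\<^sup>2"
        unfolding J_def using nrm_add_sq[of "e (c *\<^sub>C v)" "e (w n)"] eV[OF v] eV[OF wW[of n]] cv v wW[of n]
        by (simp add: eadd esc Ladd Lsc power_mult_distrib algebra_simps)
      finally show ?thesis using wJ[of n] by linarith
    qed
    have key2: "0 \<le> 2 * Re (c * d) + (cmod c)\<^sup>2 * (nrm (e v))\<^sup>2" for c
    proof (rule LIMSEQ_le)
      show "(\<lambda>n. - (1 / real (Suc n))) \<longlonglongrightarrow> 0"
        using tendsto_minus[OF LIMSEQ_inverse_real_of_nat] by (simp only: inverse_eq_divide minus_zero)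
      show "(\<lambda>n. 2 * Re (c * (ip H (e v) (e (w n)) - L v)) + (cmod c)\<^sup>2 * (nrm (e v))\<^sup>2)
        \<longlonglongrightarrow> 2 * Re (c * d) + (cmod c)\<^sup>2 * (nrm (e v))\<^sup>2"
        unfolding d_def using eV wW z lim v
        by (intro tendsto_intros tendsto_ip_right) auto
      show "\<exists>N. \<forall>n\<ge>N. - (1 / real (Suc n)) \<le> 2 * Re (c * (ip H (e v) (e (w n)) - L v)) + (cmod c)\<^sup>2 * (nrm (e v))\<^sup>2"
        using key by blast
    qed
    \<comment> \<open>Moving from the minimiser in the direction \<open>- s d\<close> would decrease the functional unless \<open>d = 0\<close>;
      the step \<open>s\<close> is small enough for the linear term to dominate the quadratic one.\<close>
    define s where "s = 1 / ((nrm (e v))\<^sup>2 + 1)"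
    have sp: "s > 0" unfolding s_def by (simp add: add_nonneg_pos)
    have dd: "(- of_real s * cnj d) * d = - of_real (s * (cmod d)\<^sup>2)"
      using complex_norm_square[of d] by (simp add: algebra_simps)
    have "0 \<le> - 2 * (s * (cmod d)\<^sup>2) + s\<^sup>2 * (cmod d)\<^sup>2 * (nrm (e v))\<^sup>2"
      using key2[of "- of_real s * cnj d"] unfolding dd by (simp add: norm_mult power_mult_distrib)
    moreover have "s\<^sup>2 * (cmod d)\<^sup>2 * (nrm (e v))\<^sup>2 \<le> s * (cmod d)\<^sup>2"
    proof -
      have "s * (nrm (e v))\<^sup>2 \<le> 1" unfolding s_def by (simp add: divide_le_eq add_nonneg_pos)
      then have "(s * (cmod d)\<^sup>2) * (s * (nrm (e v))\<^sup>2) \<le> (s * (cmod d)\<^sup>2) * 1"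
        using sp by (intro mult_left_mono) auto
      then show ?thesis by (simp add: power2_eq_square algebra_simps)
    qed
    ultimately have "s * (cmod d)\<^sup>2 \<le> 0" by linarith
    then have "d = 0" using sp by (simp add: mult_le_0_iff)
    then show ?thesis by (simp add: d_def)
  qed
  have "nrm z \<le> M"
  proof -
    have "(\<lambda>n. cmod (ip H z (e (w n)))) \<longlonglongrightarrow> cmod (ip H z z)"
      using eV wW z lim by (intro tendsto_intros tendsto_ip_right) auto
    moreover have "(\<lambda>n. M * nrm (e (w n))) \<longlonglongrightarrow> M * nrm z"
      using eV wW z lim by (intro tendsto_intros tendsto_nrm) auto
    moreover have "cmod (ip H z (e (w n))) \<le> M * nrm (e (w n))" for n
      using bd[OF wW[of n]] ipz[OF wW[of n]] ip_sym[OF eV[OF wW[of n]] z] by simp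
    ultimately have "cmod (ip H z z) \<le> M * nrm z" by (intro LIMSEQ_le) auto
    then have "nrm z * nrm z \<le> M * nrm z" using ip_self[OF z] z
      by (simp add: norm_power power2_eq_square[symmetric] del: of_real_power)
    then show ?thesis using M z nrm_nonneg[OF z] by (cases "nrm z = 0") auto
  qed
  then show ?thesis using z ipz by blast
qed

end


section \<open>Bounded operators\<close>

context hilb begin

lemma bopI:
  assumes "\<And>x. x \<notin> V \<Longrightarrow> T x = 0" "\<And>x. x \<in> V \<Longrightarrow> T x \<in> V"
    "\<And>x y. x \<in> V \<Longrightarrow> y \<in> V \<Longrightarrow> T (x + y) = T x + T y"
    "\<And>c x. x \<in> V \<Longrightarrow> T (c *\<^sub>C x) = c *\<^sub>C T x"
    "\<And>x. x \<in> V \<Longrightarrow> nrm (T x) \<le> C * nrm x"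
  shows "T \<in> bop H"
  unfolding bop_def vanishes_off_def
proof (intro CollectI conjI allI impI ballI exI[of _ C])
qed (rule assms; assumption)+

lemma nrm_pos: "x \<in> V \<Longrightarrow> x \<noteq> 0 \<Longrightarrow> 0 < nrm x"
  unfolding less_le by auto

lemma bop_in [simp]: "T \<in> bop H \<Longrightarrow> x \<in> V \<Longrightarrow> T x \<in> V"
  and bop_add: "T \<in> bop H \<Longrightarrow> x \<in> V \<Longrightarrow> y \<in> V \<Longrightarrow> T (x + y) = T x + T y"
  and bop_scale: "T \<in> bop H \<Longrightarrow> x \<in> V \<Longrightarrow> T (c *\<^sub>C x) = c *\<^sub>C T x"
  and bop_off: "T \<in> bop H \<Longrightarrow> x \<notin> V \<Longrightarrow> T x = 0"
  and bop_bounded: "T \<in> bop H \<Longrightarrow> \<exists>C. \<forall>x\<in>V. nrm (T x) \<le> C * nrm x"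
  unfolding bop_def vanishes_off_def by blast+

lemma bop_zero [simp]: "T \<in> bop H \<Longrightarrow> T 0 = 0"
  using bop_scale[of T 0 0] by simp

lemma bop_diff: "T \<in> bop H \<Longrightarrow> x \<in> V \<Longrightarrow> y \<in> V \<Longrightarrow> T (x - y) = T x - T y"
  by (metis add_diff_cancel_right' bop_add diff_add_cancel diff_in)

lemma op_eqI: "S \<in> bop H \<Longrightarrow> T \<in> bop H \<Longrightarrow> (\<And>x. x \<in> V \<Longrightarrow> S x = T x) \<Longrightarrow> S = T"
proof (rule ext)
  fix x assume "S \<in> bop H" "T \<in> bop H" "\<And>x. x \<in> V \<Longrightarrow> S x = T x"
  then show "S x = T x" by (cases "x \<in> V") (auto simp: bop_off)
qed

lemma ip_eqI: "y \<in> V \<Longrightarrow> z \<in> V \<Longrightarrow> (\<And>x. x \<in> V \<Longrightarrow> ip H x y = ip H x z) \<Longrightarrow> y = z"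
proof -
  assume y: "y \<in> V" and z: "z \<in> V" and e: "\<And>x. x \<in> V \<Longrightarrow> ip H x y = ip H x z"
  have "ip H (y - z) (y - z) = 0" using e[of "y - z"] y z by (simp del: ip_diff_left)
  then have "y - z = 0" using y z by (intro ip_self_eq_0) auto
  then show "y = z" by simp
qed

lemma op_eq_ipI:
  assumes "S \<in> bop H" "T \<in> bop H" "\<And>x y. x \<in> V \<Longrightarrow> y \<in> V \<Longrightarrow> ip H x (S y) = ip H x (T y)"
  shows "S = T"
  by (rule op_eqI[OF assms(1,2)]) (rule ip_eqI, use assms in auto)

lemma bdd_above_opnorm:
  assumes "T \<in> bop H" shows "bdd_above {nrm (T x) |x. x \<in> V \<and> nrm x \<le> 1}"
proof -
  obtain C where C: "\<And>x. x \<in> V \<Longrightarrow> nrm (T x) \<le> C * nrm x" using bop_bounded[OF assms] by blast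
  have "nrm (T x) \<le> \<bar>C\<bar>" if "x \<in> V" "nrm x \<le> 1" for x
  proof -
    have "C * nrm x \<le> \<bar>C\<bar> * nrm x" using that by (intro mult_right_mono) auto
    also have "\<dots> \<le> \<bar>C\<bar> * 1" using that by (intro mult_left_mono) auto
    finally show ?thesis using C[OF that(1)] by simp
  qed
  then show ?thesis by (auto simp: bdd_above_def)
qed

lemma opnorm_apply:
  assumes T: "T \<in> bop H" and x: "x \<in> V" shows "nrm (T x) \<le> opnorm H T * nrm x"
proof (cases "x = 0")
  case True then show ?thesis using T by simp
next
  case False
  then have n: "nrm x > 0" using x nrm_nonneg[OF x] nrm_eq_0[OF x] by linarith
  define y where "y = complex_of_real (1 / nrm x) *\<^sub>C x"
  have "nrm y = cmod (complex_of_real (1 / nrm x)) * nrm x" unfolding y_def using x by (rule nrm_scale)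
  also have "\<dots> = 1" using n by (simp only: norm_of_real) simp
  finally have y: "y \<in> V" "nrm y \<le> 1" unfolding y_def using x by auto
  have "nrm (T y) \<le> opnorm H T" unfolding opnorm_def
    by (rule cSup_upper[OF _ bdd_above_opnorm[OF T]]) (use y in blast)
  moreover have "nrm (T y) = nrm (T x) / nrm x"
    unfolding y_def using T x n by (simp add: bop_scale norm_divide)
  ultimately show ?thesis using n by (simp add: divide_le_eq)
qed

lemma opnorm_le:
  assumes "\<And>x. x \<in> V \<Longrightarrow> nrm (T x) \<le> C * nrm x" and C: "0 \<le> C"
  shows "opnorm H T \<le> C"
  unfolding opnorm_def
proof (rule cSup_least)
  show "{nrm (T x) |x. x \<in> V \<and> nrm x \<le> 1} \<noteq> {}" using zero_in nrm_zero by (auto intro!: exI[of _ 0])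
  fix n assume "n \<in> {nrm (T x) |x. x \<in> V \<and> nrm x \<le> 1}"
  then obtain x where x: "n = nrm (T x)" "x \<in> V" "nrm x \<le> 1" by blast
  have "nrm (T x) \<le> C * nrm x" using assms x by blast
  also have "\<dots> \<le> C * 1" using x C by (intro mult_left_mono) auto
  finally show "n \<le> C" using x by simp
qed

lemma opnorm_nonneg: assumes T: "T \<in> bop H" shows "0 \<le> opnorm H T"
proof -
  have "nrm (T 0) \<le> opnorm H T" unfolding opnorm_def
    by (rule cSup_upper[OF _ bdd_above_opnorm[OF T]]) (use zero_in nrm_zero in force)
  then show ?thesis using T by simp
qed

lemma id_in [simp]: "id_op H \<in> bop H"
  by (rule bopI[where C = 1]) (auto simp: id_op_def)

lemma id_apply [simp]: "x \<in> V \<Longrightarrow> id_op H x = x" by (simp add: id_op_def)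

lemma comp_in [simp]: assumes S: "S \<in> bop H" and T: "T \<in> bop H" shows "S \<circ> T \<in> bop H"
proof (rule bopI[where C = "opnorm H S * opnorm H T"])
  fix x assume x: "x \<in> V"
  have "nrm (S (T x)) \<le> opnorm H S * nrm (T x)" using S T x by (intro opnorm_apply) auto
  also have "\<dots> \<le> opnorm H S * (opnorm H T * nrm x)"
    using S T x opnorm_nonneg opnorm_apply by (intro mult_left_mono) auto
  finally show "nrm ((S \<circ> T) x) \<le> opnorm H S * opnorm H T * nrm x" by (simp add: mult.assoc)
qed (use S T in \<open>auto simp: bop_off bop_add bop_scale\<close>)

lemma bop_subspace: "csubspace (bop H)"
proof (rule cvs.subspaceI)
  show "0 \<in> bop H" by (rule bopI[where C = 0]) (auto simp: zero_fun_def)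
next
  fix S T assume S: "S \<in> bop H" and T: "T \<in> bop H"
  show "S + T \<in> bop H"
  proof (rule bopI[where C = "opnorm H S + opnorm H T"])
    fix x assume x: "x \<in> V"
    show "nrm ((S + T) x) \<le> (opnorm H S + opnorm H T) * nrm x"
      using nrm_triangle[of "S x" "T x"] opnorm_apply[OF S x] opnorm_apply[OF T x] S T x
      by (simp add: algebra_simps)
  qed (use S T in \<open>auto simp: bop_off bop_add bop_scale scaleC_add_right\<close>)
next
  fix c T assume T: "T \<in> bop H"
  show "c *\<^sub>C T \<in> bop H"
  proof (rule bopI[where C = "cmod c * opnorm H T"])
    fix x assume x: "x \<in> V"
    show "nrm ((c *\<^sub>C T) x) \<le> cmod c * opnorm H T * nrm x"
      using opnorm_apply[OF T x] T x by (simp add: mult_left_mono mult.assoc)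
  qed (use T in \<open>auto simp: bop_off bop_add bop_scale scaleC_add_right mult.commute\<close>)
qed

lemma op_add_in [simp]: "S \<in> bop H \<Longrightarrow> T \<in> bop H \<Longrightarrow> S + T \<in> bop H" using bop_subspace by (rule cvs.subspace_add)
lemma op_diff_in [simp]: "S \<in> bop H \<Longrightarrow> T \<in> bop H \<Longrightarrow> S - T \<in> bop H" using bop_subspace by (rule cvs.subspace_diff)
lemma op_scale_in [simp]: "T \<in> bop H \<Longrightarrow> c *\<^sub>C T \<in> bop H" using bop_subspace by (rule cvs.subspace_scale)
lemma op_zero_in [simp]: "0 \<in> bop H" using bop_subspace by (rule cvs.subspace_0)

lemma opnorm_triangle: "S \<in> bop H \<Longrightarrow> T \<in> bop H \<Longrightarrow> opnorm H (S + T) \<le> opnorm H S + opnorm H T"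
proof (rule opnorm_le)
  fix x assume S: "S \<in> bop H" and T: "T \<in> bop H" and x: "x \<in> V"
  show "nrm ((S + T) x) \<le> (opnorm H S + opnorm H T) * nrm x"
    using nrm_triangle[of "S x" "T x"] opnorm_apply[OF S x] opnorm_apply[OF T x] S T x
    by (simp add: algebra_simps)
qed (simp add: opnorm_nonneg)

lemma opnorm_scale: "T \<in> bop H \<Longrightarrow> opnorm H (c *\<^sub>C T) \<le> cmod c * opnorm H T"
proof (rule opnorm_le)
  fix x assume T: "T \<in> bop H" and x: "x \<in> V"
  show "nrm ((c *\<^sub>C T) x) \<le> cmod c * opnorm H T * nrm x"
    using opnorm_apply[OF T x] T x by (simp add: mult_left_mono mult.assoc)
qed (simp add: opnorm_nonneg)

lemma opnorm_comp: assumes S: "S \<in> bop H" and T: "T \<in> bop H" shows "opnorm H (S \<circ> T) \<le> opnorm H S * opnorm H T"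
proof (rule opnorm_le)
  fix x assume x: "x \<in> V"
  have "nrm (S (T x)) \<le> opnorm H S * nrm (T x)" using S T x by (intro opnorm_apply) auto
  also have "\<dots> \<le> opnorm H S * (opnorm H T * nrm x)"
    using S T x opnorm_nonneg opnorm_apply by (intro mult_left_mono) auto
  finally show "nrm ((S \<circ> T) x) \<le> opnorm H S * opnorm H T * nrm x" by (simp add: mult.assoc)
qed (simp add: opnorm_nonneg S T)

lemma opnorm_zero [simp]: "opnorm H 0 = 0"
proof (rule antisym)
  show "opnorm H 0 \<le> 0" by (rule opnorm_le) auto
  show "0 \<le> opnorm H 0" by (rule opnorm_nonneg) simp
qed

lemma opnorm_id: "opnorm H (id_op H) \<le> 1" by (rule opnorm_le) auto

lemma opnorm_minus_commute: "S \<in> bop H \<Longrightarrow> T \<in> bop H \<Longrightarrow> opnorm H (S - T) = opnorm H (T - S)"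
proof -
  have *: "opnorm H (S - T) \<le> opnorm H (T - S)" if "S \<in> bop H" "T \<in> bop H" for S T
    using opnorm_scale[of "T - S" "-1"] that by simp
  assume "S \<in> bop H" "T \<in> bop H"
  then show ?thesis using * by (intro antisym) auto
qed

lemma opnorm_triangle_diff:
  "R \<in> bop H \<Longrightarrow> S \<in> bop H \<Longrightarrow> T \<in> bop H \<Longrightarrow> opnorm H (R - T) \<le> opnorm H (R - S) + opnorm H (S - T)"
  using opnorm_triangle[of "R - S" "S - T"] by simp

lemma opnorm_le_add_diff: "S \<in> bop H \<Longrightarrow> T \<in> bop H \<Longrightarrow> opnorm H S \<le> opnorm H T + opnorm H (S - T)"
  using opnorm_triangle[of T "S - T"] by simp

lemma comp_id [simp]: "T \<in> bop H \<Longrightarrow> T \<circ> id_op H = T"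
  and id_comp [simp]: "T \<in> bop H \<Longrightarrow> id_op H \<circ> T = T"
  by (rule op_eqI, auto)+

lemma comp_add_left: "(S + T) \<circ> R = (S \<circ> R) + (T \<circ> (R :: 'v \<Rightarrow> 'v))"
  and comp_diff_left: "(S - T) \<circ> R = (S \<circ> R) - (T \<circ> (R :: 'v \<Rightarrow> 'v))"
  and comp_scale_left: "(c *\<^sub>C S) \<circ> R = c *\<^sub>C (S \<circ> (R :: 'v \<Rightarrow> 'v))"
  for S T :: "'v \<Rightarrow> 'v"
  by (auto simp: fun_eq_iff)

lemma comp_add_right: "R \<in> bop H \<Longrightarrow> S \<in> bop H \<Longrightarrow> T \<in> bop H \<Longrightarrow> R \<circ> (S + T) = (R \<circ> S) + (R \<circ> T)"
  by (rule op_eqI) (auto simp: bop_add)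

lemma comp_diff_right: "R \<in> bop H \<Longrightarrow> S \<in> bop H \<Longrightarrow> T \<in> bop H \<Longrightarrow> R \<circ> (S - T) = (R \<circ> S) - (R \<circ> T)"
  by (rule op_eqI) (auto simp: bop_diff)

lemma comp_scale_right: "R \<in> bop H \<Longrightarrow> S \<in> bop H \<Longrightarrow> R \<circ> (c *\<^sub>C S) = c *\<^sub>C (R \<circ> S)"
  by (rule op_eqI) (auto simp: bop_scale)

subsection \<open>Adjoints\<close>

lemma adjoint_exists:
  assumes T: "T \<in> bop H"
  shows "\<exists>S\<in>bop H. \<forall>x\<in>V. \<forall>y\<in>V. ip H (T x) y = ip H x (S y)"
proof -
  have ex: "\<exists>z\<in>V. (\<forall>x\<in>V. ip H x z = ip H (T x) y) \<and> nrm z \<le> opnorm H T * nrm y" if y: "y \<in> V" for y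
  proof (rule riesz[OF subspace])
    fix x assume x: "x \<in> V"
    have "cmod (ip H (T x) y) \<le> nrm (T x) * nrm y" using T x y by (intro cauchy_schwarz) auto
    also have "\<dots> \<le> (opnorm H T * nrm x) * nrm y"
      using opnorm_apply[OF T x] y by (intro mult_right_mono) auto
    finally show "cmod (ip H (T x) y) \<le> opnorm H T * nrm y * nrm x" by (simp add: mult_ac)
  qed (use T y opnorm_nonneg in \<open>auto simp: bop_add bop_scale\<close>)
  define S where "S y = (if y \<in> V then SOME z. z \<in> V \<and> (\<forall>x\<in>V. ip H x z = ip H (T x) y) \<and>
      nrm z \<le> opnorm H T * nrm y else 0)" for y
  have S: "S y \<in> V" "\<And>x. x \<in> V \<Longrightarrow> ip H x (S y) = ip H (T x) y" "nrm (S y) \<le> opnorm H T * nrm y"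
    if y: "y \<in> V" for y
  proof -
    have "S y \<in> V \<and> (\<forall>x\<in>V. ip H x (S y) = ip H (T x) y) \<and> nrm (S y) \<le> opnorm H T * nrm y"
      unfolding S_def using y ex[OF y] by (simp only: if_True) (rule someI_ex, blast)
    then show "S y \<in> V" "\<And>x. x \<in> V \<Longrightarrow> ip H x (S y) = ip H (T x) y" "nrm (S y) \<le> opnorm H T * nrm y"
      by auto
  qed
  have "S \<in> bop H"
  proof (rule bopI[where C = "opnorm H T"])
    fix x y assume x: "x \<in> V" and y: "y \<in> V"
    show "S (x + y) = S x + S y"
      by (rule ip_eqI) (use T x y S in auto)
  next
    fix c x assume x: "x \<in> V"
    show "S (c *\<^sub>C x) = c *\<^sub>C S x"
      by (rule ip_eqI) (use T x S in auto)
  qed (use S in \<open>auto simp: S_def\<close>)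
  then show ?thesis by (rule bexI[rotated]) (simp add: S)
qed

lemma adjoint_unique:
  assumes "R \<in> bop H" "S \<in> bop H" "\<And>x y. x \<in> V \<Longrightarrow> y \<in> V \<Longrightarrow> ip H (T x) y = ip H x (R y)"
    "\<And>x y. x \<in> V \<Longrightarrow> y \<in> V \<Longrightarrow> ip H (T x) y = ip H x (S y)"
  shows "R = S"
  by (rule op_eq_ipI[OF assms(1,2)]) (metis assms(3,4))

lemma adj_ex1:
  assumes T: "T \<in> bop H"
  shows "\<exists>!S. S \<in> bop H \<and> (\<forall>x\<in>V. \<forall>y\<in>V. ip H (T x) y = ip H x (S y))"
  using adjoint_exists[OF T] by (auto intro!: adjoint_unique)

lemma adj_in [simp]: "T \<in> bop H \<Longrightarrow> adj H T \<in> bop H"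
  and adj_ip: "T \<in> bop H \<Longrightarrow> x \<in> V \<Longrightarrow> y \<in> V \<Longrightarrow> ip H (T x) y = ip H x (adj H T y)"
  using theI'[OF adj_ex1, of T] unfolding adj_def by auto

lemma adj_ip': "T \<in> bop H \<Longrightarrow> x \<in> V \<Longrightarrow> y \<in> V \<Longrightarrow> ip H (adj H T x) y = ip H x (T y)"
  by (metis adj_in adj_ip bop_in ip_sym)

lemma adj_eqI: "T \<in> bop H \<Longrightarrow> S \<in> bop H \<Longrightarrow>
    (\<And>x y. x \<in> V \<Longrightarrow> y \<in> V \<Longrightarrow> ip H (T x) y = ip H x (S y)) \<Longrightarrow> adj H T = S"
  by (rule adjoint_unique[where T = T]) (auto simp: adj_ip)

lemma adj_adj [simp]: "T \<in> bop H \<Longrightarrow> adj H (adj H T) = T"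
  by (rule adj_eqI) (auto simp: adj_ip')

lemma adj_add: "S \<in> bop H \<Longrightarrow> T \<in> bop H \<Longrightarrow> adj H (S + T) = adj H S + adj H T"
  by (rule adj_eqI) (auto simp: adj_ip)

lemma adj_diff: "S \<in> bop H \<Longrightarrow> T \<in> bop H \<Longrightarrow> adj H (S - T) = adj H S - adj H T"
  by (rule adj_eqI) (auto simp: adj_ip)

lemma adj_scale: "T \<in> bop H \<Longrightarrow> adj H (c *\<^sub>C T) = cnj c *\<^sub>C adj H T"
  by (rule adj_eqI) (auto simp: adj_ip)

lemma adj_comp: "S \<in> bop H \<Longrightarrow> T \<in> bop H \<Longrightarrow> adj H (S \<circ> T) = adj H T \<circ> adj H S"
  by (rule adj_eqI) (auto simp: adj_ip)

lemma adj_id [simp]: "adj H (id_op H) = id_op H"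
  by (rule adj_eqI) auto

lemma adj_zero [simp]: "adj H 0 = 0"
  by (rule adj_eqI) auto

lemma nrm_adj_apply: assumes T: "T \<in> bop H" and x: "x \<in> V" shows "(nrm (T x))\<^sup>2 = Re (ip H (adj H T (T x)) x)"
proof -
  have "ip H (adj H T (T x)) x = ip H (T x) (T x)" using T x by (simp add: adj_ip')
  then show ?thesis using T x ip_self[of "T x"] by simp
qed

lemma opnorm_adj_le: assumes T: "T \<in> bop H" shows "opnorm H (adj H T) \<le> opnorm H T"
proof (rule opnorm_le)
  fix y assume y: "y \<in> V"
  have "(nrm (adj H T y))\<^sup>2 = Re (ip H (T (adj H T y)) y)"
    using nrm_adj_apply[of "adj H T" y] T y by simp
  also have "\<dots> \<le> nrm (T (adj H T y)) * nrm y"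
    using cauchy_schwarz[of "T (adj H T y)" y] complex_Re_le_cmod[of "ip H (T (adj H T y)) y"] T y by simp
  also have "\<dots> \<le> (opnorm H T * nrm (adj H T y)) * nrm y"
    using T y by (intro mult_right_mono opnorm_apply) auto
  finally have *: "nrm (adj H T y) * nrm (adj H T y) \<le> nrm (adj H T y) * (opnorm H T * nrm y)"
    by (simp add: power2_eq_square mult_ac)
  have n: "0 \<le> nrm (adj H T y)" and m: "0 \<le> opnorm H T * nrm y" using T y opnorm_nonneg by auto
  show "nrm (adj H T y) \<le> opnorm H T * nrm y"
  proof (cases "nrm (adj H T y) = 0")
    case True then show ?thesis using m by linarith
  next
    case False
    then have "0 < nrm (adj H T y)" using n by linarith
    then show ?thesis using * by (simp only: mult_le_cancel_left_pos)
  qed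
qed (use T opnorm_nonneg in auto)

text \<open>
  Polarisation turns the bound on the quadratic form into one on \<open>Re \<langle>T x, y\<rangle>\<close>, which is used for
  the multiple \<open>y\<close> of \<open>T x\<close> that has the norm of \<open>x\<close>.
\<close>

lemma self_adjoint_numerical_radius:
  assumes T: "T \<in> bop H" and sa: "adj H T = T" and e: "0 \<le> e"
    and bd: "\<And>x. x \<in> V \<Longrightarrow> \<bar>Re (ip H (T x) x)\<bar> \<le> e * (nrm x)\<^sup>2"
  shows "opnorm H T \<le> e"
proof (rule opnorm_le[OF _ e])
  fix x assume x: "x \<in> V"
  have pol: "4 * Re (ip H (T x) y) \<le> 2 * e * ((nrm x)\<^sup>2 + (nrm y)\<^sup>2)" if y: "y \<in> V" for y
  proof -
    have "ip H (T y) x = cnj (ip H (T x) y)"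
      using adj_ip[OF T y x] ip_sym[of "T x" y] sa T x y by simp
    then have "Re (ip H (T (x + y)) (x + y)) - Re (ip H (T (x - y)) (x - y)) = 4 * Re (ip H (T x) y)"
      using T x y by (simp add: bop_add bop_diff)
    moreover have "Re (ip H (T (x + y)) (x + y)) \<le> e * (nrm (x + y))\<^sup>2"
      and "- (e * (nrm (x - y))\<^sup>2) \<le> Re (ip H (T (x - y)) (x - y))"
      using bd[of "x + y"] bd[of "x - y"] x y by (auto simp: abs_le_iff)
    moreover have "e * (nrm (x + y))\<^sup>2 + e * (nrm (x - y))\<^sup>2 = 2 * e * ((nrm x)\<^sup>2 + (nrm y)\<^sup>2)"
    proof -
      have "(nrm (x + y))\<^sup>2 + (nrm (x - y))\<^sup>2 = 2 * ((nrm x)\<^sup>2 + (nrm y)\<^sup>2)"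
        unfolding nrm_add_sq[OF x y] nrm_diff_sq[OF x y] by simp
      then show ?thesis unfolding distrib_left[symmetric] by simp
    qed
    ultimately show ?thesis by linarith
  qed
  show "nrm (T x) \<le> e * nrm x"
  proof (cases "nrm (T x) = 0 \<or> nrm x = 0")
    case True
    then show ?thesis
    proof
      assume "nrm x = 0" then have "x = 0" using x by simp
      then show ?thesis using T by simp
    qed (use e x in simp)
  next
    case False
    then have p: "0 < nrm (T x)" "0 < nrm x" using nrm_pos[of x] nrm_pos[of "T x"] T x by auto
    define t where "t = nrm x / nrm (T x)"
    have t: "0 < t" unfolding t_def using p by simp
    have y: "of_real t *\<^sub>C T x \<in> V" using T x by auto
    have "cmod (of_real t) = t" using t by simp
    then have "nrm (of_real t *\<^sub>C T x) = t * nrm (T x)" using nrm_scale[of "T x" "of_real t"] T x by simp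
    then have "nrm (of_real t *\<^sub>C T x) = nrm x" unfolding t_def using p by simp
    moreover have "Re (ip H (T x) (of_real t *\<^sub>C T x)) = t * (nrm (T x))\<^sup>2"
      using T x by (simp add: ip_self del: of_real_power)
    ultimately have a: "4 * (t * (nrm (T x))\<^sup>2) \<le> 2 * e * ((nrm x)\<^sup>2 + (nrm x)\<^sup>2)"
      using pol[OF y] by simp
    have b: "t * (nrm (T x))\<^sup>2 = nrm x * nrm (T x)"
      unfolding t_def using p by (simp add: power2_eq_square)
    have "nrm x * nrm (T x) \<le> nrm x * (e * nrm x)"
      using a[unfolded b] by (simp add: power2_eq_square algebra_simps)
    then show ?thesis using p by simp
  qed
qed

subsection \<open>Completeness\<close>

lemma bop_complete:
  assumes X: "\<And>n::nat. X n \<in> bop H"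
    and cau: "\<And>e. e > 0 \<Longrightarrow> \<exists>N. \<forall>m\<ge>N. \<forall>n\<ge>N. opnorm H (X m - X n) < e"
  shows "\<exists>T\<in>bop H. (\<lambda>n. opnorm H (X n - T)) \<longlonglongrightarrow> 0"
proof -
  have pd: "nrm (X m x - X n x) \<le> opnorm H (X m - X n) * nrm x" if "x \<in> V" for m n x
    using opnorm_apply[of "X m - X n" x] X that by simp
  have "\<exists>y\<in>V. (\<lambda>n. nrm (X n x - y)) \<longlonglongrightarrow> 0" if x: "x \<in> V" for x
  proof -
    have "\<exists>N. \<forall>m\<ge>N. \<forall>n\<ge>N. nrm (X m x - X n x) < e" if e: "e > 0" for e
    proof -
      have pos: "nrm x + 1 > 0" using nrm_nonneg[OF x] by linarith
      obtain N where N: "\<And>m n. m \<ge> N \<Longrightarrow> n \<ge> N \<Longrightarrow> opnorm H (X m - X n) < e / (nrm x + 1)"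
        using cau[of "e / (nrm x + 1)"] e pos by auto
      have "nrm (X m x - X n x) < e" if "m \<ge> N" "n \<ge> N" for m n
      proof -
        have "opnorm H (X m - X n) * nrm x \<le> opnorm H (X m - X n) * (nrm x + 1)"
          using opnorm_nonneg[of "X m - X n"] X by (intro mult_left_mono) auto
        also have "\<dots> < e" using N[OF that] pos by (simp add: less_divide_eq)
        finally show ?thesis using pd[OF x, of m n] by linarith
      qed
      then show ?thesis by blast
    qed
    then show ?thesis using complete[of "\<lambda>n. X n x"] X x by (metis bop_in)
  qed
  then obtain L where L: "\<And>x. x \<in> V \<Longrightarrow> L x \<in> V" "\<And>x. x \<in> V \<Longrightarrow> (\<lambda>n. nrm (X n x - L x)) \<longlonglongrightarrow> 0"
    by metis
  define T where "T x = (if x \<in> V then L x else 0)" for x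
  have T: "T x \<in> V" "(\<lambda>n. nrm (X n x - T x)) \<longlonglongrightarrow> 0" if "x \<in> V" for x
    using L that by (auto simp: T_def)
  have uniq: "y = z" if "y \<in> V" "z \<in> V" "\<And>n. Y n \<in> V" "(\<lambda>n. nrm (Y n - y)) \<longlonglongrightarrow> 0" "(\<lambda>n. nrm (Y n - z)) \<longlonglongrightarrow> 0"
    for y z and Y :: "nat \<Rightarrow> 'v"
  proof (rule ip_eqI[OF that(1,2)])
    fix x assume x: "x \<in> V"
    show "ip H x y = ip H x z"
      using tendsto_ip_right[OF that(3,1) x that(4)] tendsto_ip_right[OF that(3,2) x that(5)]
      by (rule LIMSEQ_unique)
  qed
  obtain N0 where N0: "\<And>m n. m \<ge> N0 \<Longrightarrow> n \<ge> N0 \<Longrightarrow> opnorm H (X m - X n) < 1"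
    using cau[of 1] by auto
  define B where "B = opnorm H (X N0) + 1"
  have B: "nrm (X n x) \<le> B * nrm x" if "n \<ge> N0" "x \<in> V" for n x
  proof -
    have "opnorm H (X n) \<le> B"
      using opnorm_le_add_diff[of "X n" "X N0"] N0[of n N0] X that unfolding B_def by auto
    then show ?thesis using opnorm_apply[of "X n" x] X that nrm_nonneg[of x]
      by (meson mult_right_mono order_trans)
  qed
  have Tb: "T \<in> bop H"
  proof (rule bopI[where C = B])
    fix x y assume x: "x \<in> V" and y: "y \<in> V"
    have "(\<lambda>n. nrm (X n (x + y) - (T x + T y))) \<longlonglongrightarrow> 0"
    proof (rule Lim_null_comparison)
      show "(\<lambda>n. nrm (X n x - T x) + nrm (X n y - T y)) \<longlonglongrightarrow> 0"
        using tendsto_add[OF T(2)[OF x] T(2)[OF y]] by simp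
      show "\<forall>\<^sub>F n in sequentially. norm (nrm (X n (x + y) - (T x + T y))) \<le> nrm (X n x - T x) + nrm (X n y - T y)"
      proof (rule always_eventually, rule allI)
        fix n
        have e: "X n (x + y) - (T x + T y) = (X n x - T x) + (X n y - T y)"
          using X x y by (simp add: bop_add)
        show "norm (nrm (X n (x + y) - (T x + T y))) \<le> nrm (X n x - T x) + nrm (X n y - T y)"
          unfolding e using nrm_triangle[of "X n x - T x" "X n y - T y"] X x y T by simp
      qed
    qed
    then show "T (x + y) = T x + T y"
      using T X x y by (intro uniq[where Y = "\<lambda>n. X n (x + y)"]) auto
  next
    fix c x assume x: "x \<in> V"
    have "(\<lambda>n. nrm (X n (c *\<^sub>C x) - c *\<^sub>C T x)) = (\<lambda>n. cmod c * nrm (X n x - T x))"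
    proof
      fix n
      have "X n (c *\<^sub>C x) - c *\<^sub>C T x = c *\<^sub>C (X n x - T x)"
        using X x by (simp add: bop_scale cvs.scale_right_diff_distrib)
      then show "nrm (X n (c *\<^sub>C x) - c *\<^sub>C T x) = cmod c * nrm (X n x - T x)" using X x T by simp
    qed
    then have "(\<lambda>n. nrm (X n (c *\<^sub>C x) - c *\<^sub>C T x)) \<longlonglongrightarrow> 0"
      using tendsto_mult_right_zero[OF T(2)[OF x]] by simp
    then show "T (c *\<^sub>C x) = c *\<^sub>C T x"
      using T X x by (intro uniq[where Y = "\<lambda>n. X n (c *\<^sub>C x)"]) auto
  next
    fix x assume x: "x \<in> V"
    have "(\<lambda>n. nrm (X n x)) \<longlonglongrightarrow> nrm (T x)" using X x T by (intro tendsto_nrm) auto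
    then show "nrm (T x) \<le> B * nrm x"
      by (rule LIMSEQ_le_const2) (use B x in blast)
  qed (use T in \<open>auto simp: T_def\<close>)
  have "(\<lambda>n. opnorm H (X n - T)) \<longlonglongrightarrow> 0"
  proof (rule LIMSEQ_I)
    fix e :: real assume e: "e > 0"
    obtain N where N: "\<And>m n. m \<ge> N \<Longrightarrow> n \<ge> N \<Longrightarrow> opnorm H (X m - X n) < e / 2"
      using cau[of "e/2"] e by auto
    have "opnorm H (X n - T) \<le> e / 2" if n: "n \<ge> N" for n
    proof (rule opnorm_le)
      fix x assume x: "x \<in> V"
      have "(\<lambda>m. e / 2 * nrm x + nrm (X m x - T x)) \<longlonglongrightarrow> e / 2 * nrm x + 0"
        by (intro tendsto_add tendsto_const T x)
      moreover have "nrm (X n x - T x) \<le> e / 2 * nrm x + nrm (X m x - T x)" if m: "m \<ge> N" for m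
      proof -
        have "opnorm H (X n - X m) * nrm x \<le> e / 2 * nrm x"
          using N[OF n m] x by (intro mult_right_mono) auto
        then show ?thesis
          using nrm_triangle_diff[of "X n x" "X m x" "T x"] pd[OF x, of n m] X x T by simp
      qed
      ultimately have "nrm (X n x - T x) \<le> e / 2 * nrm x + 0"
        by (intro LIMSEQ_le_const) blast+
      then show "nrm ((X n - T) x) \<le> e / 2 * nrm x" by simp
    qed (use e in simp)
    moreover have "0 \<le> opnorm H (X n - T)" for n using X Tb by (intro opnorm_nonneg) auto
    ultimately have "\<forall>n\<ge>N. norm (opnorm H (X n - T) - 0) < e" using e by force
    then show "\<exists>N. \<forall>n\<ge>N. norm (opnorm H (X n - T) - 0) < e" by blast
  qed
  then show ?thesis using Tb by blast
qed

end


section \<open>Positive functionals\<close>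

text \<open>
  No closedness is required: both \<open>C\<^sup>*\<^sub>\<pi>(\<Gamma>)\<close> and the linear span of \<open>\<pi>(\<Gamma>)\<close> are meant to be instances.
\<close>

definition star_alg :: "'v::complex_vector hilbert \<Rightarrow> ('v \<Rightarrow> 'v) set \<Rightarrow> bool" where
  "star_alg H A \<longleftrightarrow> A \<subseteq> bop H \<and> csubspace A \<and> id_op H \<in> A \<and>
     (\<forall>S\<in>A. \<forall>T\<in>A. S \<circ> T \<in> A) \<and> (\<forall>T\<in>A. adj H T \<in> A)"

definition positive_functional ::
  "'v::complex_vector hilbert \<Rightarrow> ('v \<Rightarrow> 'v) set \<Rightarrow> (('v \<Rightarrow> 'v) \<Rightarrow> complex) \<Rightarrow> bool" where
  "positive_functional H A \<phi> \<longleftrightarrow>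
     (\<forall>S\<in>A. \<forall>T\<in>A. \<phi> (S + T) = \<phi> S + \<phi> T) \<and>
     (\<forall>c. \<forall>T\<in>A. \<phi> (c *\<^sub>C T) = c * \<phi> T) \<and>
     (\<forall>T\<in>A. \<phi> (adj H T \<circ> T) \<in> \<real>\<^sub>\<ge>\<^sub>0)"

lemma state_imp_positive_functional: "state H A \<phi> \<Longrightarrow> positive_functional H A \<phi>"
  by (simp add: state_def positive_functional_def)

context hilb begin

lemma star_alg_bop: "star_alg H (bop H)"
  by (simp add: star_alg_def bop_subspace)

lemma op_closure_bop: "op_closure H X \<subseteq> bop H"
  by (auto simp: op_closure_def)

lemma star_alg_in:
  assumes "star_alg H A"
  shows "T \<in> A \<Longrightarrow> T \<in> bop H" "S \<in> A \<Longrightarrow> T \<in> A \<Longrightarrow> S + T \<in> A" "S \<in> A \<Longrightarrow> T \<in> A \<Longrightarrow> S - T \<in> A"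
    "T \<in> A \<Longrightarrow> c *\<^sub>C T \<in> A" "S \<in> A \<Longrightarrow> T \<in> A \<Longrightarrow> S \<circ> T \<in> A" "T \<in> A \<Longrightarrow> adj H T \<in> A"
    "id_op H \<in> A" "0 \<in> A"
  using assms cvs.subspace_add[of A S T] cvs.subspace_diff[of A S T] cvs.subspace_scale[of A T c] cvs.subspace_0[of A]
  by (auto simp: star_alg_def)

lemma opnorm_eq_0: assumes T: "T \<in> bop H" and z: "opnorm H T = 0" shows "T = 0"
proof (rule op_eqI[OF T op_zero_in])
  fix x assume x: "x \<in> V"
  have "nrm (T x) \<le> 0" using opnorm_apply[OF T x] z by simp
  then have "nrm (T x) = 0" using T x by (intro antisym) auto
  then show "T x = 0 x" using T x by simp
qed

lemma opnorm_small_eq: assumes S: "S \<in> bop H" and T: "T \<in> bop H" and "\<And>e. e > 0 \<Longrightarrow> opnorm H (S - T) \<le> e"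
  shows "S = T"
proof -
  have "opnorm H (S - T) \<le> 0" by (rule field_le_epsilon) (use assms in auto)
  then have "opnorm H (S - T) = 0" using opnorm_nonneg[of "S - T"] S T by simp
  then show ?thesis using opnorm_eq_0[of "S - T"] S T by simp
qed

lemma op_closure_superset: "X \<subseteq> bop H \<Longrightarrow> X \<subseteq> op_closure H X"
  unfolding op_closure_def by (auto intro!: bexI)

lemma op_closure_idem: "X \<subseteq> bop H \<Longrightarrow> op_closure H (op_closure H X) \<subseteq> op_closure H X"
proof
  fix T assume X: "X \<subseteq> bop H" and T: "T \<in> op_closure H (op_closure H X)"
  have Tb: "T \<in> bop H" using T by (simp add: op_closure_def)
  have "\<exists>S\<in>X. opnorm H (T - S) < e" if e: "e > 0" for e
  proof -
    obtain R where R: "R \<in> op_closure H X" "opnorm H (T - R) < e / 2"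
      using T e half_gt_zero[OF e] unfolding op_closure_def by blast
    obtain S where S: "S \<in> X" "opnorm H (R - S) < e / 2"
      using R(1) half_gt_zero[OF e] unfolding op_closure_def by blast
    have "opnorm H (T - S) < e"
      using opnorm_triangle_diff[OF Tb subsetD[OF op_closure_bop R(1)] subsetD[OF X S(1)]] R(2) S(2) by linarith
    then show ?thesis using S by blast
  qed
  then show "T \<in> op_closure H X" using Tb by (simp add: op_closure_def)
qed

lemma star_alg_closure: assumes A: "star_alg H A" shows "star_alg H (op_closure H A)"
  unfolding star_alg_def
proof (intro conjI ballI)
  note Ain = star_alg_in[OF A]
  have AB: "A \<subseteq> bop H" using A by (simp add: star_alg_def)
  have clI: "T \<in> op_closure H A" if "T \<in> bop H" "\<And>e. e > 0 \<Longrightarrow> \<exists>S\<in>A. opnorm H (T - S) < e" for T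
    using that by (simp add: op_closure_def)
  have clD: "\<exists>S\<in>A. opnorm H (T - S) < e" if "T \<in> op_closure H A" "e > 0" for T e
    using that by (simp add: op_closure_def)
  have clB: "T \<in> bop H" if "T \<in> op_closure H A" for T using that op_closure_bop by blast
  show "op_closure H A \<subseteq> bop H" by (rule op_closure_bop)
  show "id_op H \<in> op_closure H A" using op_closure_superset[OF AB] Ain(7) by blast
  show "csubspace (op_closure H A)"
  proof (rule cvs.subspaceI)
    show "0 \<in> op_closure H A" using op_closure_superset[OF AB] Ain(8) by blast
  next
    fix S T assume S: "S \<in> op_closure H A" and T: "T \<in> op_closure H A"
    show "S + T \<in> op_closure H A"
    proof (rule clI)
      fix e :: real assume e: "e > 0"
      obtain S' where S': "S' \<in> A" "opnorm H (S - S') < e / 2" using clD[OF S, of "e/2"] e by auto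
      obtain T' where T': "T' \<in> A" "opnorm H (T - T') < e / 2" using clD[OF T, of "e/2"] e by auto
      have eq: "(S + T) - (S' + T') = (S - S') + (T - T')" by simp
      have "opnorm H ((S + T) - (S' + T')) < e" unfolding eq
        using opnorm_triangle[OF op_diff_in[OF clB[OF S] Ain(1)[OF S'(1)]] op_diff_in[OF clB[OF T] Ain(1)[OF T'(1)]]]
          S'(2) T'(2) by linarith
      then show "\<exists>R\<in>A. opnorm H (S + T - R) < e" using S' T' Ain(2) by blast
    qed (use clB S T in auto)
  next
    fix c T assume T: "T \<in> op_closure H A"
    show "c *\<^sub>C T \<in> op_closure H A"
    proof (rule clI)
      fix e :: real assume e: "e > 0"
      have p: "cmod c + 1 > 0" by (simp add: add_nonneg_pos)
      obtain T' where T': "T' \<in> A" "opnorm H (T - T') < e / (cmod c + 1)"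
        using clD[OF T, of "e/(cmod c + 1)"] e p by auto
      have "opnorm H (c *\<^sub>C (T - T')) \<le> cmod c * opnorm H (T - T')"
        using clB[OF T] Ain(1)[OF T'(1)] by (intro opnorm_scale) auto
      also have "\<dots> \<le> (cmod c + 1) * opnorm H (T - T')"
        using clB[OF T] Ain(1)[OF T'(1)] by (intro mult_right_mono opnorm_nonneg) auto
      also have "\<dots> < e" using T'(2) p by (simp add: less_divide_eq mult.commute)
      finally have "opnorm H (c *\<^sub>C T - c *\<^sub>C T') < e" by (simp add: cvs.scale_right_diff_distrib)
      then show "\<exists>R\<in>A. opnorm H (c *\<^sub>C T - R) < e" using T' Ain(4) by blast
    qed (use clB T in auto)
  qed
  fix S assume S: "S \<in> op_closure H A"
  show "adj H S \<in> op_closure H A"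
  proof (rule clI)
    fix e :: real assume e: "e > 0"
    obtain S' where S': "S' \<in> A" "opnorm H (S - S') < e" using clD[OF S e] by blast
    have "opnorm H (adj H (S - S')) < e"
      using opnorm_adj_le[OF op_diff_in[OF clB[OF S] Ain(1)[OF S'(1)]]] S'(2) by linarith
    then show "\<exists>R\<in>A. opnorm H (adj H S - R) < e"
      using S' Ain(6) clB[OF S] Ain(1)[OF S'(1)] by (auto simp: adj_diff)
  qed (use clB S in auto)
  fix T assume T: "T \<in> op_closure H A"
  show "S \<circ> T \<in> op_closure H A"
  proof (rule clI)
    fix e :: real assume e: "e > 0"
    note Sb = clB[OF S] and Tb = clB[OF T]
    define K where "K = opnorm H S + opnorm H T + 1"
    have K: "K > 0" unfolding K_def using opnorm_nonneg[OF Sb] opnorm_nonneg[OF Tb] by linarith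
    define d where "d = min 1 (e / (2 * K))"
    have d: "d > 0" "d \<le> 1" "d * K < e" using e K by (auto simp: d_def min_def field_simps)
    obtain S' where S': "S' \<in> A" "opnorm H (S - S') < d" using clD[OF S d(1)] by blast
    obtain T' where T': "T' \<in> A" "opnorm H (T - T') < d" using clD[OF T d(1)] by blast
    note S'b = Ain(1)[OF S'(1)] and T'b = Ain(1)[OF T'(1)]
    have eq: "(S \<circ> T) - (S' \<circ> T') = ((S - S') \<circ> T) + (S' \<circ> (T - T'))"
      using Sb Tb S'b T'b by (simp add: comp_diff_left comp_diff_right)
    have 1: "opnorm H ((S - S') \<circ> T) \<le> d * opnorm H T"
      using opnorm_comp[OF op_diff_in[OF Sb S'b] Tb]
        mult_right_mono[OF less_imp_le[OF S'(2)] opnorm_nonneg[OF Tb]] by linarith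
    have 2: "opnorm H S' \<le> opnorm H S + 1"
      using opnorm_le_add_diff[OF S'b Sb] opnorm_minus_commute[OF S'b Sb] S'(2) d by linarith
    have "opnorm H (S' \<circ> (T - T')) \<le> opnorm H S' * opnorm H (T - T')"
      using S'b Tb T'b by (intro opnorm_comp) auto
    also have "\<dots> \<le> (opnorm H S + 1) * d"
      using 2 T'(2) S'b Tb T'b opnorm_nonneg[OF S'b] opnorm_nonneg[OF Sb] by (intro mult_mono opnorm_nonneg) auto
    finally have 3: "opnorm H (S' \<circ> (T - T')) \<le> (opnorm H S + 1) * d" .
    have "opnorm H ((S \<circ> T) - (S' \<circ> T')) \<le> d * opnorm H T + (opnorm H S + 1) * d"
      unfolding eq using opnorm_triangle[OF comp_in[OF op_diff_in[OF Sb S'b] Tb] comp_in[OF S'b op_diff_in[OF Tb T'b]]] 1 3 by linarith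
    also have "\<dots> = d * K" unfolding K_def by (simp add: algebra_simps)
    finally have "opnorm H ((S \<circ> T) - (S' \<circ> T')) < e" using d by linarith
    then show "\<exists>R\<in>A. opnorm H ((S \<circ> T) - R) < e" using S' T' Ain(5) by blast
  qed (use clB S T in auto)
qed

subsection \<open>Square roots\<close>

text \<open>
  The recursion \<open>q\<^sub>0 = 0\<close>, \<open>q\<^sub>n\<^sub>+\<^sub>1 = (y + q\<^sub>n\<^sup>2)/2\<close> is a contraction on the ball of radius \<open>r\<close>, and its
  fixed point \<open>q\<close> satisfies \<open>(1 - q)\<^sup>2 = 1 - y\<close>. The iterates stay in \<open>A\<close> also when \<open>A\<close> is not closed.
\<close>

lemma approximate_sqrt:
  assumes A: "star_alg H A" and y: "y \<in> A" and sa: "adj H y = y" and yr: "opnorm H y \<le> r" and r: "r < 1"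
  obtains q :: "nat \<Rightarrow> 'v \<Rightarrow> 'v" where "\<And>n. q n \<in> A" "\<And>n. adj H (q n) = q n" "\<And>n. opnorm H (q n) \<le> r"
    "\<And>n. opnorm H (q (Suc n) - q n) \<le> r ^ n"
    "\<And>n. (id_op H - q n) \<circ> (id_op H - q n) = (id_op H - y) + 2 *\<^sub>C (q (Suc n) - q n)"
proof -
  note Ain = star_alg_in[OF A]
  have yb: "y \<in> bop H" using Ain(1)[OF y] .
  have r0: "0 \<le> r" using opnorm_nonneg[OF yb] yr by linarith
  define q where "q n = ((\<lambda>s. (1/2) *\<^sub>C (y + (s \<circ> s))) ^^ n) 0" for n
  have q0: "q 0 = 0" and qS: "q (Suc n) = (1/2) *\<^sub>C (y + (q n \<circ> q n))" for n by (auto simp: q_def)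
  have qA: "q n \<in> A" for n
  proof (induction n)
    case 0 show ?case unfolding q0 by (rule Ain(8))
  next
    case (Suc n) show ?case unfolding qS by (intro Ain(2,4,5) y Suc)
  qed
  have qb: "q n \<in> bop H" for n using Ain(1)[OF qA] .
  have qsa: "adj H (q n) = q n" for n
  proof (induction n)
    case 0
    have "adj H (q 0) = q 0" unfolding q0 by simp
    then show ?case .
  next
    case (Suc n)
    have "adj H (q (Suc n)) = q (Suc n)" unfolding qS using qb[of n] yb sa Suc by (simp add: adj_scale adj_add adj_comp)
    then show ?case .
  qed
  have qr: "opnorm H (q n) \<le> r" for n
  proof (induction n)
    case 0
    have "opnorm H (q 0) \<le> r" unfolding q0 using r0 by simp
    then show ?case .
  next
    case (Suc n)
    have "opnorm H (q n \<circ> q n) \<le> r * r"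
      using opnorm_comp[OF qb qb, of n n] mult_mono[OF Suc Suc r0 opnorm_nonneg[OF qb]] by linarith
    also have "\<dots> \<le> r * 1" using r r0 by (intro mult_left_mono) auto
    finally have "opnorm H (y + (q n \<circ> q n)) \<le> 2 * r"
      using opnorm_triangle[OF yb comp_in[OF qb qb], of n n] yr by linarith
    then have "opnorm H ((1/2) *\<^sub>C (y + (q n \<circ> q n))) \<le> r" using opnorm_scale[OF op_add_in[OF yb comp_in[OF qb qb]], of "1/2" n n] by simp
    then have "opnorm H (q (Suc n)) \<le> r" unfolding qS .
    then show ?case .
  qed
  have qd: "opnorm H (q (Suc n) - q n) \<le> r ^ n" for n
  proof (induction n)
    case 0
    have "opnorm H (q 1) \<le> 1" using qr[of 1] r by linarith
    then have "opnorm H (q (Suc 0) - q 0) \<le> r ^ 0" unfolding q0 by simp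
    then show ?case .
  next
    case (Suc n)
    let ?d = "q (Suc n) - q n"
    have IH: "opnorm H ?d \<le> r ^ n" using Suc .
    have eq: "q (Suc (Suc n)) - q (Suc n) = (1/2) *\<^sub>C ((q (Suc n) \<circ> ?d) + (?d \<circ> q n))"
      unfolding qS[of "Suc n"] using qb yb qS[of n]
      by (simp add: comp_diff_left comp_diff_right cvs.scale_right_diff_distrib[symmetric] del: cvs.scale_cancel_left)
    have "opnorm H (q (Suc n) \<circ> ?d) \<le> r * r ^ n"
    proof -
      have "opnorm H (q (Suc n) \<circ> ?d) \<le> opnorm H (q (Suc n)) * opnorm H ?d"
        using qb by (intro opnorm_comp) auto
      also have "\<dots> \<le> r * r ^ n" using qr IH qb r0 by (intro mult_mono opnorm_nonneg) auto
      finally show ?thesis .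
    qed
    moreover have "opnorm H (?d \<circ> q n) \<le> r ^ n * r"
    proof -
      have "opnorm H (?d \<circ> q n) \<le> opnorm H ?d * opnorm H (q n)"
        using qb by (intro opnorm_comp) auto
      also have "\<dots> \<le> r ^ n * r" using qr IH qb r0 by (intro mult_mono opnorm_nonneg) auto
      finally show ?thesis .
    qed
    moreover have "opnorm H ((q (Suc n) \<circ> ?d) + (?d \<circ> q n)) \<le> opnorm H (q (Suc n) \<circ> ?d) + opnorm H (?d \<circ> q n)"
      using qb by (intro opnorm_triangle) auto
    ultimately have *: "opnorm H ((q (Suc n) \<circ> ?d) + (?d \<circ> q n)) \<le> 2 * r ^ Suc n"
      using mult.commute[of r "r ^ n"] power_Suc[of r n] by linarith
    have "opnorm H (q (Suc (Suc n)) - q (Suc n)) \<le> cmod (1/2) * opnorm H ((q (Suc n) \<circ> ?d) + (?d \<circ> q n))"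
      unfolding eq by (rule opnorm_scale) (use qb in auto)
    also have "\<dots> \<le> r ^ Suc n" using * by simp
    finally show ?case .
  qed
  \<comment> \<open>The error of \<open>1 - q\<^sub>n\<close> as a square root of \<open>1 - y\<close> is twice the step of the recursion.\<close>
  have "(id_op H - q n) \<circ> (id_op H - q n) = (id_op H - y) + 2 *\<^sub>C (q (Suc n) - q n)" for n
  proof -
    have "2 *\<^sub>C q (Suc n) = y + (q n \<circ> q n)" unfolding qS by simp
    moreover have "2 *\<^sub>C q n = q n + q n"
      using cvs.scale_left_distrib[of 1 1 "q n"] by simp
    moreover have "(id_op H - q n) \<circ> (id_op H - q n) = (id_op H - q n) - (q n - (q n \<circ> q n))"
      using qb by (simp add: comp_diff_left comp_diff_right)
    ultimately show ?thesis by (simp add: cvs.scale_right_diff_distrib)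
  qed
  then show thesis using that[of q] qA qsa qr qd by blast
qed

lemma exact_sqrt:
  assumes A: "star_alg H A" and cl: "op_closure H A \<subseteq> A"
    and y: "y \<in> A" and sa: "adj H y = y" and y1: "opnorm H y < 1"
  obtains s where "s \<in> A" "adj H s = s" "s \<circ> s = id_op H - y"
proof -
  note Ain = star_alg_in[OF A]
  define r where "r = opnorm H y"
  have yb: "y \<in> bop H" using Ain(1)[OF y] .
  have r: "0 \<le> r" "r < 1" unfolding r_def using opnorm_nonneg[OF yb] y1 by auto
  obtain q where qA: "\<And>n. q n \<in> A" and qsa: "\<And>n. adj H (q n) = q n" and qr: "\<And>n. opnorm H (q n) \<le> r"
    and qd: "\<And>n. opnorm H (q (Suc n) - q n) \<le> r ^ n"
    and qq: "\<And>n. (id_op H - q n) \<circ> (id_op H - q n) = (id_op H - y) + 2 *\<^sub>C (q (Suc n) - q n)"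
    using approximate_sqrt[OF A y sa, of r] r by (metis order_refl r_def)
  have qb: "q n \<in> bop H" for n using Ain(1)[OF qA] .
  have tel: "opnorm H (q (n + k) - q n) \<le> (r ^ n - r ^ (n + k)) / (1 - r)" for n k
  proof (induction k)
    case 0
    have "opnorm H (q (n + 0) - q n) \<le> (r ^ n - r ^ (n + 0)) / (1 - r)" by simp
    then show ?case .
  next
    case (Suc k)
    have IH: "opnorm H (q (n + k) - q n) \<le> (r ^ n - r ^ (n + k)) / (1 - r)" using Suc .
    have "opnorm H (q (n + Suc k) - q n) \<le> r ^ (n + k) + (r ^ n - r ^ (n + k)) / (1 - r)"
      using opnorm_triangle_diff[OF qb[of "n + Suc k"] qb[of "n + k"] qb[of n]] qd[of "n + k"] IH by simp
    also have "\<dots> = (r ^ n - r ^ (n + Suc k)) / (1 - r)" using r by (simp add: field_simps)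
    finally show ?case .
  qed
  have tel': "opnorm H (q m - q n) \<le> r ^ n / (1 - r)" if "n \<le> m" for m n
  proof -
    have "(r ^ n - r ^ (n + (m - n))) / (1 - r) \<le> r ^ n / (1 - r)"
      using r by (intro divide_right_mono) auto
    then show ?thesis using tel[of n "m - n"] that by simp
  qed
  have lim: "(\<lambda>n. r ^ n / (1 - r)) \<longlonglongrightarrow> 0"
    using tendsto_divide[OF LIMSEQ_realpow_zero[OF r] tendsto_const[of "1 - r"]] r by simp
  have "\<exists>Q\<in>bop H. (\<lambda>n. opnorm H (q n - Q)) \<longlonglongrightarrow> 0"
  proof (rule bop_complete[OF qb])
    fix e :: real assume "e > 0"
    then obtain N where N: "\<And>n. n \<ge> N \<Longrightarrow> norm (r ^ n / (1 - r) - 0) < e" using LIMSEQ_D[OF lim] by blast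
    have "opnorm H (q m - q n) < e" if "m \<ge> N" "n \<ge> N" for m n
      using tel'[of n m] tel'[of m n] N[OF that(1)] N[OF that(2)] opnorm_minus_commute[OF qb qb, of m n]
      r by (cases "n \<le> m") (auto simp: power_abs)
    then show "\<exists>N. \<forall>m\<ge>N. \<forall>n\<ge>N. opnorm H (q m - q n) < e" by blast
  qed
  then obtain Q where Q: "Q \<in> bop H" and Ql: "(\<lambda>n. opnorm H (q n - Q)) \<longlonglongrightarrow> 0" by blast
  have close: "\<exists>n. opnorm H (q n - Q) < e \<and> r ^ n < e" if "e > 0" for e
  proof -
    obtain N1 where "\<And>n. n \<ge> N1 \<Longrightarrow> norm (opnorm H (q n - Q) - 0) < e" using LIMSEQ_D[OF Ql \<open>e > 0\<close>] by blast
    moreover obtain N2 where "\<And>n. n \<ge> N2 \<Longrightarrow> norm (r ^ n - 0) < e"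
      using LIMSEQ_D[OF LIMSEQ_realpow_zero[OF r] \<open>e > 0\<close>] by blast
    ultimately have "norm (opnorm H (q (max N1 N2) - Q) - 0) < e" "norm (r ^ max N1 N2 - 0) < e" by auto
    then show ?thesis by (intro exI[of _ "max N1 N2"]) auto
  qed
  have "Q \<in> op_closure H A"
    unfolding op_closure_def using Q close qA opnorm_minus_commute[OF Q qb] by (auto, metis)
  then have QA: "Q \<in> A" using cl by blast
  have Qsa: "adj H Q = Q"
  proof (rule opnorm_small_eq)
    fix e :: real assume "e > 0"
    then obtain n where n: "opnorm H (q n - Q) < e / 2" using close[of "e/2"] by auto
    have "adj H (Q - q n) = adj H Q - q n" using Q qb qsa by (simp add: adj_diff)
    then have "opnorm H (adj H Q - q n) < e / 2"
      using opnorm_adj_le[OF op_diff_in[OF Q qb], of n] n opnorm_minus_commute[OF qb Q, of n] by simp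
    then show "opnorm H (adj H Q - Q) \<le> e"
      using opnorm_triangle_diff[OF adj_in[OF Q] qb Q, of n] n by linarith
  qed (use Q in auto)
  let ?s = "id_op H - Q"
  have "?s \<circ> ?s = id_op H - y"
  proof (rule opnorm_small_eq)
    fix e :: real assume e: "e > 0"
    define \<delta> where "\<delta> = min e 1 / 8"
    have \<delta>: "\<delta> > 0" "\<delta> \<le> 1 / 8" "8 * \<delta> \<le> e" using e by (auto simp: \<delta>_def)
    obtain n where n: "opnorm H (q n - Q) < \<delta>" "r ^ n < \<delta>" using close[OF \<delta>(1)] by auto
    let ?t = "id_op H - q n"
    have sb: "?s \<in> bop H" and tb: "?t \<in> bop H" and dQ: "q n - Q \<in> bop H" using Q qb by auto
    have st: "q n - Q = ?s - ?t" by simp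
    have diff1: "opnorm H (id_op H - T) \<le> 1 + opnorm H T" if "T \<in> bop H" for T
    proof -
      have "opnorm H (id_op H - T) \<le> opnorm H (id_op H) + opnorm H (T - 0)"
        using opnorm_triangle_diff[of "id_op H - T" 0 0] opnorm_triangle_diff[of "id_op H" 0 T]
          opnorm_minus_commute[of 0 T] that by simp
      then show ?thesis using opnorm_id by simp
    qed
    have tn: "opnorm H ?t \<le> 2" using diff1[OF qb, of n] qr[of n] r by linarith
    have "opnorm H Q \<le> r + \<delta>"
      using opnorm_le_add_diff[OF Q qb, of n] opnorm_minus_commute[OF qb Q, of n] n qr[of n] by linarith
    then have sn: "opnorm H ?s \<le> 3" using diff1[OF Q] r \<delta> by linarith
    have d1: "(?s \<circ> ?s) - (?t \<circ> ?t) = (?s \<circ> (q n - Q)) + ((q n - Q) \<circ> ?t)"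
      unfolding st using sb tb comp_diff_left[of ?s ?t ?t] comp_diff_right[of ?s ?s ?t] by simp
    have 1: "opnorm H (?s \<circ> (q n - Q)) \<le> 3 * \<delta>"
      using order_trans[OF opnorm_comp[OF sb dQ] mult_mono[OF sn less_imp_le[OF n(1)]]] opnorm_nonneg[OF dQ] by simp
    have 2: "opnorm H ((q n - Q) \<circ> ?t) \<le> \<delta> * 2"
      using order_trans[OF opnorm_comp[OF dQ tb] mult_mono[OF less_imp_le[OF n(1)] tn]] opnorm_nonneg[OF tb] \<delta> by simp
    have "opnorm H (2 *\<^sub>C (q (Suc n) - q n)) \<le> 2 * opnorm H (q (Suc n) - q n)"
      using opnorm_scale[of "q (Suc n) - q n" 2] qb by simp
    then have 3: "opnorm H (2 *\<^sub>C (q (Suc n) - q n)) \<le> 2 * \<delta>" using qd[of n] n(2) by linarith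
    let ?a = "?s \<circ> (q n - Q)" and ?b = "(q n - Q) \<circ> ?t" and ?c = "2 *\<^sub>C (q (Suc n) - q n)"
    have ab: "?a \<in> bop H" "?b \<in> bop H" "?c \<in> bop H" using sb tb dQ qb by auto
    have eq: "(?s \<circ> ?s) - (id_op H - y) = ?a + ?b + ?c"
    proof -
      have e2: "(?t \<circ> ?t) - (id_op H - y) = ?c" unfolding qq by simp
      have "(?s \<circ> ?s) - (id_op H - y) = ((?s \<circ> ?s) - (?t \<circ> ?t)) + ((?t \<circ> ?t) - (id_op H - y))" by simp
      then show ?thesis by (simp only: d1 e2)
    qed
    show "opnorm H ((?s \<circ> ?s) - (id_op H - y)) \<le> e"
      unfolding eq using opnorm_triangle[OF op_add_in[OF ab(1,2)] ab(3)] opnorm_triangle[OF ab(1,2)] 1 2 3 \<delta> by linarith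
  qed (use Q yb in auto)
  then show thesis using that[of ?s] QA Qsa Ain Q by (auto simp: adj_diff)
qed


subsection \<open>Boundedness and positivity\<close>

lemma positive_functionalD:
  assumes "positive_functional H A \<phi>"
  shows "S \<in> A \<Longrightarrow> T \<in> A \<Longrightarrow> \<phi> (S + T) = \<phi> S + \<phi> T"
    and "T \<in> A \<Longrightarrow> \<phi> (c *\<^sub>C T) = c * \<phi> T"
    and "T \<in> A \<Longrightarrow> \<phi> (adj H T \<circ> T) \<in> \<real>\<^sub>\<ge>\<^sub>0"
  using assms unfolding positive_functional_def by auto

lemma positive_functional_diff:
  assumes A: "star_alg H A" and p: "positive_functional H A \<phi>" and S: "S \<in> A" and T: "T \<in> A"
  shows "\<phi> (S - T) = \<phi> S - \<phi> T"
proof -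
  have "\<phi> ((S - T) + T) = \<phi> (S - T) + \<phi> T"
    using star_alg_in(3)[OF A S T] T by (rule positive_functionalD(1)[OF p])
  then show ?thesis by simp
qed

lemma linear_on_sum:
  fixes \<phi> :: "('v \<Rightarrow> 'v) \<Rightarrow> complex"
  assumes W: "csubspace W" and add: "\<And>S T. S \<in> W \<Longrightarrow> T \<in> W \<Longrightarrow> \<phi> (S + T) = \<phi> S + \<phi> T"
    and sc: "\<And>c T. T \<in> W \<Longrightarrow> \<phi> (c *\<^sub>C T) = c * \<phi> T" and T: "\<And>i. i \<in> I \<Longrightarrow> T i \<in> W"
  shows "\<phi> (\<Sum>i\<in>I. c i *\<^sub>C T i) = (\<Sum>i\<in>I. c i * \<phi> (T i))"
  using T
proof (induction I rule: infinite_finite_induct)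
  case (insert i I)
  have WW: "(\<Sum>i\<in>I. c i *\<^sub>C T i) \<in> W" using W insert by (intro cvs.subspace_sum cvs.subspace_scale) auto
  have IH: "\<phi> (\<Sum>i\<in>I. c i *\<^sub>C T i) = (\<Sum>i\<in>I. c i * \<phi> (T i))" by (rule insert.IH) (simp add: insert.prems)
  have Ti: "T i \<in> W" by (rule insert.prems) simp
  have "\<phi> (\<Sum>i\<in>insert i I. c i *\<^sub>C T i) = (\<Sum>i\<in>insert i I. c i * \<phi> (T i))"
    by (simp only: sum.insert[OF insert(1,2)] add[OF cvs.subspace_scale[OF W Ti] WW] sc[OF Ti] IH)
  then show ?case .
qed (use sc[OF cvs.subspace_0[OF W], of 0] in \<open>simp_all only: sum.infinite sum.empty cvs.scale_zero_left mult_zero_left not_False_eq_True\<close>)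

lemma positive_functional_sum:
  assumes A: "star_alg H A" and p: "positive_functional H A \<phi>" and T: "\<And>i. i \<in> I \<Longrightarrow> T i \<in> A"
  shows "\<phi> (\<Sum>i\<in>I. c i *\<^sub>C T i) = (\<Sum>i\<in>I. c i * \<phi> (T i))"
  by (rule linear_on_sum[where \<phi> = \<phi>, OF _ positive_functionalD(1)[OF p] positive_functionalD(2)[OF p] T])
    (use A in \<open>simp add: star_alg_def\<close>)

lemma positive_functional_cauchy_schwarz:
  assumes A: "star_alg H A" and p: "positive_functional H A \<phi>" and S: "S \<in> A" and T: "T \<in> A"
  shows "(cmod (\<phi> (adj H T \<circ> S)))\<^sup>2 \<le> Re (\<phi> (adj H S \<circ> S)) * Re (\<phi> (adj H T \<circ> T))"
    and "\<phi> (adj H S \<circ> T) = cnj (\<phi> (adj H T \<circ> S))"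
proof -
  note Ain = star_alg_in[OF A] and pD = positive_functionalD[OF p]
  have W: "csubspace A" using A by (simp add: star_alg_def)
  have 1: "\<phi> (adj H R \<circ> (S + T)) = \<phi> (adj H R \<circ> S) + \<phi> (adj H R \<circ> T)" if "S \<in> A" "T \<in> A" "R \<in> A" for R S T
    using comp_add_right[of "adj H R" S T] pD(1)[OF Ain(5)[OF Ain(6)[OF that(3)] that(1)] Ain(5)[OF Ain(6)[OF that(3)] that(2)]]
      that Ain(1) by simp
  have 2: "\<phi> (adj H (S + T) \<circ> R) = \<phi> (adj H S \<circ> R) + \<phi> (adj H T \<circ> R)" if "S \<in> A" "T \<in> A" "R \<in> A" for R S T
    using pD(1)[OF Ain(5)[OF Ain(6)[OF that(1)] that(3)] Ain(5)[OF Ain(6)[OF that(2)] that(3)]]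
      that Ain(1) by (simp add: adj_add comp_add_left)
  have 3: "\<phi> (adj H R \<circ> (c *\<^sub>C S)) = c * \<phi> (adj H R \<circ> S)" if "S \<in> A" "R \<in> A" for c R S
    using comp_scale_right[of "adj H R" S c] pD(2)[OF Ain(5)[OF Ain(6)[OF that(2)] that(1)]] that Ain(1) by simp
  have 4: "\<phi> (adj H (c *\<^sub>C R) \<circ> S) = cnj c * \<phi> (adj H R \<circ> S)" if "S \<in> A" "R \<in> A" for c R S
    using pD(2)[OF Ain(5)[OF Ain(6)[OF that(2)] that(1)]] that Ain(1) by (simp add: adj_scale comp_scale_left)
  show "(cmod (\<phi> (adj H T \<circ> S)))\<^sup>2 \<le> Re (\<phi> (adj H S \<circ> S)) * Re (\<phi> (adj H T \<circ> T))"
    by (rule positive_form_cauchy_schwarz[OF W, where B = "\<lambda>S T. \<phi> (adj H T \<circ> S)"]) (fact 1 2 3 4 pD(3) S T)+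
  show "\<phi> (adj H S \<circ> T) = cnj (\<phi> (adj H T \<circ> S))"
    by (rule positive_form_hermitian[OF W, where B = "\<lambda>S T. \<phi> (adj H T \<circ> S)"]) (fact 1 2 3 4 pD(3) S T)+
qed

lemma positive_functional_adj:
  assumes A: "star_alg H A" and p: "positive_functional H A \<phi>" and T: "T \<in> A"
  shows "\<phi> (adj H T) = cnj (\<phi> T)"
  using positive_functional_cauchy_schwarz(2)[OF A p T star_alg_in(7)[OF A]] star_alg_in(1)[OF A T] by simp

lemma positive_functional_self_adjoint_real:
  assumes A: "star_alg H A" and p: "positive_functional H A \<phi>" and T: "T \<in> A" "adj H T = T"
  shows "\<phi> T = of_real (Re (\<phi> T))"
  using positive_functional_adj[OF A p T(1)] T(2) by (simp add: complex_eq_iff)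

lemma positive_functional_norm_square_le:
  assumes A: "star_alg H A" and p: "positive_functional H A \<phi>" and T: "T \<in> A"
  shows "(cmod (\<phi> T))\<^sup>2 \<le> Re (\<phi> (adj H T \<circ> T)) * Re (\<phi> (id_op H))"
  using positive_functional_cauchy_schwarz(1)[OF A p T star_alg_in(7)[OF A]] star_alg_in(1)[OF A T] by simp

lemma adj_comp_self: "T \<in> bop H \<Longrightarrow> adj H (adj H T \<circ> T) = adj H T \<circ> T"
  by (simp add: adj_comp)

text \<open>
  For self-adjoint \<open>y\<close> of norm less than \<open>1\<close> the element \<open>1 - y\<close> is a square \<open>s\<^sup>* s\<close>, so that
  \<open>\<phi>(y) \<le> 1\<close>. Scaling gives the bound for all self-adjoint elements, and \<open>|\<phi>(T)|\<^sup>2 \<le> \<phi>(T\<^sup>* T)\<close> the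
  bound in general.
\<close>

theorem state_norm_le:
  assumes A: "star_alg H A" and cl: "op_closure H A \<subseteq> A" and st: "state H A \<phi>" and T: "T \<in> A"
  shows "cmod (\<phi> T) \<le> opnorm H T"
proof -
  note p = state_imp_positive_functional[OF st] and Ain = star_alg_in[OF A]
  have id1: "\<phi> (id_op H) = 1" using st by (simp add: state_def)
  have lt1: "Re (\<phi> y) \<le> 1" if y: "y \<in> A" "adj H y = y" "opnorm H y < 1" for y
  proof -
    obtain s where s: "s \<in> A" "adj H s = s" "s \<circ> s = id_op H - y" using exact_sqrt[OF A cl y] by blast
    have "0 \<le> Re (\<phi> (adj H s \<circ> s))" using positive_functionalD(3)[OF p s(1)] by (simp add: complex_nonneg_Reals_iff)
    then have "0 \<le> Re (\<phi> (id_op H - y))" unfolding s(2,3) .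
    then show ?thesis using positive_functional_diff[OF A p Ain(7) y(1)] id1 by simp
  qed
  have sa: "Re (\<phi> y) \<le> opnorm H y" if y: "y \<in> A" "adj H y = y" for y
  proof (rule field_le_epsilon)
    fix e :: real assume e: "e > 0"
    have n: "0 \<le> opnorm H y" using opnorm_nonneg Ain(1)[OF y(1)] .
    define t where "t = opnorm H y + e"
    have t: "t > 0" "opnorm H y < t" unfolding t_def using e n by auto
    have "opnorm H (of_real (1 / t) *\<^sub>C y) \<le> cmod (of_real (1 / t)) * opnorm H y"
      by (rule opnorm_scale) (rule Ain(1)[OF y(1)])
    also have "\<dots> = opnorm H y / t" using t by (simp only: norm_of_real) simp
    also have "\<dots> < 1" using t by (simp add: divide_less_eq)
    finally have "Re (\<phi> (of_real (1 / t) *\<^sub>C y)) \<le> 1"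
      using y Ain(1)[OF y(1)] by (intro lt1 Ain(4)) (auto simp: adj_scale)
    then have "Re (\<phi> y) / t \<le> 1" using positive_functionalD(2)[OF p y(1), of "of_real (1 / t)"] by simp
    then show "Re (\<phi> y) \<le> opnorm H y + e" using t unfolding t_def[symmetric] by (simp add: divide_le_eq)
  qed
  have Tb: "T \<in> bop H" using Ain(1)[OF T] .
  have "(cmod (\<phi> T))\<^sup>2 \<le> Re (\<phi> (adj H T \<circ> T))" using positive_functional_norm_square_le[OF A p T] id1 by simp
  also have "\<dots> \<le> opnorm H (adj H T \<circ> T)" using Ain T Tb by (intro sa) (auto simp: adj_comp_self)
  also have "\<dots> \<le> opnorm H (adj H T) * opnorm H T" using Tb by (intro opnorm_comp) auto
  also have "\<dots> \<le> opnorm H T * opnorm H T" using Tb opnorm_adj_le opnorm_nonneg by (intro mult_right_mono) auto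
  finally have "(cmod (\<phi> T))\<^sup>2 \<le> (opnorm H T)\<^sup>2" by (simp add: power2_eq_square)
  then show ?thesis by (rule power2_le_imp_le) (rule opnorm_nonneg[OF Tb])
qed

text \<open>
  Positivity in the algebra means positivity on sums of \<open>T\<^sup>* T\<close>, and a positive operator \<open>z\<close> need not
  have a square root in an algebra that is not closed. After scaling, \<open>y\<^sub>0 = 1 - z/M\<close> has norm at
  most \<open>1\<close>. For \<open>r < 1\<close> the approximate square roots of \<open>1 - r y\<^sub>0\<close> and the boundedness of \<open>\<phi>\<close>
  give \<open>\<phi>(1 - r y\<^sub>0) \<ge> 0\<close>, and \<open>r\<close> tends to \<open>1\<close>.
\<close>

theorem positive_functional_nonneg:
  assumes A: "star_alg H A" and p: "positive_functional H A \<phi>"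
    and bd: "\<And>T. T \<in> A \<Longrightarrow> cmod (\<phi> T) \<le> C * opnorm H T"
    and z: "z \<in> A" and sa: "adj H z = z" and pos: "\<And>x. x \<in> V \<Longrightarrow> 0 \<le> Re (ip H (z x) x)"
  shows "0 \<le> Re (\<phi> z)"
proof -
  note Ain = star_alg_in[OF A] and pD = positive_functionalD[OF p]
  have zb: "z \<in> bop H" using Ain(1)[OF z] .
  define M where "M = opnorm H z + 1"
  have M: "M > 0" "opnorm H z \<le> M" unfolding M_def using opnorm_nonneg[OF zb] by auto
  define y0 where "y0 = id_op H - of_real (1 / M) *\<^sub>C z"
  have y0A: "y0 \<in> A" unfolding y0_def by (intro Ain(3,4,7) z)
  have y0sa: "adj H y0 = y0" unfolding y0_def using zb sa by (simp add: adj_diff adj_scale)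
  have y0n: "opnorm H y0 \<le> 1"
  proof (rule self_adjoint_numerical_radius[OF Ain(1)[OF y0A] y0sa])
    fix x assume x: "x \<in> V"
    have e: "Re (ip H (y0 x) x) = (nrm x)\<^sup>2 - Re (ip H (z x) x) / M"
      unfolding y0_def using x zb by (simp add: ip_self del: of_real_power)
    have "Re (ip H (z x) x) \<le> cmod (ip H (z x) x)" by (rule complex_Re_le_cmod)
    also have "\<dots> \<le> nrm (z x) * nrm x" using x zb by (intro cauchy_schwarz) auto
    also have "\<dots> \<le> (opnorm H z * nrm x) * nrm x" using x zb by (intro mult_right_mono opnorm_apply) auto
    also have "\<dots> \<le> (M * nrm x) * nrm x" using x M by (intro mult_right_mono) auto
    finally have "Re (ip H (z x) x) / M \<le> (nrm x)\<^sup>2" using M by (simp add: divide_le_eq power2_eq_square mult_ac)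
    moreover have "0 \<le> Re (ip H (z x) x) / M" using pos[OF x] M by simp
    ultimately show "\<bar>Re (ip H (y0 x) x)\<bar> \<le> 1 * (nrm x)\<^sup>2" unfolding e by simp
  qed simp
  define a where "a = Re (\<phi> (id_op H))"
  define b where "b = Re (\<phi> z) / M"
  have a0: "0 \<le> a" unfolding a_def
    using pD(3)[OF Ain(7)] by (simp add: complex_nonneg_Reals_iff)
  have key: "0 \<le> (1 - r) * a + r * b" if r: "0 < r" "r < 1" for r
  proof -
    let ?y = "of_real r *\<^sub>C y0"
    have y: "?y \<in> A" "adj H ?y = ?y" using Ain(4)[OF y0A] y0sa Ain(1)[OF y0A] by (auto simp: adj_scale)
    have "opnorm H ?y \<le> cmod (of_real r) * opnorm H y0" by (rule opnorm_scale) (rule Ain(1)[OF y0A])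
    also have "\<dots> \<le> r * 1" using y0n r by simp
    finally have yr: "opnorm H ?y \<le> r" by simp
    obtain q where qA: "\<And>n. q n \<in> A" and qsa: "\<And>n. adj H (q n) = q n"
      and qr: "\<And>n. opnorm H (q n) \<le> r"
      and qd: "\<And>n. opnorm H (q (Suc n) - q n) \<le> r ^ n"
      and qq: "\<And>n. (id_op H - q n) \<circ> (id_op H - q n) = (id_op H - ?y) + 2 *\<^sub>C (q (Suc n) - q n)"
      by (rule approximate_sqrt[OF A y yr r(2)]) (rule that)
    have C0: "cmod (\<phi> T) \<le> \<bar>C\<bar> * opnorm H T" if "T \<in> A" for T
      using bd[OF that] mult_right_mono[OF abs_ge_self[of C] opnorm_nonneg[OF Ain(1)[OF that]]] by linarith
    have low: "- (2 * \<bar>C\<bar> * r ^ n) \<le> Re (\<phi> (id_op H - ?y))" for n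
    proof -
      let ?s = "id_op H - q n" and ?d = "q (Suc n) - q n"
      have s: "?s \<in> A" "adj H ?s = ?s" using Ain(3)[OF Ain(7) qA] qsa Ain(1)[OF qA] by (auto simp: adj_diff)
      have d: "?d \<in> A" using Ain(3) qA by blast
      have "0 \<le> Re (\<phi> (adj H ?s \<circ> ?s))" using pD(3)[OF s(1)] by (simp add: complex_nonneg_Reals_iff)
      then have "0 \<le> Re (\<phi> ((id_op H - ?y) + 2 *\<^sub>C ?d))" unfolding s(2) qq .
      also have "\<phi> ((id_op H - ?y) + 2 *\<^sub>C ?d) = \<phi> (id_op H - ?y) + 2 * \<phi> ?d"
        using pD(1)[OF Ain(3)[OF Ain(7) y(1)] Ain(4)[OF d]] pD(2)[OF d] by simp
      finally have "- (2 * Re (\<phi> ?d)) \<le> Re (\<phi> (id_op H - ?y))" by simp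
      moreover have "Re (\<phi> ?d) \<le> \<bar>C\<bar> * r ^ n"
        using complex_Re_le_cmod[of "\<phi> ?d"] C0[OF d] mult_left_mono[OF qd[of n] abs_ge_zero[of C]] by linarith
      ultimately show ?thesis by linarith
    qed
    have "(\<lambda>n. - (2 * \<bar>C\<bar> * r ^ n)) \<longlonglongrightarrow> - (2 * \<bar>C\<bar> * 0)"
      using r by (intro tendsto_intros LIMSEQ_realpow_zero) auto
    then have "- (2 * \<bar>C\<bar> * 0) \<le> Re (\<phi> (id_op H - ?y))"
      by (rule LIMSEQ_le_const2) (use low in blast)
    moreover have "\<phi> (id_op H - ?y) = \<phi> (id_op H) - of_real r * (\<phi> (id_op H) - of_real (1 / M) * \<phi> z)"
      using positive_functional_diff[OF A p Ain(7) y(1)] pD(2)[OF y0A, of "of_real r"]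
        positive_functional_diff[OF A p Ain(7) Ain(4)[OF z]] pD(2)[OF z] unfolding y0_def by simp
    ultimately show ?thesis unfolding a_def b_def by (simp add: algebra_simps)
  qed
  have "0 \<le> b"
  proof (rule ccontr)
    assume "\<not> 0 \<le> b"
    then have b: "b < 0" by simp
    \<comment> \<open>For negative \<open>b\<close> the affine function \<open>(1 - r) a + r b\<close> of \<open>r\<close> equals \<open>b / 2\<close> at this point of the
      open unit interval.\<close>
    define r where "r = (a - b / 2) / (a - b)"
    have "0 < r" "r < 1" unfolding r_def using a0 b by (auto simp: field_simps)
    from key[OF this] have "0 \<le> a - r * (a - b)" by (simp add: algebra_simps)
    also have "r * (a - b) = a - b / 2" unfolding r_def using a0 b by simp
    finally show False using b by simp
  qed
  then show ?thesis unfolding b_def using M by (simp add: zero_le_divide_iff)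
qed

corollary state_nonneg:
  assumes A: "star_alg H A" and cl: "op_closure H A \<subseteq> A" and st: "state H A \<phi>"
    and z: "z \<in> A" "adj H z = z" "\<And>x. x \<in> V \<Longrightarrow> 0 \<le> Re (ip H (z x) x)"
  shows "\<phi> z \<in> \<real>\<^sub>\<ge>\<^sub>0"
proof -
  note p = state_imp_positive_functional[OF st]
  have "0 \<le> Re (\<phi> z)"
    by (rule positive_functional_nonneg[OF A p _ z, where C = 1]) (simp add: state_norm_le[OF A cl st])
  then show ?thesis using positive_functional_self_adjoint_real[OF A p z(1,2)]
    by (metis nonneg_Reals_of_real_iff)
qed

end


section \<open>Convexity\<close>

text \<open>
  The image of \<open>C\<close> under \<open>(f, g)\<close> is a convex subset of the plane that avoids the open third
  quadrant, so a line through the origin separates the two. If \<open>f\<close> takes a negative value, the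
  supremum \<open>t\<close> of \<open>0\<close> and the values of \<open>-g/f\<close> at the points with \<open>f > 0\<close> satisfies
  \<open>g + t f \<ge> 0\<close>.
\<close>

lemma two_function_alternative:
  fixes C :: "'a::real_vector set" and f g :: "'a \<Rightarrow> real"
  assumes C: "convex C"
    and f: "\<And>x y t. x \<in> C \<Longrightarrow> y \<in> C \<Longrightarrow> 0 \<le> t \<Longrightarrow> t \<le> 1 \<Longrightarrow> f ((1 - t) *\<^sub>R x + t *\<^sub>R y) = (1 - t) * f x + t * f y"
    and g: "\<And>x y t. x \<in> C \<Longrightarrow> y \<in> C \<Longrightarrow> 0 \<le> t \<Longrightarrow> t \<le> 1 \<Longrightarrow> g ((1 - t) *\<^sub>R x + t *\<^sub>R y) = (1 - t) * g x + t * g y"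
    and no: "\<And>x. x \<in> C \<Longrightarrow> f x < 0 \<Longrightarrow> 0 \<le> g x"
  shows "\<exists>s. 0 \<le> s \<and> s \<le> 1 \<and> (\<forall>x\<in>C. 0 \<le> s * f x + (1 - s) * g x)"
proof (cases "\<forall>x\<in>C. 0 \<le> f x")
  case True
  then show ?thesis by (intro exI[of _ 1]) auto
next
  case False
  then obtain x0 where x0: "x0 \<in> C" "f x0 < 0" by fastforce
  have seg: "(1 - t) *\<^sub>R x + t *\<^sub>R y \<in> C" if "x \<in> C" "y \<in> C" "0 \<le> t" "t \<le> 1" for x y t
    using C that by (simp add: convex_alt)
  have strong: "0 \<le> g z" if z: "z \<in> C" "f z \<le> 0" for z
  proof (rule ccontr)
    assume "\<not> 0 \<le> g z"
    then have gz: "g z < 0" by simp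
    have gx: "0 \<le> g x0" using no x0 by blast
    define D where "D = g x0 - g z"
    define t where "t = (- g z) / (2 * D)"
    have D: "D > 0" "- g z \<le> D" unfolding D_def using gz gx by auto
    have t: "0 < t" "t < 1" unfolding t_def using gz D by (auto simp: field_simps)
    have "(1 - t) * f z + t * f x0 < 0"
    proof -
      have "(1 - t) * f z \<le> 0" using z t by (simp add: mult_nonneg_nonpos)
      moreover have "t * f x0 < 0" using t x0 by (simp add: mult_pos_neg)
      ultimately show ?thesis by linarith
    qed
    then have "f ((1 - t) *\<^sub>R z + t *\<^sub>R x0) < 0" using f[OF z(1) x0(1)] t by simp
    then have "0 \<le> g ((1 - t) *\<^sub>R z + t *\<^sub>R x0)" using no seg[OF z(1) x0(1)] t by simp
    then have "0 \<le> (1 - t) * g z + t * g x0" using g[OF z(1) x0(1)] t by simp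
    also have "\<dots> = g z + t * D" by (simp add: D_def algebra_simps)
    also have "t * D = - g z / 2" unfolding t_def using D by simp
    finally show False using gz by simp
  qed
  have cross: "- g y / f y \<le> g x / (- f x)" if y: "y \<in> C" "0 < f y" and x: "x \<in> C" "f x < 0" for x y
  proof -
    define t where "t = f y / (f y - f x)"
    have t: "0 \<le> t" "t \<le> 1" unfolding t_def using x y by (auto simp: field_simps)
    have t1: "1 - t = - f x / (f y - f x)" unfolding t_def using x y by (simp add: field_simps)
    have "(1 - t) * f y + t * f x = 0" unfolding t1 unfolding t_def using x y by (simp add: field_simps)
    then have "f ((1 - t) *\<^sub>R y + t *\<^sub>R x) \<le> 0" using f[OF y(1) x(1) t] by simp
    then have "0 \<le> g ((1 - t) *\<^sub>R y + t *\<^sub>R x)" using strong seg[OF y(1) x(1) t] by blast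
    then have "0 \<le> (1 - t) * g y + t * g x" using g[OF y(1) x(1) t] by simp
    also have "\<dots> = (- f x * g y + f y * g x) / (f y - f x)" unfolding t1 unfolding t_def
      by (simp add: add_divide_distrib diff_divide_distrib)
    finally have "0 \<le> - f x * g y + f y * g x" using x y by (simp add: zero_le_divide_iff)
    then show ?thesis using x y by (simp add: field_simps)
  qed
  define T where "T = insert 0 ((\<lambda>y. - g y / f y) ` {y \<in> C. 0 < f y})"
  have up: "s \<le> g x / (- f x)" if "s \<in> T" "x \<in> C" "f x < 0" for s x
    using that cross no[of x] unfolding T_def by (auto simp: divide_nonneg_neg divide_nonneg_pos zero_le_divide_iff)
  have bdd: "bdd_above T" using up x0 by (auto simp: bdd_above_def)
  define t where "t = Sup T"
  have t0: "0 \<le> t" unfolding t_def by (rule cSup_upper[OF _ bdd]) (simp add: T_def)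
  have key: "0 \<le> g x + t * f x" if x: "x \<in> C" for x
  proof -
    consider "f x < 0" | "f x = 0" | "f x > 0" by linarith
    then show ?thesis
    proof cases
      case 1
      have "t \<le> g x / (- f x)" unfolding t_def by (rule cSup_least) (use up x 1 in \<open>auto simp: T_def\<close>)
      then show ?thesis using 1 by (simp add: field_simps)
    next
      case 2 then show ?thesis using strong[OF x] by simp
    next
      case 3
      have "- g x / f x \<le> t" unfolding t_def by (rule cSup_upper[OF _ bdd]) (use x 3 in \<open>auto simp: T_def\<close>)
      then show ?thesis using 3 by (simp add: field_simps)
    qed
  qed
  define s where "s = t / (1 + t)"
  have "0 \<le> s" "s \<le> 1" "1 - s = 1 / (1 + t)" unfolding s_def using t0 by (auto simp: field_simps)
  moreover have "0 \<le> s * f x + (1 - s) * g x" if "x \<in> C" for x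
  proof -
    have "s * f x + (1 - s) * g x = (g x + t * f x) / (1 + t)"
      unfolding \<open>1 - s = 1 / (1 + t)\<close> unfolding s_def by (simp add: add_divide_distrib)
    then show ?thesis using key[OF that] t0 by simp
  qed
  ultimately show ?thesis by blast
qed

text \<open>
  The minimax theorem for finitely many affine functions on a convex set. In the induction step
  the hypothesis is applied to the convex set where the new function is negative, and the resulting
  combination is paired with the new function by \<open>two_function_alternative\<close>.
\<close>

lemma finite_function_alternative:
  fixes C :: "'a::real_vector set" and h :: "'i \<Rightarrow> 'a \<Rightarrow> real"
  assumes "finite I" "I \<noteq> {}" and "convex C"
    and "\<And>i x y t. i \<in> I \<Longrightarrow> x \<in> C \<Longrightarrow> y \<in> C \<Longrightarrow> 0 \<le> t \<Longrightarrow> t \<le> 1 \<Longrightarrow>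
      h i ((1 - t) *\<^sub>R x + t *\<^sub>R y) = (1 - t) * h i x + t * h i y"
    and "\<And>x. x \<in> C \<Longrightarrow> \<exists>i\<in>I. 0 \<le> h i x"
  shows "\<exists>l. (\<forall>i\<in>I. 0 \<le> l i) \<and> sum l I = 1 \<and> (\<forall>x\<in>C. 0 \<le> (\<Sum>i\<in>I. l i * h i x))"
  using assms
proof (induction I arbitrary: C rule: finite_ne_induct)
  case (singleton i)
  then show ?case by (intro exI[of _ "\<lambda>_. 1"]) auto
next
  case (insert i I)
  note aff = insert.prems(2) and no = insert.prems(3) and C = insert.prems(1)
  define C' where "C' = {x \<in> C. h i x < 0}"
  have "convex C'"
    unfolding convex_alt
  proof (intro ballI allI impI)
    fix x y t assume x: "x \<in> C'" and y: "y \<in> C'" and t: "0 \<le> (t::real) \<and> t \<le> 1"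
    have "(1 - t) *\<^sub>R x + t *\<^sub>R y \<in> C" using C x y t by (auto simp: convex_alt C'_def)
    moreover have "h i ((1 - t) *\<^sub>R x + t *\<^sub>R y) = (1 - t) * h i x + t * h i y"
      using aff[of i x y t] x y t by (auto simp: C'_def)
    moreover have "(1 - t) * h i x + t * h i y < 0"
      using convex_bound_lt[of "h i x" 0 "h i y" "1 - t" t] x y t by (auto simp: C'_def)
    ultimately show "(1 - t) *\<^sub>R x + t *\<^sub>R y \<in> C'" by (simp add: C'_def)
  qed
  then have "\<exists>l. (\<forall>j\<in>I. 0 \<le> l j) \<and> sum l I = 1 \<and> (\<forall>x\<in>C'. 0 \<le> (\<Sum>j\<in>I. l j * h j x))"
  proof (rule insert.IH)
    fix x assume "x \<in> C'"
    then show "\<exists>j\<in>I. 0 \<le> h j x" using no[of x] by (auto simp: C'_def)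
  qed (use aff in \<open>auto simp: C'_def\<close>)
  then obtain l where l: "\<And>j. j \<in> I \<Longrightarrow> 0 \<le> l j" "sum l I = 1" "\<And>x. x \<in> C' \<Longrightarrow> 0 \<le> (\<Sum>j\<in>I. l j * h j x)" by blast
  have "\<exists>s. 0 \<le> s \<and> s \<le> 1 \<and> (\<forall>x\<in>C. 0 \<le> s * h i x + (1 - s) * (\<Sum>j\<in>I. l j * h j x))"
  proof (rule two_function_alternative[OF C])
    fix x y :: 'a and t :: real assume A: "x \<in> C" "y \<in> C" "0 \<le> t" "t \<le> 1"
    show "h i ((1 - t) *\<^sub>R x + t *\<^sub>R y) = (1 - t) * h i x + t * h i y" using aff A by auto
    have "(\<Sum>j\<in>I. l j * h j ((1 - t) *\<^sub>R x + t *\<^sub>R y)) = (\<Sum>j\<in>I. (1 - t) * (l j * h j x) + t * (l j * h j y))"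
    proof (rule sum.cong[OF refl])
      fix j assume j: "j \<in> I"
      show "l j * h j ((1 - t) *\<^sub>R x + t *\<^sub>R y) = (1 - t) * (l j * h j x) + t * (l j * h j y)"
        unfolding aff[OF insertI2[OF j] A] by (simp add: algebra_simps)
    qed
    then show "(\<Sum>j\<in>I. l j * h j ((1 - t) *\<^sub>R x + t *\<^sub>R y)) = (1 - t) * (\<Sum>j\<in>I. l j * h j x) + t * (\<Sum>j\<in>I. l j * h j y)"
      by (simp only: sum.distrib sum_distrib_left)
  qed (use l(3) in \<open>auto simp: C'_def\<close>)
  then obtain s where s: "0 \<le> s" "s \<le> 1" "\<And>x. x \<in> C \<Longrightarrow> 0 \<le> s * h i x + (1 - s) * (\<Sum>j\<in>I. l j * h j x)" by blast
  define l' where "l' j = (if j = i then s else (1 - s) * l j)" for j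
  have l'I: "(\<Sum>j\<in>I. l' j * k j) = (1 - s) * (\<Sum>j\<in>I. l j * k j)" for k
    unfolding sum_distrib_left by (rule sum.cong) (use insert.hyps in \<open>auto simp: l'_def\<close>)
  have "\<forall>j\<in>insert i I. 0 \<le> l' j" using l s by (auto simp: l'_def)
  moreover have "sum l' (insert i I) = 1"
    using l'I[of "\<lambda>_. 1"] l(2) insert.hyps by (simp add: l'_def)
  moreover have "0 \<le> (\<Sum>j\<in>insert i I. l' j * h j x)" if "x \<in> C" for x
    using s(3)[OF that] l'I[of "\<lambda>j. h j x"] insert.hyps by (simp add: l'_def)
  ultimately show ?case by blast
qed

text \<open>
  Either the coordinates \<open>u\<close> are approximated by points of \<open>C\<close>, or a complex linear combination of
  the coordinates separates \<open>u\<close> from \<open>C\<close>. The minimax theorem is applied to the real parts of the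
  differences rotated by the four units \<open>k \<in> {1, -1, \<i>, -\<i>}\<close>: if \<open>|z| \<ge> e\<close> then \<open>Re (k z) \<ge> e/2\<close>
  for one of them.
\<close>

lemma approximate_or_separate:
  fixes C :: "'a::real_vector set" and p :: "'i \<Rightarrow> 'a \<Rightarrow> complex" and u :: "'i \<Rightarrow> complex"
  assumes X: "finite X" "X \<noteq> {}" and C: "convex C"
    and aff: "\<And>i x y t. i \<in> X \<Longrightarrow> x \<in> C \<Longrightarrow> y \<in> C \<Longrightarrow> 0 \<le> t \<Longrightarrow> t \<le> 1 \<Longrightarrow>
      p i ((1 - t) *\<^sub>R x + t *\<^sub>R y) = of_real (1 - t) * p i x + of_real t * p i y"
    and no: "\<And>f. f \<in> C \<Longrightarrow> \<exists>i\<in>X. e \<le> cmod (p i f - u i)"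
  shows "\<exists>c. \<forall>f\<in>C. Re (\<Sum>i\<in>X. c i * u i) + e / 2 \<le> Re (\<Sum>i\<in>X. c i * p i f)"
proof -
  define K where "K = {1, -1, \<i>, -\<i>}"
  have K: "finite K" by (simp add: K_def)
  define h where "h = (\<lambda>(i, k) f. Re (k * (p i f - u i)) - e / 2)"
  have "\<exists>l. (\<forall>ik\<in>X \<times> K. 0 \<le> l ik) \<and> sum l (X \<times> K) = 1 \<and> (\<forall>f\<in>C. 0 \<le> (\<Sum>ik\<in>X \<times> K. l ik * h ik f))"
  proof (rule finite_function_alternative[OF _ _ C])
    show "finite (X \<times> K)" "X \<times> K \<noteq> {}" using X K by (auto simp: K_def)
  next
    fix ik x y t assume A: "ik \<in> X \<times> K" "x \<in> C" "y \<in> C" "0 \<le> (t::real)" "t \<le> 1"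
    obtain i k where ik: "ik = (i, k)" "i \<in> X" using A by auto
    have "k * (p i ((1 - t) *\<^sub>R x + t *\<^sub>R y) - u i) = of_real (1 - t) * (k * (p i x - u i)) + of_real t * (k * (p i y - u i))"
      unfolding aff[OF ik(2) A(2-5)] by (simp add: algebra_simps)
    then have "Re (k * (p i ((1 - t) *\<^sub>R x + t *\<^sub>R y) - u i)) = (1 - t) * Re (k * (p i x - u i)) + t * Re (k * (p i y - u i))"
      by (simp only: plus_complex.sel Re_complex_of_real times_complex.sel Im_complex_of_real)
    moreover have "e / 2 = (1 - t) * (e / 2) + t * (e / 2)" by (simp add: field_simps)
    ultimately show "h ik ((1 - t) *\<^sub>R x + t *\<^sub>R y) = (1 - t) * h ik x + t * h ik y"
      unfolding h_def ik by (simp only: prod.case right_diff_distrib)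
  next
    fix f assume f: "f \<in> C"
    obtain i where i: "i \<in> X" "e \<le> cmod (p i f - u i)" using no[OF f] by blast
    let ?z = "p i f - u i"
    have "e \<le> \<bar>Re ?z\<bar> + \<bar>Im ?z\<bar>" using i(2) cmod_le[of ?z] by linarith
    then consider "e / 2 \<le> Re ?z" | "e / 2 \<le> - Re ?z" | "e / 2 \<le> Im ?z" | "e / 2 \<le> - Im ?z" by linarith
    then show "\<exists>ik\<in>X \<times> K. 0 \<le> h ik f"
    proof cases
      case 1 then show ?thesis using i(1) by (intro bexI[of _ "(i, 1)"]) (auto simp: h_def K_def)
    next
      case 2 then show ?thesis using i(1) by (intro bexI[of _ "(i, -1)"]) (auto simp: h_def K_def)
    next
      case 3 then show ?thesis using i(1) by (intro bexI[of _ "(i, -\<i>)"]) (auto simp: h_def K_def)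
    next
      case 4 then show ?thesis using i(1) by (intro bexI[of _ "(i, \<i>)"]) (auto simp: h_def K_def)
    qed
  qed
  then obtain l where l: "sum l (X \<times> K) = 1" "\<And>f. f \<in> C \<Longrightarrow> 0 \<le> (\<Sum>ik\<in>X \<times> K. l ik * h ik f)" by blast
  define c where "c i = (\<Sum>k\<in>K. of_real (l (i, k)) * k)" for i
  have "Re (\<Sum>i\<in>X. c i * u i) + e / 2 \<le> Re (\<Sum>i\<in>X. c i * p i f)" if f: "f \<in> C" for f
  proof -
    have "(\<Sum>ik\<in>X \<times> K. l ik * h ik f) = (\<Sum>ik\<in>X \<times> K. l ik * Re (snd ik * (p (fst ik) f - u (fst ik))) - l ik * (e / 2))"
      by (rule sum.cong) (auto simp: h_def algebra_simps)
    also have "\<dots> = (\<Sum>ik\<in>X \<times> K. l ik * Re (snd ik * (p (fst ik) f - u (fst ik)))) - e / 2"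
      by (simp only: sum_subtractf sum_distrib_right[symmetric] l(1))
    also have "(\<Sum>ik\<in>X \<times> K. l ik * Re (snd ik * (p (fst ik) f - u (fst ik))))
        = (\<Sum>i\<in>X. \<Sum>k\<in>K. l (i, k) * Re (k * (p i f - u i)))"
      by (simp add: sum.cartesian_product case_prod_beta)
    also have "\<dots> = (\<Sum>i\<in>X. Re (c i * (p i f - u i)))"
      unfolding c_def sum_distrib_right Re_sum by (intro sum.cong) (auto simp: mult.assoc)
    also have "\<dots> = Re (\<Sum>i\<in>X. c i * p i f) - Re (\<Sum>i\<in>X. c i * u i)"
      by (simp only: Re_sum[symmetric] right_diff_distrib sum_subtractf minus_complex.sel)
    finally show ?thesis using l(2)[OF f] by linarith
  qed
  then show ?thesis by blast
qed

text \<open>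
  Maximising the real and imaginary parts of the coordinates one after the other cuts \<open>K\<close> down to
  a single point, which is extreme. The first functional to be maximised is chosen so as to keep
  the coordinate at \<open>g0\<close> away from \<open>0\<close>.
\<close>

lemma extreme_point_with_nonzero_coordinate:
  fixes K :: "('g \<Rightarrow> complex) set"
  assumes K: "compact K" and X: "countable X"
    and off: "\<And>f. f \<in> K \<Longrightarrow> vanishes_off X f" and \<psi>0: "\<psi>0 \<in> K" "\<psi>0 g0 \<noteq> 0"
  shows "\<exists>\<psi>. \<psi> extreme_point_of K \<and> \<psi> g0 \<noteq> 0"
proof -
  have "X \<noteq> {}" using off[OF \<psi>0(1)] \<psi>0(2) by (auto simp: vanishes_off_def)
  define e where "e = from_nat_into X"
  have e: "\<exists>k. e k = g" if "g \<in> X" for g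
    using range_from_nat_into[OF \<open>X \<noteq> {}\<close> X] that unfolding e_def by (metis rangeE)
  define L :: "nat \<Rightarrow> ('g \<Rightarrow> complex) \<Rightarrow> real" where
    "L n f = (if n = 0 then Re (cnj (\<psi>0 g0) * f g0) else if odd n then Re (f (e (n div 2)))
       else Im (f (e (n div 2 - 1))))" for n f
  have Lcont: "continuous_on UNIV (L n)" for n
    unfolding L_def by (cases "n = 0"; cases "odd n") (auto intro!: continuous_intros)
  have Laff: "L n ((1 - t) *\<^sub>R x + t *\<^sub>R y) = (1 - t) * L n x + t * L n y" for n t x y
    unfolding L_def by (simp add: algebra_simps)
  define F where "F = rec_nat K (\<lambda>n S. S \<inter> {z. Sup (L n ` S) \<le> L n z})"
  define D where "D n = {z. Sup (L n ` F n) \<le> L n z}" for n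
  have F0: "F 0 = K" and Fi: "F (Suc n) = F n \<inter> D n" for n by (simp_all add: F_def D_def)
  have clD: "closed (D n)" for n unfolding D_def by (intro closed_Collect_le continuous_intros Lcont)
  have max: "\<exists>x\<in>F n. \<forall>y\<in>F n. L n y \<le> L n x" and Sup: "x \<in> F n \<Longrightarrow> \<forall>y\<in>F n. L n y \<le> L n x \<Longrightarrow> Sup (L n ` F n) = L n x"
    if "compact (F n)" "F n \<noteq> {}" for n x
    using continuous_attains_sup[of "F n" "L n"] that continuous_on_subset[OF Lcont]
    by (blast, intro cSup_eq_maximum) auto
  have F: "compact (F n) \<and> F n \<noteq> {}" for n
  proof (induction n)
    case 0 then show ?case unfolding F0 using K \<psi>0 by auto
  next
    case (Suc n)
    then obtain x where x: "x \<in> F n" "\<forall>y\<in>F n. L n y \<le> L n x" using max by blast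
    then have "x \<in> F (Suc n)" using Suc Sup[of n x] by (simp add: Fi D_def)
    then show ?case unfolding Fi using Suc clD compact_Int_closed by blast
  qed
  have FS: "F (Suc n) = {x \<in> F n. \<forall>y\<in>F n. L n y \<le> L n x}" for n
  proof -
    obtain x where x: "x \<in> F n" "\<forall>y\<in>F n. L n y \<le> L n x" using max F by blast
    have S: "Sup (L n ` F n) = L n x" using F x by (intro Sup) auto
    show ?thesis unfolding Fi D_def S using x by (auto intro: order_trans[of _ "L n x"])
  qed
  have anti: "F n \<subseteq> F m" if "m \<le> n" for m n
    using that by (induction rule: dec_induct) (auto simp: FS)
  have "K \<inter> (\<Inter>n\<in>UNIV. D n) \<noteq> {}"
  proof (rule compact_imp_fip_image[OF K clD])
    fix N :: "nat set" assume N: "finite N"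
    define m where "m = Suc (Max (insert 0 N))"
    obtain x where x: "x \<in> F m" using F[of m] by blast
    have "x \<in> D i" if "i \<in> N" for i
    proof -
      have "Suc i \<le> m" using N that by (simp add: m_def)
      then show ?thesis using anti[of "Suc i" m] x by (auto simp: Fi)
    qed
    moreover have "x \<in> K" using anti[of 0 m] x F0 by auto
    ultimately show "K \<inter> (\<Inter>n\<in>N. D n) \<noteq> {}" by blast
  qed
  then obtain \<psi> where \<psi>0': "\<psi> \<in> K" "\<And>n. \<psi> \<in> D n" by blast
  have \<psi>: "\<psi> \<in> F n" for n
    by (induction n) (use \<psi>0' in \<open>auto simp: F0 Fi\<close>)
  have nz: "\<psi> g0 \<noteq> 0"
  proof -
    have "L 0 \<psi>0 \<le> L 0 \<psi>" using \<psi>[of 1] \<psi>0(1) by (simp add: FS F0)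
    moreover have "cnj (\<psi>0 g0) * \<psi>0 g0 = of_real ((cmod (\<psi>0 g0))\<^sup>2)"
      using complex_norm_square[of "\<psi>0 g0"] by (simp add: mult.commute)
    then have "L 0 \<psi>0 = (cmod (\<psi>0 g0))\<^sup>2" unfolding L_def by (simp only: if_True simp_thms Re_complex_of_real)
    then have "L 0 \<psi>0 > 0" using \<psi>0(2) by simp
    ultimately show ?thesis by (auto simp: L_def)
  qed
  have "\<psi> \<notin> open_segment a b" if a: "a \<in> K" and b: "b \<in> K" for a b
  proof
    assume "\<psi> \<in> open_segment a b"
    then obtain u where u: "0 < u" "u < 1" and eq: "\<psi> = (1 - u) *\<^sub>R a + u *\<^sub>R b" and ab: "a \<noteq> b"
      by (auto simp: in_segment)
    have step: "L n a = L n \<psi> \<and> L n b = L n \<psi>" if "a \<in> F n" "b \<in> F n" for n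
    proof -
      have "L n a \<le> L n \<psi>" "L n b \<le> L n \<psi>" using \<psi>[of "Suc n"] that by (simp_all add: FS)
      moreover have "L n \<psi> = (1 - u) * L n a + u * L n b" unfolding eq Laff ..
      then have "(1 - u) * (L n \<psi> - L n a) + u * (L n \<psi> - L n b) = 0" by (simp add: algebra_simps)
      ultimately show ?thesis using u
        by (smt (verit) mult_nonneg_nonneg mult_eq_0_iff)
    qed
    have mem: "a \<in> F n \<and> b \<in> F n" for n
    proof (induction n)
      case 0 then show ?case using a b by (simp add: F0)
    next
      case (Suc n)
      then show ?case using step[of n] \<psi>[of "Suc n"] by (simp add: FS)
    qed
    have "L n a = L n b" for n using step[of n] mem[of n] by simp
    then have "L (2 * k + 1) a = L (2 * k + 1) b" "L (2 * k + 2) a = L (2 * k + 2) b" for k by blast+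
    then have "a (e k) = b (e k)" for k by (simp add: L_def complex_eq_iff)
    then have "a g = b g" for g
      using e[of g] off[OF a] off[OF b] by (cases "g \<in> X") (auto simp: vanishes_off_def)
    then show False using ab by blast
  qed
  moreover have "\<psi> \<in> K" using \<psi>[of 0] F0 by simp
  ultimately show ?thesis using nz unfolding extreme_point_of_def by blast
qed

section \<open>The state space\<close>

context hilb begin

lemma closed_states: "closed {f. state H A f}"
  unfolding state_def vanishes_off_def Ball_def complex_nonneg_Reals_iff
  by (intro closed_Collect_conj closed_Collect_all closed_Collect_imp closed_Collect_eq closed_Collect_le
      open_Collect_const continuous_intros continuous_on_product_coordinates)

text \<open>
  The state space is a closed subset of a product of discs of radius \<open>\<parallel>T\<parallel>\<close>.
\<close>

lemma compact_states:
  assumes A: "star_alg H A" and cl: "op_closure H A \<subseteq> A"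
  shows "compact {f. state H A f}"
proof -
  define B where "B T = (if T \<in> A then cball 0 (opnorm H T) else {0::complex})" for T
  have "compactin (product_topology (\<lambda>_. euclidean) UNIV) (PiE UNIV B)"
    unfolding compactin_PiE by (auto simp: B_def)
  then have "compact (PiE UNIV B)" by (simp add: euclidean_product_topology)
  moreover have "{f. state H A f} \<subseteq> PiE UNIV B"
    using state_norm_le[OF A cl] by (auto simp: B_def state_def vanishes_off_def)
  ultimately show ?thesis using compact_Int_closed[OF _ closed_states[of A], of "PiE UNIV B"]
    by (simp add: Int_absorb1)
qed

lemma op_closure_bop_subset: "op_closure H (bop H) \<subseteq> bop H" by (rule op_closure_bop)

lemma convex_states: "convex {f. state H A f}"
  unfolding convex_alt
proof (intro ballI allI impI, unfold mem_Collect_eq)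
  fix f g and t :: real assume f: "state H A f" and g: "state H A g" and t: "0 \<le> t \<and> t \<le> 1"
  have "f (adj H T \<circ> T) \<in> \<real>\<^sub>\<ge>\<^sub>0" "g (adj H T \<circ> T) \<in> \<real>\<^sub>\<ge>\<^sub>0" if "T \<in> A" for T
    using f g that by (auto simp: state_def)
  then have "(1 - t) *\<^sub>R f (adj H T \<circ> T) + t *\<^sub>R g (adj H T \<circ> T) \<in> \<real>\<^sub>\<ge>\<^sub>0" if "T \<in> A" for T
    using t that by (simp add: complex_nonneg_Reals_iff)
  then show "state H A ((1 - t) *\<^sub>R f + t *\<^sub>R g)"
    using f g unfolding state_def by (simp add: vanishes_off_def algebra_simps)
qed

lemma vector_functional_positive:
  assumes x: "x \<in> V" and A: "A \<subseteq> bop H"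
  shows "positive_functional H A (\<lambda>T. ip H (T x) x)"
  unfolding positive_functional_def
proof (intro conjI ballI allI)
  fix T assume "T \<in> A"
  then have T: "T \<in> bop H" using A by blast
  have "ip H ((adj H T \<circ> T) x) x = ip H (T x) (T x)" using T x by (simp add: adj_ip')
  then show "ip H ((adj H T \<circ> T) x) x \<in> \<real>\<^sub>\<ge>\<^sub>0" using T x ip_self_nonneg by simp
qed (use x A in \<open>auto simp: subset_iff\<close>)

lemma vector_state:
  assumes x: "x \<in> V" and n: "nrm x = 1"
  shows "state H (bop H) (\<lambda>T. if T \<in> bop H then ip H (T x) x else 0)"
  using vector_functional_positive[OF x order_refl] x n
  by (simp add: state_def positive_functional_def vanishes_off_def ip_self)

text \<open>
  The self-adjoint part of \<open>x\<close> shifted by the constant \<open>m\<close>: its positivity on vectors and under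
  \<open>\<phi>\<close> expresses lower bounds for \<open>Re \<langle>x y, y\<rangle>\<close> and \<open>Re \<phi>(x)\<close>.
\<close>

lemma real_part_op:
  fixes m :: real
  assumes A: "star_alg H A" and x: "x \<in> A" and p: "positive_functional H A \<phi>"
  defines "z \<equiv> (1/2) *\<^sub>C (x + adj H x) - of_real m *\<^sub>C id_op H"
  shows "z \<in> A" "adj H z = z" "Re (\<phi> z) = Re (\<phi> x) - m * Re (\<phi> (id_op H))"
    "\<And>y. y \<in> V \<Longrightarrow> Re (ip H (z y) y) = Re (ip H (x y) y) - m * (nrm y)\<^sup>2"
proof -
  note Ain = star_alg_in[OF A] and pD = positive_functionalD[OF p]
  have xb: "x \<in> bop H" using Ain(1)[OF x] .
  show "z \<in> A" unfolding z_def by (intro Ain(2,3,4,6,7) x)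
  show "adj H z = z" unfolding z_def using xb by (simp add: adj_diff adj_scale adj_add add.commute)
  have "\<phi> z = (1/2) * (\<phi> x + cnj (\<phi> x)) - of_real m * \<phi> (id_op H)"
    unfolding z_def
    using positive_functional_diff[OF A p Ain(4)[OF Ain(2)[OF x Ain(6)[OF x]]] Ain(4)[OF Ain(7)]]
      pD(2)[OF Ain(2)[OF x Ain(6)[OF x]]] pD(2)[OF Ain(7)] pD(1)[OF x Ain(6)[OF x]]
      positive_functional_adj[OF A p x] by simp
  then show "Re (\<phi> z) = Re (\<phi> x) - m * Re (\<phi> (id_op H))" by simp
  fix y assume y: "y \<in> V"
  have "ip H (adj H x y) y = cnj (ip H (x y) y)" using adj_ip'[OF xb y y] ip_sym[of "x y" y] xb y by simp
  then show "Re (ip H (z y) y) = Re (ip H (x y) y) - m * (nrm y)\<^sup>2"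
    unfolding z_def using xb y by (simp add: ip_self del: of_real_power)
qed

text \<open>
  By compactness of the state space it suffices to approximate \<open>\<phi>\<close> by states on a finite subset of
  \<open>B\<close>. If this failed, some \<open>x \<in> B\<close> would satisfy \<open>Re f(x) \<ge> m := Re \<phi>(x) + e/2\<close> for all states
  \<open>f\<close>. For vector states this says that the self-adjoint part of \<open>x - m\<close> is a positive operator, so
  \<open>Re \<phi>(x) \<ge> m\<close> by \<open>positive_functional_nonneg\<close>.
\<close>

theorem extend_to_state:
  assumes B: "star_alg H B" and p: "positive_functional H B \<phi>" and one: "\<phi> (id_op H) = 1"
    and bd: "\<And>T. T \<in> B \<Longrightarrow> cmod (\<phi> T) \<le> C * opnorm H T" and V: "V \<noteq> {0}"
  shows "\<exists>f. state H (bop H) f \<and> (\<forall>T\<in>B. f T = \<phi> T)"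
proof -
  define S where "S = {f. state H (bop H) f}"
  note Bin = star_alg_in[OF B]
  obtain x0 where x0: "x0 \<in> V" "x0 \<noteq> 0" using V zero_in by blast
  have approx: "\<exists>f\<in>S. \<forall>T\<in>X. cmod (f T - \<phi> T) < e" if X: "finite X" "X \<noteq> {}" "X \<subseteq> B" and e: "e > 0" for X e
  proof (rule ccontr)
    assume neg: "\<not> (\<exists>f\<in>S. \<forall>T\<in>X. cmod (f T - \<phi> T) < e)"
    have "\<exists>c. \<forall>f\<in>S. Re (\<Sum>T\<in>X. c T * \<phi> T) + e / 2 \<le> Re (\<Sum>T\<in>X. c T * f T)"
    proof (rule approximate_or_separate[OF X(1,2), where p = "\<lambda>T f. f T"])
      show "convex S" unfolding S_def by (rule convex_states)
    qed (use neg in \<open>auto simp: not_less scaleR_conv_of_real\<close>)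
    then obtain c where c: "\<And>f. f \<in> S \<Longrightarrow> Re (\<Sum>T\<in>X. c T * \<phi> T) + e / 2 \<le> Re (\<Sum>T\<in>X. c T * f T)" by blast
    define x where "x = (\<Sum>T\<in>X. c T *\<^sub>C T)"
    have xB: "x \<in> B" unfolding x_def using B X(3) unfolding star_alg_def
      by (intro cvs.subspace_sum cvs.subspace_scale) auto
    have phix: "\<phi> x = (\<Sum>T\<in>X. c T * \<phi> T)"
      unfolding x_def by (rule positive_functional_sum[OF B p]) (use X in auto)
    define m where "m = Re (\<phi> x) + e / 2"
    have low: "m \<le> Re (f x)" if f: "f \<in> S" for f
    proof -
      have "f x = (\<Sum>T\<in>X. c T * f T)" unfolding x_def
        by (rule positive_functional_sum[OF star_alg_bop state_imp_positive_functional])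
          (use f X Bin(1) in \<open>auto simp: S_def\<close>)
      then show ?thesis using c[OF f] phix unfolding m_def by simp
    qed
    have xb: "x \<in> bop H" using Bin(1)[OF xB] .
    have vec: "m * (nrm y)\<^sup>2 \<le> Re (ip H (x y) y)" if y: "y \<in> V" for y
    proof (cases "y = 0")
      case False
      then have n: "nrm y > 0" using nrm_pos y by blast
      define w where "w = of_real (1 / nrm y) *\<^sub>C y"
      have c: "cmod (of_real (1 / nrm y)) = 1 / nrm y" using n by (simp only: norm_of_real) simp
      have w: "w \<in> V" "nrm w = 1" unfolding w_def using nrm_scale[OF y, of "of_real (1 / nrm y)"] c n y by auto
      have "m \<le> Re (ip H (x w) w)" using low[of "\<lambda>T. if T \<in> bop H then ip H (T w) w else 0"] vector_state[OF w] xb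
        by (simp add: S_def)
      also have "ip H (x w) w = of_real ((1 / nrm y) * (1 / nrm y)) * ip H (x y) y"
        unfolding w_def using xb y by (simp add: bop_scale)
      also have "Re \<dots> = Re (ip H (x y) y) / (nrm y)\<^sup>2"
        by (simp only: Re_complex_of_real times_complex.sel Im_complex_of_real power2_eq_square) simp
      finally show ?thesis using n by (simp add: le_divide_eq)
    qed (use xb in simp)
    note z = real_part_op[OF B xB p, where m = m]
    have "0 \<le> Re (\<phi> ((1/2) *\<^sub>C (x + adj H x) - of_real m *\<^sub>C id_op H))"
      by (rule positive_functional_nonneg[OF B p bd z(1,2)]) (use vec z(4) in auto)
    then show False unfolding z(3) using one e by (simp add: m_def)
  qed
  have "S \<inter> \<Inter>((\<lambda>(T, e). {f. cmod (f T - \<phi> T) \<le> e}) ` (B \<times> {0<..})) \<noteq> {}"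
  proof (rule compact_imp_fip)
    show "compact S" unfolding S_def by (rule compact_states[OF star_alg_bop op_closure_bop_subset])
  next
    fix T assume "T \<in> (\<lambda>(T, e). {f. cmod (f T - \<phi> T) \<le> e}) ` (B \<times> {0<..})"
    then show "closed T"
      by (auto intro!: closed_Collect_le continuous_intros continuous_on_product_coordinates)
  next
    fix F' assume F': "finite F'" "F' \<subseteq> (\<lambda>(T, e). {f. cmod (f T - \<phi> T) \<le> e}) ` (B \<times> {0<..})"
    obtain P where P: "finite P" "P \<subseteq> B \<times> {0<..}" "F' = (\<lambda>(T, e). {f. cmod (f T - \<phi> T) \<le> e}) ` P"
      using F' by (meson finite_subset_image)
    define d where "d = Min (insert 1 (snd ` P))"
    have d: "d > 0" unfolding d_def using P(1,2) by (auto simp: Min_gr_iff)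
    have dle: "d \<le> e" if "(T, e) \<in> P" for T e
      unfolding d_def by (rule Min_le) (use P(1) that in force)+
    have PB: "fst ` P \<subseteq> B" using P(2) by force
    obtain f where f: "f \<in> S" "\<And>T. T \<in> insert (id_op H) (fst ` P) \<Longrightarrow> cmod (f T - \<phi> T) < d"
      using approx[of "insert (id_op H) (fst ` P)" d] P(1) PB Bin(7) d by blast
    have "f \<in> \<Inter>F'" unfolding P(3)
    proof (clarsimp)
      fix T e assume Te: "(T, e) \<in> P"
      have "cmod (f T - \<phi> T) < d" by (rule f(2)) (use Te in force)
      then show "cmod (f T - \<phi> T) \<le> e" using dle[OF Te] by linarith
    qed
    then show "S \<inter> \<Inter>F' \<noteq> {}" using f(1) by blast
  qed
  then obtain f where f: "f \<in> S" "\<And>T e. T \<in> B \<Longrightarrow> e > 0 \<Longrightarrow> cmod (f T - \<phi> T) \<le> e" by auto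
  have "f T = \<phi> T" if "T \<in> B" for T
  proof -
    have "cmod (f T - \<phi> T) \<le> 0" by (rule field_le_epsilon) (use f(2)[OF that] in simp)
    then show ?thesis by simp
  qed
  then show ?thesis using f(1) unfolding S_def by blast
qed

text \<open>
  Sums of vector functionals form a convex cone. An element \<open>x\<close> separating \<open>f\<close> from this cone would
  be non-negative on the cone, because the cone is invariant under scaling, but \<open>Re f(x) < 0\<close>. This
  contradicts the positivity of \<open>f\<close>.
\<close>

theorem state_vector_approximation:
  assumes f: "state H (bop H) f" and X: "finite X" "X \<subseteq> bop H" and e: "e > 0"
  shows "\<exists>(n::nat) \<eta>. (\<forall>i<n. \<eta> i \<in> V) \<and> (\<forall>T\<in>X. cmod (f T - (\<Sum>i<n. ip H (T (\<eta> i)) (\<eta> i))) < e)"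
proof (rule ccontr)
  assume neg: "\<not> ?thesis"
  define g where "g = (\<lambda>(n::nat) \<eta> T. \<Sum>i<n. ip H (T (\<eta> i :: 'v)) (\<eta> i))"
  define C where "C = {g n \<eta> |n \<eta>. \<forall>i<n. \<eta> i \<in> V}"
  have X0: "X \<noteq> {}"
  proof
    assume "X = {}" then show False using neg by (auto dest!: spec[of _ 0])
  qed
  define \<C> where "\<C> = (\<lambda>p T. if T \<in> X then p T else (0::complex)) ` C"
  have "convex \<C>" unfolding convex_alt
  proof (intro ballI allI impI)
    fix a b and t :: real assume a: "a \<in> \<C>" and b: "b \<in> \<C>" and t: "0 \<le> t \<and> t \<le> 1"
    obtain n \<eta> where n: "a = (\<lambda>T. if T \<in> X then g n \<eta> T else 0)" "\<And>i. i < n \<Longrightarrow> \<eta> i \<in> V"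
      using a unfolding \<C>_def C_def by blast
    obtain k \<zeta> where k: "b = (\<lambda>T. if T \<in> X then g k \<zeta> T else 0)" "\<And>i. i < k \<Longrightarrow> \<zeta> i \<in> V"
      using b unfolding \<C>_def C_def by blast
    \<comment> \<open>A convex combination of two sums of vector functionals is obtained by concatenating the families
      of vectors, scaled by the square roots of the coefficients.\<close>
    define \<theta> where "\<theta> i = (if i < n then of_real (sqrt (1 - t)) *\<^sub>C \<eta> i else of_real (sqrt t) *\<^sub>C \<zeta> (i - n))" for i
    have \<theta>: "\<theta> i \<in> V" if "i < n + k" for i using that n(2) k(2) by (auto simp: \<theta>_def)
    have sc: "ip H (T (of_real s *\<^sub>C x)) (of_real s *\<^sub>C x) = of_real (s * s) * ip H (T x) x" if "T \<in> X" "x \<in> V" for T x s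
      using that X(2) by (auto simp: bop_scale subset_iff)
    have "g (n + k) \<theta> T = of_real (1 - t) * g n \<eta> T + of_real t * g k \<zeta> T" if T: "T \<in> X" for T
    proof -
      have split: "(\<Sum>i<n + k. q i) = (\<Sum>i<n. q i) + (\<Sum>i<k. q (i + n))" for q :: "nat \<Rightarrow> complex"
        by (induction k) (auto simp: add_ac)
      have "g (n + k) \<theta> T = (\<Sum>i<n. ip H (T (\<theta> i)) (\<theta> i)) + (\<Sum>i<k. ip H (T (\<theta> (i + n))) (\<theta> (i + n)))"
        unfolding g_def by (rule split)
      also have "(\<Sum>i<n. ip H (T (\<theta> i)) (\<theta> i)) = (\<Sum>i<n. of_real (1 - t) * ip H (T (\<eta> i)) (\<eta> i))"
        by (rule sum.cong) (use sc[OF T] n(2) t in \<open>auto simp: \<theta>_def simp del: of_real_mult of_real_diff\<close>)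
      also have "(\<Sum>i<k. ip H (T (\<theta> (i + n))) (\<theta> (i + n))) = (\<Sum>i<k. of_real t * ip H (T (\<zeta> i)) (\<zeta> i))"
        by (rule sum.cong) (use sc[OF T] k(2) t in \<open>auto simp: \<theta>_def simp del: of_real_mult\<close>)
      finally show ?thesis unfolding g_def sum_distrib_left .
    qed
    then have "(1 - t) *\<^sub>R a + t *\<^sub>R b = (\<lambda>T. if T \<in> X then g (n + k) \<theta> T else 0)"
      unfolding n(1) k(1) by (auto simp: fun_eq_iff scaleR_conv_of_real)
    moreover have "g (n + k) \<theta> \<in> C" unfolding C_def using \<theta> by blast
    ultimately show "(1 - t) *\<^sub>R a + t *\<^sub>R b \<in> \<C>" unfolding \<C>_def by blast
  qed
  then have "\<exists>c. \<forall>p\<in>\<C>. Re (\<Sum>T\<in>X. c T * f T) + e / 2 \<le> Re (\<Sum>T\<in>X. c T * p T)"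
  proof (rule approximate_or_separate[OF X(1) X0, where p = "\<lambda>T f. f T"])
    fix p assume "p \<in> \<C>"
    then obtain n \<eta> where n: "p = (\<lambda>T. if T \<in> X then g n \<eta> T else 0)" "\<And>i. i < n \<Longrightarrow> \<eta> i \<in> V"
      unfolding \<C>_def C_def by blast
    obtain T where "T \<in> X" "\<not> cmod (f T - g n \<eta> T) < e"
      using neg n(2) unfolding g_def by blast
    then show "\<exists>T\<in>X. e \<le> cmod (p T - f T)" unfolding n(1)
      by (intro bexI[of _ T]) (auto simp: norm_minus_commute)
  qed (auto simp: scaleR_conv_of_real)
  then obtain c where c: "\<And>p. p \<in> \<C> \<Longrightarrow> Re (\<Sum>T\<in>X. c T * f T) + e / 2 \<le> Re (\<Sum>T\<in>X. c T * p T)" by blast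
  define x where "x = (\<Sum>T\<in>X. c T *\<^sub>C T)"
  have xb: "x \<in> bop H" unfolding x_def using bop_subspace X(2)
    by (intro cvs.subspace_sum cvs.subspace_scale) auto
  note p = state_imp_positive_functional[OF f]
  have fx: "f x = (\<Sum>T\<in>X. c T * f T)"
    unfolding x_def by (rule positive_functional_sum[OF star_alg_bop p]) (use X in auto)
  have vec: "Re (f x) + e / 2 \<le> Re (ip H (x y) y)" if y: "y \<in> V" for y
  proof -
    have "g 1 (\<lambda>_. y) \<in> C" unfolding C_def using y by blast
    then have "(\<lambda>T. if T \<in> X then g 1 (\<lambda>_. y) T else 0) \<in> \<C>" unfolding \<C>_def by blast
    from c[OF this] have "Re (f x) + e / 2 \<le> Re (\<Sum>T\<in>X. c T * ip H (T y) y)"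
      unfolding fx g_def by simp
    also have "(\<Sum>T\<in>X. c T * ip H (T y) y) = ip H (x y) y" unfolding x_def
      by (rule positive_functional_sum[OF star_alg_bop vector_functional_positive[OF y order_refl], symmetric]) (use X in auto)
    finally show ?thesis .
  qed
  have "Re (f x) + e / 2 \<le> 0" using vec[of 0] xb by simp
  then have fneg: "Re (f x) < 0" using e by linarith
  have nonneg: "0 \<le> Re (ip H (x y) y)" if y: "y \<in> V" for y
  proof (rule ccontr)
    assume "\<not> 0 \<le> Re (ip H (x y) y)"
    then have r: "Re (ip H (x y) y) < 0" by simp
    \<comment> \<open>Scaling \<open>y\<close> by \<open>s\<close> makes the value of the form equal to \<open>Re f(x)\<close>, which violates the separation.\<close>
    define s where "s = sqrt ((Re (f x)) / Re (ip H (x y) y))"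
    have ss: "s * s = Re (f x) / Re (ip H (x y) y)"
      unfolding s_def using r fneg by (simp add: divide_nonpos_neg)
    have "ip H (x (of_real s *\<^sub>C y)) (of_real s *\<^sub>C y) = of_real (s * s) * ip H (x y) y"
      using xb y by (simp add: bop_scale)
    then have "Re (ip H (x (of_real s *\<^sub>C y)) (of_real s *\<^sub>C y)) = (s * s) * Re (ip H (x y) y)"
      by (simp only: Re_complex_of_real times_complex.sel Im_complex_of_real)
    also have "\<dots> = Re (f x)" unfolding ss using r by simp
    finally show False using vec[of "of_real s *\<^sub>C y"] y e by simp
  qed
  note z = real_part_op[OF star_alg_bop xb p, where m = 0]
  have "0 \<le> Re (f ((1/2) *\<^sub>C (x + adj H x) - of_real 0 *\<^sub>C id_op H))"
  proof (rule positive_functional_nonneg[OF star_alg_bop p _ z(1,2), where C = 1])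
    fix y assume y: "y \<in> V"
    show "0 \<le> Re (ip H (((1/2) *\<^sub>C (x + adj H x) - of_real 0 *\<^sub>C id_op H) y) y)"
      unfolding z(4)[OF y] using nonneg[OF y] by simp
  qed (simp add: state_norm_le[OF star_alg_bop op_closure_bop_subset f])
  then show False unfolding z(3) using fneg by simp
qed

end


section \<open>Unitary representations\<close>

text \<open>
  The elements of the group algebra are the finitely supported functions on the group, and a family
  \<open>p\<close> of vectors indexed by the group extends linearly to it by \<open>lincomb\<close>. For \<open>p = \<pi>\<close> this is
  the integrated form of the representation.
\<close>

definition finsupp :: "'g set \<Rightarrow> ('g \<Rightarrow> complex) set" where
  "finsupp X = {c. finite {g. c g \<noteq> 0} \<and> {g. c g \<noteq> 0} \<subseteq> X}"

definition lincomb :: "('g \<Rightarrow> complex) \<Rightarrow> ('g \<Rightarrow> 'a::complex_vector) \<Rightarrow> 'a" where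
  "lincomb c p = (\<Sum>g | c g \<noteq> 0. c g *\<^sub>C p g)"

lemma lincomb_superset:
  assumes "finite F" "{g. c g \<noteq> 0} \<subseteq> F" shows "lincomb c p = (\<Sum>g\<in>F. c g *\<^sub>C p g)"
  unfolding lincomb_def by (rule sum.mono_neutral_left) (use assms in auto)

lemma finsupp_subspace: "csubspace (finsupp X)"
proof (rule cvs.subspaceI)
  fix c d assume c: "c \<in> finsupp X" and d: "d \<in> finsupp X"
  have "{g. (c + d) g \<noteq> 0} \<subseteq> {g. c g \<noteq> 0} \<union> {g. d g \<noteq> 0}" by auto
  then show "c + d \<in> finsupp X" using c d unfolding finsupp_def by (auto intro: finite_subset)
next
  fix a c assume c: "c \<in> finsupp X"
  have "{g. (a *\<^sub>C c) g \<noteq> 0} \<subseteq> {g. c g \<noteq> 0}" by auto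
  then show "a *\<^sub>C c \<in> finsupp X" using c unfolding finsupp_def by (auto intro: finite_subset)
qed (simp add: finsupp_def)

lemma lincomb_add:
  assumes c: "c \<in> finsupp X" and d: "d \<in> finsupp X"
  shows "lincomb (c + d) p = lincomb c p + lincomb d p"
proof -
  let ?F = "{g. c g \<noteq> 0} \<union> {g. d g \<noteq> 0}"
  have F: "finite ?F" using c d by (auto simp: finsupp_def)
  have "lincomb (c + d) p = (\<Sum>g\<in>?F. (c + d) g *\<^sub>C p g)" by (rule lincomb_superset[OF F]) auto
  also have "\<dots> = (\<Sum>g\<in>?F. c g *\<^sub>C p g) + (\<Sum>g\<in>?F. d g *\<^sub>C p g)"
    by (simp add: scaleC_add_left sum.distrib)
  also have "\<dots> = lincomb c p + lincomb d p"
    using lincomb_superset[OF F, of c p] lincomb_superset[OF F, of d p] by simp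
  finally show ?thesis .
qed

lemma lincomb_scale:
  assumes c: "c \<in> finsupp X" shows "lincomb (a *\<^sub>C c) p = a *\<^sub>C lincomb c p"
proof -
  have "lincomb (a *\<^sub>C c) p = (\<Sum>g | c g \<noteq> 0. (a *\<^sub>C c) g *\<^sub>C p g)"
    by (rule lincomb_superset) (use c in \<open>auto simp: finsupp_def\<close>)
  then show ?thesis unfolding lincomb_def cvs.scale_sum_right by (simp add: scaleC_scaleC)
qed

lemma lincomb_diff:
  assumes c: "c \<in> finsupp X" and d: "d \<in> finsupp X"
  shows "lincomb (c - d) p = lincomb c p - lincomb d p"
proof -
  have "c - d \<in> finsupp X" using finsupp_subspace c d by (rule cvs.subspace_diff)
  from lincomb_add[OF this d, of p] show ?thesis by simp
qed

lemma lincomb_single: "g \<in> X \<Longrightarrow> (\<lambda>h. if h = g then 1 else 0) \<in> finsupp X"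
  "lincomb (\<lambda>h. if h = g then 1 else 0) p = p g"
  using lincomb_superset[of "{g}" "\<lambda>h. if h = g then 1 else 0" p] by (auto simp: finsupp_def scaleC_one)

lemma cspan_eq_lincomb: "cspan (p ` X) = (\<lambda>c. lincomb c p) ` finsupp X"
proof (intro equalityI)
  show "cspan (p ` X) \<subseteq> (\<lambda>c. lincomb c p) ` finsupp X"
  proof (rule cvs.span_minimal)
    show "p ` X \<subseteq> (\<lambda>c. lincomb c p) ` finsupp X"
    proof
      fix x assume "x \<in> p ` X"
      then obtain g where g: "g \<in> X" "x = p g" by blast
      have "x = lincomb (\<lambda>h. if h = g then 1 else 0) p" unfolding g(2) by (rule lincomb_single(2)[symmetric])
      then show "x \<in> (\<lambda>c. lincomb c p) ` finsupp X" using lincomb_single(1)[OF g(1)] by (rule image_eqI)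
    qed
    show "csubspace ((\<lambda>c. lincomb c p) ` finsupp X)"
    proof (rule cvs.subspaceI)
      show "0 \<in> (\<lambda>c. lincomb c p) ` finsupp X"
        by (rule image_eqI[of _ _ 0]) (auto simp: lincomb_def finsupp_def)
    next
      fix x y assume "x \<in> (\<lambda>c. lincomb c p) ` finsupp X" "y \<in> (\<lambda>c. lincomb c p) ` finsupp X"
      then obtain c d where c: "c \<in> finsupp X" "x = lincomb c p" and d: "d \<in> finsupp X" "y = lincomb d p" by blast
      have "x + y = lincomb (c + d) p" unfolding c(2) d(2) by (rule lincomb_add[OF c(1) d(1), symmetric])
      then show "x + y \<in> (\<lambda>c. lincomb c p) ` finsupp X"
        using cvs.subspace_add[OF finsupp_subspace c(1) d(1)] by (rule image_eqI)
    next
      fix a x assume "x \<in> (\<lambda>c. lincomb c p) ` finsupp X"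
      then obtain c where c: "c \<in> finsupp X" "x = lincomb c p" by blast
      have "a *\<^sub>C x = lincomb (a *\<^sub>C c) p" unfolding c(2) by (rule lincomb_scale[OF c(1), symmetric])
      then show "a *\<^sub>C x \<in> (\<lambda>c. lincomb c p) ` finsupp X"
        using cvs.subspace_scale[OF finsupp_subspace c(1)] by (rule image_eqI)
    qed
  qed
  show "(\<lambda>c. lincomb c p) ` finsupp X \<subseteq> cspan (p ` X)"
  proof (rule image_subsetI)
    fix c assume c: "c \<in> finsupp X"
    show "lincomb c p \<in> cspan (p ` X)" unfolding lincomb_def
      by (intro cvs.span_sum cvs.span_scale cvs.span_base) (use c in \<open>auto simp: finsupp_def\<close>)
  qed
qed

locale rep = group G + hilb H
  for G :: "('g, 'b) monoid_scheme" (structure) and H :: "'v::complex_vector hilbert" +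
  fixes \<pi> :: "'g \<Rightarrow> 'v \<Rightarrow> 'v"
  assumes unitary_rep: "unitary_rep G H \<pi>"
begin

lemma pi_in [simp]: "g \<in> carrier G \<Longrightarrow> \<pi> g \<in> bop H"
  and pi_ip: "g \<in> carrier G \<Longrightarrow> x \<in> V \<Longrightarrow> y \<in> V \<Longrightarrow> ip H (\<pi> g x) (\<pi> g y) = ip H x y"
  and pi_mult: "g \<in> carrier G \<Longrightarrow> h \<in> carrier G \<Longrightarrow> \<pi> (g \<otimes> h) = \<pi> g \<circ> \<pi> h"
  using unitary_rep by (auto simp: unitary_rep_def hom_def unitary_group_def)

lemma pi_one [simp]: "\<pi> \<one> = id_op H"
proof (rule op_eqI)
  fix x assume x: "x \<in> V"
  let ?d = "\<pi> \<one> x - x"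
  have d: "?d \<in> V" using x by simp
  have "\<pi> \<one> ?d = 0" using pi_mult[of \<one> \<one>] x by (simp add: bop_diff fun_eq_iff)
  then have "ip H ?d ?d = 0" using pi_ip[of \<one> ?d ?d] d by simp
  then have "?d = 0" using d by (rule ip_self_eq_0[rotated])
  then show "\<pi> \<one> x = id_op H x" using x by simp
qed auto

lemma pi_inv: "g \<in> carrier G \<Longrightarrow> \<pi> g \<circ> \<pi> (inv g) = id_op H" "g \<in> carrier G \<Longrightarrow> \<pi> (inv g) \<circ> \<pi> g = id_op H"
  by (simp_all flip: pi_mult)

lemma pi_adj [simp]: "g \<in> carrier G \<Longrightarrow> adj H (\<pi> g) = \<pi> (inv g)"
proof (rule adj_eqI)
  fix x y assume g: "g \<in> carrier G" and x: "x \<in> V" and y: "y \<in> V"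
  have "ip H (\<pi> g x) y = ip H (\<pi> (inv g) (\<pi> g x)) (\<pi> (inv g) y)" using g x y by (simp add: pi_ip)
  also have "\<pi> (inv g) (\<pi> g x) = x" using pi_inv(2)[OF g] x by (metis comp_apply id_apply)
  finally show "ip H (\<pi> g x) y = ip H x (\<pi> (inv g) y)" .
qed auto

lemma pi_nrm [simp]: "g \<in> carrier G \<Longrightarrow> x \<in> V \<Longrightarrow> nrm (\<pi> g x) = nrm x"
  by (simp add: hnorm_def pi_ip)

lemma Ad_eq: "g \<in> carrier G \<Longrightarrow> Ad H (\<pi> g) T = \<pi> g \<circ> T \<circ> \<pi> (inv g)"
  by (simp add: Ad_def)

lemma Ad_in [simp]: "g \<in> carrier G \<Longrightarrow> T \<in> bop H \<Longrightarrow> Ad H (\<pi> g) T \<in> bop H"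
  by (simp add: Ad_eq)

lemma Ad_add: "g \<in> carrier G \<Longrightarrow> S \<in> bop H \<Longrightarrow> T \<in> bop H \<Longrightarrow> Ad H (\<pi> g) (S + T) = Ad H (\<pi> g) S + Ad H (\<pi> g) T"
  by (simp add: Ad_eq comp_add_left comp_add_right)

lemma Ad_scale: "g \<in> carrier G \<Longrightarrow> T \<in> bop H \<Longrightarrow> Ad H (\<pi> g) (c *\<^sub>C T) = c *\<^sub>C Ad H (\<pi> g) T"
  by (simp add: Ad_eq comp_scale_left comp_scale_right)

lemma Ad_id [simp]: "g \<in> carrier G \<Longrightarrow> Ad H (\<pi> g) (id_op H) = id_op H"
  by (simp add: Ad_eq pi_inv)

lemma Ad_one [simp]: "T \<in> bop H \<Longrightarrow> Ad H (id_op H) T = T"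
  by (simp add: Ad_def)

lemma Ad_adj: "g \<in> carrier G \<Longrightarrow> T \<in> bop H \<Longrightarrow> adj H (Ad H (\<pi> g) T) = Ad H (\<pi> g) (adj H T)"
  by (simp add: Ad_eq adj_comp comp_assoc)

lemma Ad_comp: "g \<in> carrier G \<Longrightarrow> S \<in> bop H \<Longrightarrow> T \<in> bop H \<Longrightarrow> Ad H (\<pi> g) (S \<circ> T) = Ad H (\<pi> g) S \<circ> Ad H (\<pi> g) T"
proof -
  assume g: "g \<in> carrier G" and S: "S \<in> bop H" and T: "T \<in> bop H"
  have "Ad H (\<pi> g) S \<circ> Ad H (\<pi> g) T = \<pi> g \<circ> S \<circ> (\<pi> (inv g) \<circ> \<pi> g) \<circ> T \<circ> \<pi> (inv g)"
    using g by (simp add: Ad_eq comp_assoc)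
  also have "\<dots> = Ad H (\<pi> g) (S \<circ> T)" unfolding pi_inv(2)[OF g] using g S T by (simp add: Ad_eq comp_assoc)
  finally show ?thesis by simp
qed

lemma Ad_mult: "g \<in> carrier G \<Longrightarrow> h \<in> carrier G \<Longrightarrow> Ad H (\<pi> g) (Ad H (\<pi> h) T) = Ad H (\<pi> (g \<otimes> h)) T"
  by (simp only: Ad_eq m_closed) (simp add: pi_mult inv_mult_group comp_assoc)

lemma Ad_pi: "g \<in> carrier G \<Longrightarrow> h \<in> carrier G \<Longrightarrow> Ad H (\<pi> g) (\<pi> h) = \<pi> (g \<otimes> h \<otimes> inv g)"
  by (simp add: Ad_eq pi_mult)

lemma opnorm_Ad: assumes g: "g \<in> carrier G" and T: "T \<in> bop H" shows "opnorm H (Ad H (\<pi> g) T) \<le> opnorm H T"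
proof (rule opnorm_le)
  fix x assume x: "x \<in> V"
  show "nrm (Ad H (\<pi> g) T x) \<le> opnorm H T * nrm x"
    using opnorm_apply[OF T, of "\<pi> (inv g) x"] g T x by (simp add: Ad_eq)
qed (simp add: opnorm_nonneg T)

subsection \<open>The algebra generated by the representation\<close>

abbreviation "B \<equiv> cspan (\<pi> ` carrier G)"
abbreviation "A \<equiv> cstar_alg G H \<pi>"

lemma B_sub: "B \<subseteq> bop H"
  by (rule cvs.span_minimal) (auto simp: bop_subspace)

lemma pi_B: "g \<in> carrier G \<Longrightarrow> \<pi> g \<in> B" by (rule cvs.span_base) simp

lemma B_star_alg: "star_alg H B"
  unfolding star_alg_def
proof (intro conjI ballI)
  show "B \<subseteq> bop H" by (rule B_sub)
  show "csubspace B" by (rule cvs.subspace_span)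
  show "id_op H \<in> B" using pi_B[of \<one>] by simp
next
  fix S T assume S: "S \<in> B" and T: "T \<in> B"
  have 1: "B \<subseteq> {T \<in> bop H. \<pi> g \<circ> T \<in> B}" if g: "g \<in> carrier G" for g
  proof (rule cvs.span_minimal)
    have "\<pi> g \<circ> (0 :: 'v \<Rightarrow> 'v) = 0" by (rule op_eqI) (use g in auto)
    then show "csubspace {T \<in> bop H. \<pi> g \<circ> T \<in> B}"
      using g by (intro cvs.subspaceI) (auto simp: comp_add_right comp_scale_right cvs.span_add cvs.span_scale cvs.span_zero)
    show "\<pi> ` carrier G \<subseteq> {T \<in> bop H. \<pi> g \<circ> T \<in> B}" using g pi_B by (auto simp flip: pi_mult)
  qed
  have "B \<subseteq> {S. S \<circ> T \<in> B}"
  proof (rule cvs.span_minimal)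
    have "(0::'v \<Rightarrow> 'v) \<circ> T = 0" by (simp add: fun_eq_iff)
    then show "csubspace {S. S \<circ> T \<in> B}"
      by (intro cvs.subspaceI) (auto simp: comp_add_left comp_scale_left cvs.span_add cvs.span_scale cvs.span_zero)
    show "\<pi> ` carrier G \<subseteq> {S. S \<circ> T \<in> B}" using 1 T by auto
  qed
  then show "S \<circ> T \<in> B" using S by blast
next
  fix T assume T: "T \<in> B"
  have "B \<subseteq> {T \<in> bop H. adj H T \<in> B}"
  proof (rule cvs.span_minimal)
    show "csubspace {T \<in> bop H. adj H T \<in> B}"
      by (rule cvs.subspaceI) (auto simp: adj_add adj_scale cvs.span_add cvs.span_scale cvs.span_zero)
    show "\<pi> ` carrier G \<subseteq> {T \<in> bop H. adj H T \<in> B}" using pi_B by auto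
  qed
  then show "adj H T \<in> B" using T by blast
qed

lemma A_star_alg: "star_alg H A" unfolding cstar_alg_def by (rule star_alg_closure[OF B_star_alg])
lemma A_closed: "op_closure H A \<subseteq> A" unfolding cstar_alg_def by (rule op_closure_idem[OF B_sub])
lemma A_sub: "A \<subseteq> bop H" unfolding cstar_alg_def by (rule op_closure_bop)
lemma B_A: "B \<subseteq> A" unfolding cstar_alg_def by (rule op_closure_superset[OF B_sub])
lemma pi_A: "g \<in> carrier G \<Longrightarrow> \<pi> g \<in> A" using pi_B B_A by blast

lemma Ad_A: "g \<in> carrier G \<Longrightarrow> T \<in> A \<Longrightarrow> Ad H (\<pi> g) T \<in> A"
  using star_alg_in(5)[OF A_star_alg] pi_A by (simp add: Ad_eq)

text \<open>
  Identities between bounded linear functionals on \<open>A\<close> are checked on \<open>\<pi>(\<Gamma>)\<close>; here \<open>D\<close> is the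
  difference of the two sides.
\<close>

lemma vanish_on_A:
  assumes add: "\<And>S T. S \<in> bop H \<Longrightarrow> T \<in> bop H \<Longrightarrow> D (S + T) = D S + (D T :: complex)"
    and sc: "\<And>c T. T \<in> bop H \<Longrightarrow> D (c *\<^sub>C T) = c * D T"
    and bd: "\<And>T. T \<in> bop H \<Longrightarrow> cmod (D T) \<le> C * opnorm H T"
    and gen: "\<And>g. g \<in> carrier G \<Longrightarrow> D (\<pi> g) = 0" and T: "T \<in> A"
  shows "D T = 0"
proof -
  have D0: "D 0 = 0" using sc[of 0 0] by simp
  have B: "B \<subseteq> {T \<in> bop H. D T = 0}"
  proof (rule cvs.span_minimal)
    show "csubspace {T \<in> bop H. D T = 0}" by (rule cvs.subspaceI) (auto simp: add sc D0)
  qed (use gen in auto)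
  have Tb: "T \<in> bop H" using T A_sub by blast
  have "cmod (D T) \<le> 0"
  proof (rule field_le_epsilon)
    fix e :: real assume e: "e > 0"
    have p: "\<bar>C\<bar> + 1 > 0" by simp
    have "e / (\<bar>C\<bar> + 1) > 0" using e p by simp
    then obtain S where S: "S \<in> B" "opnorm H (T - S) < e / (\<bar>C\<bar> + 1)"
      using T unfolding cstar_alg_def op_closure_def by blast
    have Sb: "S \<in> bop H" "D S = 0" using B S(1) by auto
    have "D T = D (T - S) + D S" using add[of "T - S" S] Tb Sb by simp
    then have "cmod (D T) \<le> C * opnorm H (T - S)" using bd[of "T - S"] Tb Sb by simp
    also have "\<dots> \<le> (\<bar>C\<bar> + 1) * opnorm H (T - S)"
      using opnorm_nonneg[of "T - S"] Tb Sb by (intro mult_right_mono) auto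
    also have "\<dots> \<le> e" using S(2) p by (simp add: less_divide_eq mult.commute)
    finally show "cmod (D T) \<le> 0 + e" by simp
  qed
  then show ?thesis by simp
qed

subsection \<open>States and positive definite functions\<close>

text \<open>
  \<open>res f\<close> is the positive definite function \<open>f \<circ> \<pi>\<close>, and \<open>act\<close> is the action of the group on states
  of \<open>B(H)\<close> from the right, so that \<open>act g\<close> corresponds to the conjugation by \<open>g\<^sup>-\<^sup>1\<close>.
\<close>

definition states where "states = {f. state H (bop H) f}"
definition res :: "(('v \<Rightarrow> 'v) \<Rightarrow> complex) \<Rightarrow> 'g \<Rightarrow> complex" where
  "res f = (\<lambda>g. if g \<in> carrier G then f (\<pi> g) else 0)"
definition act :: "'g \<Rightarrow> (('v \<Rightarrow> 'v) \<Rightarrow> complex) \<Rightarrow> ('v \<Rightarrow> 'v) \<Rightarrow> complex" where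
  "act g f = (\<lambda>T. if T \<in> bop H then f (Ad H (\<pi> g) T) else 0)"

lemma states_bound: "f \<in> states \<Longrightarrow> T \<in> bop H \<Longrightarrow> cmod (f T) \<le> opnorm H T"
  unfolding states_def using state_norm_le[OF star_alg_bop op_closure_bop_subset] by simp

lemma states_positive: "f \<in> states \<Longrightarrow> positive_functional H (bop H) f"
  unfolding states_def using state_imp_positive_functional by simp

lemma states_one: "f \<in> states \<Longrightarrow> f (id_op H) = 1" by (simp add: states_def state_def)

lemmas states_add = positive_functionalD(1)[OF states_positive]
lemmas states_scale = positive_functionalD(2)[OF states_positive]
lemmas states_diff = positive_functional_diff[OF star_alg_bop states_positive]

lemma act_states: assumes g: "g \<in> carrier G" and f: "f \<in> states" shows "act g f \<in> states"
proof -
  have "f (Ad H (\<pi> g) (adj H T \<circ> T)) \<in> \<real>\<^sub>\<ge>\<^sub>0" if "T \<in> bop H" for T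
    using positive_functionalD(3)[OF states_positive[OF f] Ad_in[OF g that]] that g
    by (simp add: Ad_comp Ad_adj)
  then show ?thesis using g states_add[OF f] states_scale[OF f] states_one[OF f]
    unfolding states_def act_def state_def by (simp add: vanishes_off_def Ad_add Ad_scale)
qed

lemma compact_states_bop: "compact states" unfolding states_def by (rule compact_states[OF star_alg_bop op_closure_bop_subset])
lemma convex_states_bop: "convex states" unfolding states_def by (rule convex_states)

lemma states_nonempty: assumes "V \<noteq> {0}" shows "states \<noteq> {}"
proof -
  obtain x where x: "x \<in> V" "x \<noteq> 0" using assms zero_in by blast
  let ?w = "of_real (1 / nrm x) *\<^sub>C x"
  have n: "nrm x > 0" using nrm_pos x by blast
  then have c: "cmod (of_real (1 / nrm x)) = 1 / nrm x" by (simp only: norm_of_real) simp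
  have "?w \<in> V" "nrm ?w = 1" using nrm_scale[OF x(1), of "of_real (1 / nrm x)"] c n x by auto
  then show ?thesis using vector_state[of ?w] unfolding states_def by blast
qed

lemma res_affine: "res ((1 - t) *\<^sub>R f + t *\<^sub>R h) = (1 - t) *\<^sub>R res f + t *\<^sub>R res h"
  by (auto simp: res_def fun_eq_iff)

lemma res_continuous: "continuous_on X res"
  unfolding res_def
proof (rule continuous_on_coordinatewise_then_product)
  fix g show "continuous_on X (\<lambda>f. if g \<in> carrier G then f (\<pi> g) else 0)"
    by (cases "g \<in> carrier G") (auto intro!: continuous_on_subset[OF continuous_on_product_coordinates])
qed

lemma lincomb_pi_B: "c \<in> finsupp (carrier G) \<Longrightarrow> lincomb c \<pi> \<in> B"
  using cspan_eq_lincomb[of \<pi> "carrier G"] by blast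

lemma adj_sum: "(\<And>i. i \<in> I \<Longrightarrow> T i \<in> bop H) \<Longrightarrow> adj H (\<Sum>i\<in>I. c i *\<^sub>C T i) = (\<Sum>i\<in>I. cnj (c i) *\<^sub>C adj H (T i))"
proof (induction I rule: infinite_finite_induct)
  case (insert i I)
  have W: "(\<Sum>i\<in>I. c i *\<^sub>C T i) \<in> bop H" using bop_subspace insert(4) by (intro cvs.subspace_sum cvs.subspace_scale) auto
  have IH: "adj H (\<Sum>i\<in>I. c i *\<^sub>C T i) = (\<Sum>i\<in>I. cnj (c i) *\<^sub>C adj H (T i))" by (rule insert.IH) (simp add: insert.prems)
  have "adj H (\<Sum>i\<in>insert i I. c i *\<^sub>C T i) = (\<Sum>i\<in>insert i I. cnj (c i) *\<^sub>C adj H (T i))"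
    using insert.prems[of i] by (simp only: sum.insert[OF insert(1,2)] adj_add[OF op_scale_in W] adj_scale IH insertI1)
  then show ?case .
qed (simp_all only: sum.infinite sum.empty adj_zero not_False_eq_True)

lemma comp_sum_right: "R \<in> bop H \<Longrightarrow> (\<And>i. i \<in> I \<Longrightarrow> T i \<in> bop H) \<Longrightarrow>
    R \<circ> (\<Sum>i\<in>I. c i *\<^sub>C T i) = (\<Sum>i\<in>I. c i *\<^sub>C (R \<circ> T i))"
proof (induction I rule: infinite_finite_induct)
  case (insert i I)
  have W: "(\<Sum>i\<in>I. c i *\<^sub>C T i) \<in> bop H" using bop_subspace insert(5) by (intro cvs.subspace_sum cvs.subspace_scale) auto
  have IH: "R \<circ> (\<Sum>i\<in>I. c i *\<^sub>C T i) = (\<Sum>i\<in>I. c i *\<^sub>C (R \<circ> T i))" by (rule insert.IH) (simp_all add: insert.prems)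
  have "R \<circ> (\<Sum>i\<in>insert i I. c i *\<^sub>C T i) = (\<Sum>i\<in>insert i I. c i *\<^sub>C (R \<circ> T i))"
    using insert.prems(1) insert.prems(2)[of i]
    by (simp only: sum.insert[OF insert(1,2)] comp_add_right[OF _ op_scale_in W] comp_scale_right IH insertI1)
  then show ?case .
qed (auto intro!: op_eqI)

lemma comp_sum_left: "(\<Sum>i\<in>I. c i *\<^sub>C T i) \<circ> R = (\<Sum>i\<in>I. c i *\<^sub>C (T i \<circ> (R :: 'v \<Rightarrow> 'v)))"
  for T :: "'i \<Rightarrow> 'v \<Rightarrow> 'v"
proof (induction I rule: infinite_finite_induct)
  case (insert i I)
  have "(\<Sum>i\<in>insert i I. c i *\<^sub>C T i) \<circ> R = (\<Sum>i\<in>insert i I. c i *\<^sub>C (T i \<circ> R))"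
    using insert.IH by (simp only: sum.insert[OF insert(1,2)] comp_add_left comp_scale_left)
  then show ?case .
qed (auto simp: fun_eq_iff)

lemma adj_lincomb_comp_lincomb:
  assumes c: "c \<in> finsupp (carrier G)" and d: "d \<in> finsupp (carrier G)"
  shows "adj H (lincomb c \<pi>) \<circ> lincomb d \<pi> =
    (\<Sum>g | c g \<noteq> 0. cnj (c g) *\<^sub>C (\<Sum>h | d h \<noteq> 0. d h *\<^sub>C \<pi> (inv g \<otimes> h)))"
proof -
  have cG: "g \<in> carrier G" if "c g \<noteq> 0" for g using c that by (auto simp: finsupp_def)
  have dG: "g \<in> carrier G" if "d g \<noteq> 0" for g using d that by (auto simp: finsupp_def)
  have "adj H (lincomb c \<pi>) \<circ> lincomb d \<pi> = (\<Sum>g | c g \<noteq> 0. cnj (c g) *\<^sub>C adj H (\<pi> g)) \<circ> (\<Sum>h | d h \<noteq> 0. d h *\<^sub>C \<pi> h)"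
    unfolding lincomb_def by (subst adj_sum) (use cG in auto)
  also have "\<dots> = (\<Sum>g | c g \<noteq> 0. cnj (c g) *\<^sub>C (adj H (\<pi> g) \<circ> (\<Sum>h | d h \<noteq> 0. d h *\<^sub>C \<pi> h)))"
    by (rule comp_sum_left)
  also have "\<dots> = (\<Sum>g | c g \<noteq> 0. cnj (c g) *\<^sub>C (\<Sum>h | d h \<noteq> 0. d h *\<^sub>C \<pi> (inv g \<otimes> h)))"
  proof (rule sum.cong[OF refl])
    fix g assume g: "g \<in> {g. c g \<noteq> 0}"
    have "adj H (\<pi> g) \<circ> (\<Sum>h | d h \<noteq> 0. d h *\<^sub>C \<pi> h) = (\<Sum>h | d h \<noteq> 0. d h *\<^sub>C (adj H (\<pi> g) \<circ> \<pi> h))"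
      by (rule comp_sum_right) (use g cG dG in auto)
    also have "\<dots> = (\<Sum>h | d h \<noteq> 0. d h *\<^sub>C \<pi> (inv g \<otimes> h))"
      by (rule sum.cong) (use g cG dG in \<open>auto simp: pi_mult\<close>)
    finally show "cnj (c g) *\<^sub>C (adj H (\<pi> g) \<circ> (\<Sum>h | d h \<noteq> 0. d h *\<^sub>C \<pi> h)) =
        cnj (c g) *\<^sub>C (\<Sum>h | d h \<noteq> 0. d h *\<^sub>C \<pi> (inv g \<otimes> h))" by simp
  qed
  finally show ?thesis .
qed

lemma functional_lincomb:
  assumes W: "csubspace W" and add: "\<And>S T. S \<in> W \<Longrightarrow> T \<in> W \<Longrightarrow> \<phi> (S + T) = \<phi> S + \<phi> T"
    and sc: "\<And>c T. T \<in> W \<Longrightarrow> \<phi> (c *\<^sub>C T) = c * \<phi> T" and B: "B \<subseteq> W"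
    and c: "c \<in> finsupp (carrier G)" and d: "d \<in> finsupp (carrier G)"
    and u: "\<And>g. g \<in> carrier G \<Longrightarrow> \<phi> (\<pi> g) = u g"
  shows "\<phi> (lincomb c \<pi>) = lincomb c u"
    and "\<phi> (adj H (lincomb c \<pi>) \<circ> lincomb d \<pi>) = (\<Sum>g | c g \<noteq> 0. \<Sum>h | d h \<noteq> 0. cnj (c g) * d h * u (inv g \<otimes> h))"
proof -
  have cG: "g \<in> carrier G" if "c g \<noteq> 0" for g using c that by (auto simp: finsupp_def)
  have dG: "g \<in> carrier G" if "d g \<noteq> 0" for g using d that by (auto simp: finsupp_def)
  have piW: "\<pi> g \<in> W" if "g \<in> carrier G" for g using B pi_B that by blast
  note lin = linear_on_sum[where \<phi> = \<phi>, OF W add sc]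
  have "\<phi> (lincomb c \<pi>) = (\<Sum>g | c g \<noteq> 0. c g * \<phi> (\<pi> g))"
    unfolding lincomb_def by (rule lin) (use cG piW in auto)
  also have "\<dots> = lincomb c u" unfolding lincomb_def by (rule sum.cong) (use u cG in auto)
  finally show "\<phi> (lincomb c \<pi>) = lincomb c u" .
  have "\<phi> (adj H (lincomb c \<pi>) \<circ> lincomb d \<pi>) =
      (\<Sum>g | c g \<noteq> 0. cnj (c g) * \<phi> (\<Sum>h | d h \<noteq> 0. d h *\<^sub>C \<pi> (inv g \<otimes> h)))"
    unfolding adj_lincomb_comp_lincomb[OF c d]
    by (rule lin) (use cG dG piW W in \<open>auto intro!: cvs.subspace_sum cvs.subspace_scale\<close>)
  also have "\<dots> = (\<Sum>g | c g \<noteq> 0. \<Sum>h | d h \<noteq> 0. cnj (c g) * d h * u (inv g \<otimes> h))"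
  proof (rule sum.cong[OF refl])
    fix g assume g: "g \<in> {g. c g \<noteq> 0}"
    have "\<phi> (\<Sum>h | d h \<noteq> 0. d h *\<^sub>C \<pi> (inv g \<otimes> h)) = (\<Sum>h | d h \<noteq> 0. d h * \<phi> (\<pi> (inv g \<otimes> h)))"
      by (rule lin) (use g cG dG piW in auto)
    also have "\<dots> = (\<Sum>h | d h \<noteq> 0. d h * u (inv g \<otimes> h))"
      by (rule sum.cong) (use u g cG dG in auto)
    finally show "cnj (c g) * \<phi> (\<Sum>h | d h \<noteq> 0. d h *\<^sub>C \<pi> (inv g \<otimes> h)) =
        (\<Sum>h | d h \<noteq> 0. cnj (c g) * d h * u (inv g \<otimes> h))"
      by (simp add: sum_distrib_left mult.assoc)
  qed
  finally show "\<phi> (adj H (lincomb c \<pi>) \<circ> lincomb d \<pi>) = (\<Sum>g | c g \<noteq> 0. \<Sum>h | d h \<noteq> 0. cnj (c g) * d h * u (inv g \<otimes> h))" .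
qed

lemma states_lincomb:
  assumes f: "f \<in> states" and c: "c \<in> finsupp (carrier G)" and d: "d \<in> finsupp (carrier G)"
  shows "f (lincomb c \<pi>) = lincomb c (res f)"
    and "f (adj H (lincomb c \<pi>) \<circ> lincomb d \<pi>) = (\<Sum>g | c g \<noteq> 0. \<Sum>h | d h \<noteq> 0. cnj (c g) * d h * res f (inv g \<otimes> h))"
proof -
  show "f (lincomb c \<pi>) = lincomb c (res f)"
    by (rule functional_lincomb(1)[OF bop_subspace states_add[OF f] states_scale[OF f] B_sub c d]) (auto simp: res_def)
  show "f (adj H (lincomb c \<pi>) \<circ> lincomb d \<pi>) = (\<Sum>g | c g \<noteq> 0. \<Sum>h | d h \<noteq> 0. cnj (c g) * d h * res f (inv g \<otimes> h))"
    by (rule functional_lincomb(2)[OF bop_subspace states_add[OF f] states_scale[OF f] B_sub c d]) (auto simp: res_def)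
qed

lemma res_PD1: assumes f: "f \<in> states" shows "res f \<in> PD1 G"
  unfolding PD1_def
proof (intro CollectI conjI allI impI)
  show "vanishes_off (carrier G) (res f)" by (simp add: vanishes_off_def res_def)
  show "res f \<one> = 1" using states_one[OF f] by (simp add: res_def)
  fix F and c :: "'g \<Rightarrow> complex" assume F: "finite F \<and> F \<subseteq> carrier G"
  define c' where "c' g = (if g \<in> F then c g else 0)" for g
  have sub: "{g. c' g \<noteq> 0} \<subseteq> F" by (auto simp: c'_def)
  have c': "c' \<in> finsupp (carrier G)" using F sub by (auto simp: finsupp_def intro: finite_subset)
  have "f (adj H (lincomb c' \<pi>) \<circ> lincomb c' \<pi>) = (\<Sum>g | c' g \<noteq> 0. \<Sum>h | c' h \<noteq> 0. cnj (c' g) * c' h * res f (inv g \<otimes> h))"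
    by (rule states_lincomb(2)[OF f c' c'])
  also have "\<dots> = (\<Sum>g\<in>F. \<Sum>h | c' h \<noteq> 0. cnj (c' g) * c' h * res f (inv g \<otimes> h))"
    by (rule sum.mono_neutral_left) (use F sub in auto)
  also have "\<dots> = (\<Sum>g\<in>F. \<Sum>h\<in>F. cnj (c g) * c h * res f (inv g \<otimes> h))"
  proof (rule sum.cong[OF refl])
    fix g assume g: "g \<in> F"
    have "(\<Sum>h | c' h \<noteq> 0. cnj (c' g) * c' h * res f (inv g \<otimes> h)) = (\<Sum>h\<in>F. cnj (c' g) * c' h * res f (inv g \<otimes> h))"
      by (rule sum.mono_neutral_left) (use F sub in auto)
    also have "\<dots> = (\<Sum>h\<in>F. cnj (c g) * c h * res f (inv g \<otimes> h))"
      by (rule sum.cong) (use g in \<open>auto simp: c'_def\<close>)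
    finally show "(\<Sum>h | c' h \<noteq> 0. cnj (c' g) * c' h * res f (inv g \<otimes> h)) = (\<Sum>h\<in>F. cnj (c g) * c h * res f (inv g \<otimes> h))" .
  qed
  finally show "(\<Sum>g\<in>F. \<Sum>h\<in>F. cnj (c g) * c h * res f (inv g \<otimes> h)) \<in> \<real>\<^sub>\<ge>\<^sub>0"
    using positive_functionalD(3)[OF states_positive[OF f], of "lincomb c' \<pi>"] lincomb_pi_B[OF c'] B_sub by auto
qed

lemma res_act_conj: "g \<in> carrier G \<Longrightarrow> res (act (inv g) f) = conj_act G g (res f)"
  by (auto simp: res_def act_def conj_act_def Ad_pi fun_eq_iff)

end


section \<open>Transfer of amenability\<close>

context hilb begin

text \<open>
  In this and the following lemmas the dense subspace is given as the image of a linear map \<open>e\<close>; in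
  the application \<open>e c = \<rho>(c) \<xi>\<close> for a cyclic vector \<open>\<xi>\<close>.
\<close>

lemma dense_orthogonal_zero:
  assumes e: "\<And>c. c \<in> W \<Longrightarrow> e c \<in> V" and dense: "\<And>v \<epsilon>. v \<in> V \<Longrightarrow> 0 < \<epsilon> \<Longrightarrow> \<exists>c\<in>W. nrm (v - e c) < \<epsilon>"
    and u: "u \<in> V" and orth: "\<And>c. c \<in> W \<Longrightarrow> ip H (e c) u = 0"
  shows "u = 0"
proof (rule ccontr)
  assume "u \<noteq> 0"
  then have n: "nrm u > 0" using u by (rule nrm_pos[rotated])
  obtain c where c: "c \<in> W" "nrm (u - e c) < nrm u" using dense[OF u n] by blast
  have "ip H u u = ip H (u - e c) u" using u e[OF c(1)] orth[OF c(1)] by simp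
  then have "(nrm u)\<^sup>2 = Re (ip H (u - e c) u)" using ip_self[OF u] by (metis Re_complex_of_real)
  also have "\<dots> \<le> nrm (u - e c) * nrm u"
    using complex_Re_le_cmod[of "ip H (u - e c) u"] cauchy_schwarz[of "u - e c" u] u e[OF c(1)] by simp
  also have "\<dots> < nrm u * nrm u" using c(2) n by simp
  finally show False by (simp add: power2_eq_square)
qed

lemma dense_op_eqI:
  assumes e: "\<And>c. c \<in> W \<Longrightarrow> e c \<in> V" and dense: "\<And>v \<epsilon>. v \<in> V \<Longrightarrow> 0 < \<epsilon> \<Longrightarrow> \<exists>c\<in>W. nrm (v - e c) < \<epsilon>"
    and S: "S \<in> bop H" and T: "T \<in> bop H"
    and eq: "\<And>c d. c \<in> W \<Longrightarrow> d \<in> W \<Longrightarrow> ip H (S (e d)) (e c) = ip H (T (e d)) (e c)"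
  shows "S = T"
proof (rule op_eqI[OF S T])
  fix v assume v: "v \<in> V"
  have 1: "S (e d) = T (e d)" if d: "d \<in> W" for d
  proof -
    have "S (e d) - T (e d) = 0"
    proof (rule dense_orthogonal_zero[OF e dense])
      fix c assume c: "c \<in> W"
      have "ip H (S (e d) - T (e d)) (e c) = 0" using eq[OF c d] S T e c d by simp
      then show "ip H (e c) (S (e d) - T (e d)) = 0"
        using ip_sym[of "S (e d) - T (e d)" "e c"] S T e c d by simp
    qed (use S T e d in auto)
    then show ?thesis by simp
  qed
  have D: "adj H (S - T) \<in> bop H" using S T by simp
  have "S v - T v = 0"
  proof (rule ip_eqI[where z = 0])
    fix y assume y: "y \<in> V"
    have "adj H (S - T) y = 0"
    proof (rule dense_orthogonal_zero[OF e dense])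
      fix c assume c: "c \<in> W"
      have "ip H (e c) (adj H (S - T) y) = ip H ((S - T) (e c)) y"
        using adj_ip[of "S - T" "e c" y] S T e c y by simp
      then show "ip H (e c) (adj H (S - T) y) = 0" using 1[OF c] y by simp
    qed (use D y in auto)
    then have "ip H ((S - T) v) y = 0" using adj_ip[of "S - T" v y] S T v y by simp
    then have "ip H (S v - T v) y = 0" by simp
    then show "ip H y (S v - T v) = ip H y 0"
      using ip_sym[of "S v - T v" y] S T v y by simp
  qed (use S T v in auto)
  then show "S v = T v" by simp
qed

lemma dense_form_nonneg:
  assumes e: "\<And>c. c \<in> W \<Longrightarrow> e c \<in> V" and dense: "\<And>v \<epsilon>. v \<in> V \<Longrightarrow> 0 < \<epsilon> \<Longrightarrow> \<exists>c\<in>W. nrm (v - e c) < \<epsilon>"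
    and S: "S \<in> bop H" and pos: "\<And>c. c \<in> W \<Longrightarrow> 0 \<le> Re (ip H (S (e c)) (e c))" and v: "v \<in> V"
  shows "0 \<le> Re (ip H (S v) v)"
proof (rule field_le_epsilon)
  fix \<epsilon> :: real assume \<epsilon>: "\<epsilon> > 0"
  define M where "M = opnorm H S * (2 * nrm v + 1) + 1"
  have On: "0 \<le> opnorm H S" using opnorm_nonneg[OF S] .
  have M: "M > 0" unfolding M_def using On v by (simp add: add_nonneg_pos)
  define \<delta> where "\<delta> = min 1 (\<epsilon> / M)"
  have \<delta>: "0 < \<delta>" "\<delta> \<le> 1" "\<delta> * M \<le> \<epsilon>" using \<epsilon> M by (auto simp: \<delta>_def min_def field_simps)
  obtain c where c: "c \<in> W" "nrm (v - e c) < \<delta>" using dense[OF v \<delta>(1)] by blast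
  let ?w = "e c"
  have w: "?w \<in> V" using e[OF c(1)] .
  have nw: "nrm ?w \<le> nrm v + 1"
    using nrm_le_add_diff[OF w v] nrm_minus_commute[OF w v] c(2) \<delta>(2) by linarith
  have "ip H (S ?w) ?w = ip H (S v) v - ip H (S (v - ?w)) v - ip H (S ?w) (v - ?w)"
    using S v w by (simp add: bop_diff)
  then have eq: "Re (ip H (S ?w) ?w) = Re (ip H (S v) v) - Re (ip H (S (v - ?w)) v) - Re (ip H (S ?w) (v - ?w))" by simp
  have b: "\<bar>Re (ip H (S x) y)\<bar> \<le> opnorm H S * nrm x * nrm y" if "x \<in> V" "y \<in> V" for x y
  proof -
    have "\<bar>Re (ip H (S x) y)\<bar> \<le> nrm (S x) * nrm y"
      using abs_Re_le_cmod[of "ip H (S x) y"] cauchy_schwarz[of "S x" y] S that by simp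
    also have "\<dots> \<le> opnorm H S * nrm x * nrm y" using opnorm_apply[OF S that(1)] that by (intro mult_right_mono) auto
    finally show ?thesis .
  qed
  have "opnorm H S * nrm (v - ?w) * nrm v \<le> opnorm H S * \<delta> * nrm v"
    using c(2) On v by (intro mult_right_mono mult_left_mono) auto
  moreover have "opnorm H S * nrm ?w * nrm (v - ?w) \<le> opnorm H S * (nrm v + 1) * \<delta>"
    using c(2) On v w nw by (intro mult_mono mult_left_mono) auto
  moreover have "opnorm H S * \<delta> * nrm v + opnorm H S * (nrm v + 1) * \<delta> \<le> \<delta> * M"
    unfolding M_def using \<delta>(1) by (simp add: algebra_simps)
  ultimately show "0 \<le> Re (ip H (S v) v) + \<epsilon>"
    using pos[OF c(1)] eq b[of "v - ?w" v] b[of ?w "v - ?w"] \<delta>(3) v w by fastforce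
qed

text \<open>
  The Riesz theorem is applied twice: for fixed \<open>c\<close> it represents the functional \<open>L c\<close> by a vector
  \<open>z c\<close>, and for fixed \<open>v\<close> it represents \<open>c \<mapsto> \<langle>z c, v\<rangle>\<close>, which defines the operator at \<open>v\<close>.
\<close>

theorem operator_of_form:
  fixes e :: "'c::complex_vector \<Rightarrow> 'v" and L :: "'c \<Rightarrow> 'c \<Rightarrow> complex"
  assumes W: "csubspace W" and e: "\<And>c. c \<in> W \<Longrightarrow> e c \<in> V"
    and eadd: "\<And>c d. c \<in> W \<Longrightarrow> d \<in> W \<Longrightarrow> e (c + d) = e c + e d"
    and esc: "\<And>a c. c \<in> W \<Longrightarrow> e (a *\<^sub>C c) = a *\<^sub>C e c"
    and dense: "\<And>v \<epsilon>. v \<in> V \<Longrightarrow> 0 < \<epsilon> \<Longrightarrow> \<exists>c\<in>W. nrm (v - e c) < \<epsilon>"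
    and add2: "\<And>c d d'. c \<in> W \<Longrightarrow> d \<in> W \<Longrightarrow> d' \<in> W \<Longrightarrow> L c (d + d') = L c d + L c d'"
    and sc2: "\<And>a c d. c \<in> W \<Longrightarrow> d \<in> W \<Longrightarrow> L c (a *\<^sub>C d) = a * L c d"
    and add1: "\<And>c c' d. c \<in> W \<Longrightarrow> c' \<in> W \<Longrightarrow> d \<in> W \<Longrightarrow> L (c + c') d = L c d + L c' d"
    and sc1: "\<And>a c d. c \<in> W \<Longrightarrow> d \<in> W \<Longrightarrow> L (a *\<^sub>C c) d = cnj a * L c d"
    and bd: "\<And>c d. c \<in> W \<Longrightarrow> d \<in> W \<Longrightarrow> cmod (L c d) \<le> M * nrm (e c) * nrm (e d)" and M: "0 \<le> M"
  shows "\<exists>S\<in>bop H. \<forall>c\<in>W. \<forall>d\<in>W. ip H (S (e d)) (e c) = L c d"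
proof -
  have "\<exists>z\<in>V. (\<forall>d\<in>W. ip H (e d) z = L c d) \<and> nrm z \<le> M * nrm (e c)" if c: "c \<in> W" for c
    by (rule riesz[OF W]) (use e eadd esc add2 sc2 bd M c in auto)
  then obtain z where z: "\<And>c. c \<in> W \<Longrightarrow> z c \<in> V" "\<And>c d. c \<in> W \<Longrightarrow> d \<in> W \<Longrightarrow> ip H (e d) (z c) = L c d"
    "\<And>c. c \<in> W \<Longrightarrow> nrm (z c) \<le> M * nrm (e c)" by metis
  have Wadd: "c + d \<in> W" if "c \<in> W" "d \<in> W" for c d using W that by (rule cvs.subspace_add)
  have Wsc: "a *\<^sub>C c \<in> W" if "c \<in> W" for a c using W that by (rule cvs.subspace_scale)
  have zadd: "z (c + d) = z c + z d" if c: "c \<in> W" and d: "d \<in> W" for c d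
  proof -
    have "z (c + d) - (z c + z d) = 0"
      by (rule dense_orthogonal_zero[OF e dense]) (use z c d Wadd e add1 in auto)
    then show ?thesis by simp
  qed
  have zsc: "z (a *\<^sub>C c) = a *\<^sub>C z c" if c: "c \<in> W" for a c
  proof -
    have "z (a *\<^sub>C c) - a *\<^sub>C z c = 0"
      by (rule dense_orthogonal_zero[OF e dense]) (use z c Wsc e sc1 in auto)
    then show ?thesis by simp
  qed
  have "\<exists>s\<in>V. (\<forall>c\<in>W. ip H (e c) s = ip H (z c) v) \<and> nrm s \<le> M * nrm v" if v: "v \<in> V" for v
  proof (rule riesz[OF W e eadd esc])
    fix c assume c: "c \<in> W"
    have "cmod (ip H (z c) v) \<le> nrm (z c) * nrm v" using z c v by (intro cauchy_schwarz) auto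
    also have "\<dots> \<le> M * nrm (e c) * nrm v" using z c v by (intro mult_right_mono) auto
    finally show "cmod (ip H (z c) v) \<le> M * nrm v * nrm (e c)" by (simp add: mult_ac)
  qed (use z zadd zsc v M in auto)
  then obtain s where s: "\<And>v. v \<in> V \<Longrightarrow> s v \<in> V" "\<And>v c. v \<in> V \<Longrightarrow> c \<in> W \<Longrightarrow> ip H (e c) (s v) = ip H (z c) v"
    "\<And>v. v \<in> V \<Longrightarrow> nrm (s v) \<le> M * nrm v" by metis
  define S where "S v = (if v \<in> V then s v else 0)" for v
  have "S \<in> bop H"
  proof (rule bopI[where C = M])
    fix x y assume x: "x \<in> V" and y: "y \<in> V"
    have "s (x + y) - (s x + s y) = 0"
      by (rule dense_orthogonal_zero[OF e dense]) (use s x y e z in auto)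
    then show "S (x + y) = S x + S y" using x y by (simp add: S_def)
  next
    fix a x assume x: "x \<in> V"
    have "s (a *\<^sub>C x) - a *\<^sub>C s x = 0"
      by (rule dense_orthogonal_zero[OF e dense]) (use s x e z in auto)
    then show "S (a *\<^sub>C x) = a *\<^sub>C S x" using x by (simp add: S_def)
  qed (use s in \<open>auto simp: S_def\<close>)
  moreover have "ip H (S (e d)) (e c) = L c d" if c: "c \<in> W" and d: "d \<in> W" for c d
  proof -
    have "ip H (S (e d)) (e c) = cnj (ip H (e c) (s (e d)))" using s c d e by (simp add: S_def ip_sym[of "e c" "s (e d)"])
    also have "\<dots> = cnj (ip H (z c) (e d))" using s c d e by simp
    also have "\<dots> = ip H (e d) (z c)" using ip_sym[of "z c" "e d"] z e c d by simp
    finally show ?thesis using z c d by simp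
  qed
  ultimately show ?thesis by blast
qed

end

text \<open>
  The function \<open>shift G k d\<close> is \<open>k\<^sup>-\<^sup>1 d\<close> in the group algebra.
\<close>

definition shift :: "('g, 'b) monoid_scheme \<Rightarrow> 'g \<Rightarrow> ('g \<Rightarrow> complex) \<Rightarrow> 'g \<Rightarrow> complex" where
  "shift G k d = (\<lambda>g. if g \<in> carrier G then d (k \<otimes>\<^bsub>G\<^esub> g) else 0)"

lemma sum_fun_apply: "(\<Sum>i\<in>I. F i) y = (\<Sum>i\<in>I. F i y)"
  by (induction I rule: infinite_finite_induct) auto

context rep begin

lemma shift_support:
  assumes k: "k \<in> carrier G" and d: "d \<in> finsupp (carrier G)"
  shows "{g. shift G k d g \<noteq> 0} = (\<lambda>h. inv k \<otimes> h) ` {h. d h \<noteq> 0}"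
proof (intro equalityI subsetI)
  fix g assume "g \<in> {g. shift G k d g \<noteq> 0}"
  then have g: "g \<in> carrier G" "d (k \<otimes> g) \<noteq> 0" by (auto simp: shift_def split: if_splits)
  have "inv k \<otimes> (k \<otimes> g) = g" using k g(1) by (simp add: m_assoc[symmetric])
  then show "g \<in> (\<lambda>h. inv k \<otimes> h) ` {h. d h \<noteq> 0}" using g(2) by force
next
  fix g assume "g \<in> (\<lambda>h. inv k \<otimes> h) ` {h. d h \<noteq> 0}"
  then obtain h where h: "g = inv k \<otimes> h" "d h \<noteq> 0" by blast
  have hG: "h \<in> carrier G" using d h(2) by (auto simp: finsupp_def)
  have "k \<otimes> (inv k \<otimes> h) = h" using k hG by (simp add: m_assoc[symmetric])
  then show "g \<in> {g. shift G k d g \<noteq> 0}" using h k hG by (simp add: shift_def)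
qed

lemma shift_finsupp: "k \<in> carrier G \<Longrightarrow> d \<in> finsupp (carrier G) \<Longrightarrow> shift G k d \<in> finsupp (carrier G)"
  unfolding finsupp_def using shift_support[of k d] by (auto simp: finsupp_def)

lemma lincomb_shift:
  assumes k: "k \<in> carrier G" and d: "d \<in> finsupp (carrier G)"
  shows "lincomb (shift G k d) \<pi> = \<pi> (inv k) \<circ> lincomb d \<pi>"
proof -
  have dG: "h \<in> carrier G" if "d h \<noteq> 0" for h using d that by (auto simp: finsupp_def)
  have inj: "inj_on (\<lambda>h. inv k \<otimes> h) {h. d h \<noteq> 0}"
    using k dG by (auto simp: inj_on_def)
  have "lincomb (shift G k d) \<pi> = (\<Sum>h | d h \<noteq> 0. shift G k d (inv k \<otimes> h) *\<^sub>C \<pi> (inv k \<otimes> h))"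
    unfolding lincomb_def shift_support[OF k d] by (subst sum.reindex[OF inj]) simp
  also have "\<dots> = (\<Sum>h | d h \<noteq> 0. d h *\<^sub>C (\<pi> (inv k) \<circ> \<pi> h))"
  proof (rule sum.cong[OF refl])
    fix h assume "h \<in> {h. d h \<noteq> 0}"
    then have h: "h \<in> carrier G" using dG by simp
    have "k \<otimes> (inv k \<otimes> h) = h" using k h by (simp add: m_assoc[symmetric])
    then have "shift G k d (inv k \<otimes> h) = d h" using k h by (simp add: shift_def)
    then show "shift G k d (inv k \<otimes> h) *\<^sub>C \<pi> (inv k \<otimes> h) = d h *\<^sub>C (\<pi> (inv k) \<circ> \<pi> h)"
      using k h by (simp only: pi_mult[OF inv_closed])
  qed
  also have "\<dots> = \<pi> (inv k) \<circ> lincomb d \<pi>"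
    unfolding lincomb_def by (rule comp_sum_right[symmetric]) (use k dG in auto)
  finally show ?thesis .
qed

text \<open>
  The difference of the two sides is the value of \<open>f\<close> at \<open>X\<^sup>* (\<parallel>T\<parallel>\<^sup>2 - T\<^sup>* T) X\<close>, a positive operator.
\<close>

lemma state_compression_le:
  assumes f: "f \<in> states" and T: "T \<in> bop H" and X: "X \<in> bop H"
  shows "Re (f (adj H (T \<circ> X) \<circ> (T \<circ> X))) \<le> (opnorm H T)\<^sup>2 * Re (f (adj H X \<circ> X))"
proof -
  let ?P = "adj H X \<circ> X" and ?Q = "adj H (T \<circ> X) \<circ> (T \<circ> X)"
  let ?z = "of_real ((opnorm H T)\<^sup>2) *\<^sub>C ?P - ?Q"
  have in': "?P \<in> bop H" "?Q \<in> bop H" "T \<circ> X \<in> bop H" using T X by auto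
  have "f ?z \<in> \<real>\<^sub>\<ge>\<^sub>0"
  proof (rule state_nonneg[OF star_alg_bop op_closure_bop_subset, where \<phi> = f])
    show "state H (bop H) f" using f by (simp add: states_def)
    show "?z \<in> bop H" using in' by simp
    show "adj H ?z = ?z" using in' adj_comp_self[OF X] adj_comp_self[OF in'(3)] by (simp add: adj_diff adj_scale)
    fix x assume x: "x \<in> V"
    have "Re (ip H (?P x) x) = (nrm (X x))\<^sup>2" using nrm_adj_apply[OF X x] by simp
    moreover have "Re (ip H (?Q x) x) = (nrm (T (X x)))\<^sup>2" using nrm_adj_apply[OF in'(3) x] by simp
    moreover have "(nrm (T (X x)))\<^sup>2 \<le> (opnorm H T * nrm (X x))\<^sup>2"
      using opnorm_apply[OF T, of "X x"] T X x by (intro power_mono) auto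
    moreover have "ip H (?z x) x = of_real ((opnorm H T)\<^sup>2) * ip H (?P x) x - ip H (?Q x) x"
    proof -
      have "?z x = of_real ((opnorm H T)\<^sup>2) *\<^sub>C (?P x) - ?Q x" by simp
      moreover have "?P x \<in> V" "?Q x \<in> V" by (rule bop_in[OF in'(1) x] bop_in[OF in'(2) x])+
      ultimately show ?thesis using x by (simp only: ip_diff_left ip_scale_left scale_in)
    qed
    ultimately show "0 \<le> Re (ip H (?z x) x)" by (simp add: power_mult_distrib)
  qed
  moreover have "f ?z = of_real ((opnorm H T)\<^sup>2) * f ?P - f ?Q"
    using states_diff[OF f op_scale_in[OF in'(1)] in'(2)] states_scale[OF f in'(1)] by simp
  ultimately show ?thesis by (simp add: complex_nonneg_Reals_iff)
qed

text \<open>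
  The assignment \<open>\<langle>\<Phi>(T) \<rho>(d) \<xi>, \<rho>(c) \<xi>\<rangle> = f(\<pi>(c)\<^sup>* T \<pi>(d))\<close> defines a unital positive map from
  \<open>B(H)\<close> to the bounded operators on the GNS space, because for \<open>T = 1\<close> it is the inner product.
  It intertwines the two conjugation actions, since translating \<open>c\<close> and \<open>d\<close> by a group element has
  the same effect as conjugating \<open>T\<close>. Composing an invariant state with \<open>\<Phi>\<close> gives an invariant state.
\<close>

theorem amenable_transfer:
  fixes K :: "'w::complex_vector hilbert"
  assumes f: "f \<in> states" and gns: "gns_triple G \<psi> K \<rho> \<xi>" and \<psi>: "\<And>g. g \<in> carrier G \<Longrightarrow> \<psi> g = f (\<pi> g)"
    and am: "amenable_rep G K \<rho>"
  shows "amenable_rep G H \<pi>"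
proof -
  interpret K: rep G K \<rho>
    using gns by unfold_locales (simp_all add: gns_triple_def)
  have \<xi>: "\<xi> \<in> vecs K" using gns by (simp add: gns_triple_def)
  define W where "W = finsupp (carrier G)"
  define x where "x c = lincomb c \<pi>" for c
  define e where "e c = lincomb c \<rho> \<xi>" for c
  have W: "csubspace W" unfolding W_def by (rule finsupp_subspace)
  have xb: "x c \<in> bop H" if "c \<in> W" for c using lincomb_pi_B B_sub that unfolding x_def W_def by blast
  have rb: "lincomb c \<rho> \<in> bop K" if "c \<in> W" for c using K.lincomb_pi_B K.B_sub that unfolding W_def by blast
  have eV: "e c \<in> vecs K" if "c \<in> W" for c unfolding e_def using rb[OF that] \<xi> by simp
  have xadd: "x (c + d) = x c + x d" if "c \<in> W" "d \<in> W" for c d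
    using that unfolding x_def W_def by (rule lincomb_add)
  have xsc: "x (a *\<^sub>C c) = a *\<^sub>C x c" if "c \<in> W" for a c
    using that unfolding x_def W_def by (rule lincomb_scale)
  have eadd: "e (c + d) = e c + e d" if "c \<in> W" "d \<in> W" for c d
    using lincomb_add[of c "carrier G" d \<rho>] that unfolding e_def W_def by simp
  have esc: "e (a *\<^sub>C c) = a *\<^sub>C e c" if "c \<in> W" for a c
    using lincomb_scale[of c "carrier G" a \<rho>] that unfolding e_def W_def by simp
  have ipe: "ip K (e d) (e c) = f (adj H (x c) \<circ> x d)" if c: "c \<in> W" and d: "d \<in> W" for c d
  proof -
    have "ip K (e d) (e c) = ip K ((adj K (lincomb c \<rho>) \<circ> lincomb d \<rho>) \<xi>) \<xi>"
      unfolding e_def using rb[OF c] rb[OF d] \<xi> by (simp add: K.adj_ip')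
    also have "\<dots> = (\<Sum>g | c g \<noteq> 0. \<Sum>h | d h \<noteq> 0. cnj (c g) * d h * res f (inv g \<otimes> h))"
    proof (rule K.functional_lincomb(2)[OF K.bop_subspace _ _ K.B_sub, where \<phi> = "\<lambda>T. ip K (T \<xi>) \<xi>"])
      fix g assume g: "g \<in> carrier G"
      then show "ip K (\<rho> g \<xi>) \<xi> = res f g" using gns \<psi>[OF g] by (simp add: gns_triple_def res_def)
    qed (use \<xi> c d in \<open>auto simp: W_def\<close>)
    also have "\<dots> = f (adj H (x c) \<circ> x d)"
      unfolding x_def by (rule states_lincomb(2)[OF f, symmetric]) (use c d in \<open>auto simp: W_def\<close>)
    finally show ?thesis .
  qed
  have nre: "(K.nrm (e c))\<^sup>2 = Re (f (adj H (x c) \<circ> x c))" if c: "c \<in> W" for c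
    using ipe[OF c c] K.ip_self[OF eV[OF c]] by (metis Re_complex_of_real)
  have dense: "\<exists>c\<in>W. K.nrm (v - e c) < \<epsilon>" if v: "v \<in> vecs K" and \<epsilon>: "0 < \<epsilon>" for v \<epsilon>
  proof -
    have "v \<in> hclosure K (cspan ((\<lambda>g. \<rho> g \<xi>) ` carrier G))" using gns v by (simp add: gns_triple_def)
    then obtain y where y: "y \<in> cspan ((\<lambda>g. \<rho> g \<xi>) ` carrier G)" "K.nrm (v - y) < \<epsilon>"
      using \<epsilon> unfolding hclosure_def by blast
    obtain c where c: "c \<in> W" "y = lincomb c (\<lambda>g. \<rho> g \<xi>)" using y(1) unfolding cspan_eq_lincomb W_def by blast
    have "y = e c" unfolding c(2) e_def lincomb_def sum_fun_apply by simp
    then show ?thesis using c(1) y(2) by blast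
  qed
  define L where "L T c d = f (adj H (x c) \<circ> (T \<circ> x d))" for T c d
  have ex: "\<exists>S\<in>bop K. \<forall>c\<in>W. \<forall>d\<in>W. ip K (S (e d)) (e c) = L T c d" if T: "T \<in> bop H" for T
  proof (rule K.operator_of_form[OF W eV eadd esc dense, where M = "opnorm H T"])
    fix c d d' assume c: "c \<in> W" and d: "d \<in> W" and d': "d' \<in> W"
    note b = xb[OF c] xb[OF d] xb[OF d']
    have "adj H (x c) \<circ> (T \<circ> x (d + d')) = (adj H (x c) \<circ> (T \<circ> x d)) + (adj H (x c) \<circ> (T \<circ> x d'))"
      using b T by (simp add: xadd[OF d d'] comp_add_right)
    then show "L T c (d + d') = L T c d + L T c d'"
      unfolding L_def using b T states_add[OF f, of "adj H (x c) \<circ> (T \<circ> x d)" "adj H (x c) \<circ> (T \<circ> x d')"] by simp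
    have "adj H (x (d + d')) \<circ> (T \<circ> x c) = (adj H (x d) \<circ> (T \<circ> x c)) + (adj H (x d') \<circ> (T \<circ> x c))"
      using b T by (simp add: xadd[OF d d'] adj_add comp_add_left)
    then show "L T (d + d') c = L T d c + L T d' c"
      unfolding L_def using b T states_add[OF f, of "adj H (x d) \<circ> (T \<circ> x c)" "adj H (x d') \<circ> (T \<circ> x c)"] by simp
  next
    fix a c d assume c: "c \<in> W" and d: "d \<in> W"
    note b = xb[OF c] xb[OF d]
    have "adj H (x c) \<circ> (T \<circ> x (a *\<^sub>C d)) = a *\<^sub>C (adj H (x c) \<circ> (T \<circ> x d))"
      using b T by (simp add: xsc[OF d] comp_scale_right)
    then show "L T c (a *\<^sub>C d) = a * L T c d"
      unfolding L_def using b T states_scale[OF f, of "adj H (x c) \<circ> (T \<circ> x d)" a] by simp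
    have "adj H (x (a *\<^sub>C c)) \<circ> (T \<circ> x d) = cnj a *\<^sub>C (adj H (x c) \<circ> (T \<circ> x d))"
      using b T by (simp add: xsc[OF c] adj_scale comp_scale_left)
    then show "L T (a *\<^sub>C c) d = cnj a * L T c d"
      unfolding L_def using b T states_scale[OF f, of "adj H (x c) \<circ> (T \<circ> x d)" "cnj a"] by simp
    have "(cmod (L T c d))\<^sup>2 \<le> Re (f (adj H (T \<circ> x d) \<circ> (T \<circ> x d))) * Re (f (adj H (x c) \<circ> x c))"
      unfolding L_def
      by (rule positive_functional_cauchy_schwarz(1)[OF star_alg_bop states_positive[OF f]]) (use b T in auto)
    also have "\<dots> \<le> ((opnorm H T)\<^sup>2 * (K.nrm (e d))\<^sup>2) * (K.nrm (e c))\<^sup>2"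
      unfolding nre[OF c, symmetric] nre[OF d] by (intro mult_right_mono state_compression_le f T b) simp
    also have "\<dots> = (opnorm H T * K.nrm (e c) * K.nrm (e d))\<^sup>2" by (simp add: power_mult_distrib mult_ac)
    finally show "cmod (L T c d) \<le> opnorm H T * K.nrm (e c) * K.nrm (e d)"
      by (rule power2_le_imp_le) (use opnorm_nonneg[OF T] eV c d in auto)
  qed (use opnorm_nonneg[OF T] in auto)
  define \<Phi> where "\<Phi> T = (SOME S. S \<in> bop K \<and> (\<forall>c\<in>W. \<forall>d\<in>W. ip K (S (e d)) (e c) = L T c d))" for T
  have \<Phi>: "\<Phi> T \<in> bop K" "\<And>c d. c \<in> W \<Longrightarrow> d \<in> W \<Longrightarrow> ip K (\<Phi> T (e d)) (e c) = L T c d" if T: "T \<in> bop H" for T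
  proof -
    have "\<exists>S. S \<in> bop K \<and> (\<forall>c\<in>W. \<forall>d\<in>W. ip K (S (e d)) (e c) = L T c d)" using ex[OF T] by blast
    from someI_ex[OF this] show "\<Phi> T \<in> bop K" "\<And>c d. c \<in> W \<Longrightarrow> d \<in> W \<Longrightarrow> ip K (\<Phi> T (e d)) (e c) = L T c d"
      unfolding \<Phi>_def by blast+
  qed
  have uniq: "\<Phi> T = S" if T: "T \<in> bop H" and S: "S \<in> bop K" and "\<And>c d. c \<in> W \<Longrightarrow> d \<in> W \<Longrightarrow> ip K (S (e d)) (e c) = L T c d" for T S
    by (rule K.dense_op_eqI[OF eV dense \<Phi>(1)[OF T] S]) (use \<Phi>(2)[OF T] that(3) in auto)
  have \<Phi>add: "\<Phi> (S + T) = \<Phi> S + \<Phi> T" if S: "S \<in> bop H" and T: "T \<in> bop H" for S T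
  proof (rule uniq)
    fix c d assume c: "c \<in> W" and d: "d \<in> W"
    note b = xb[OF c] xb[OF d]
    have "adj H (x c) \<circ> ((S + T) \<circ> x d) = (adj H (x c) \<circ> (S \<circ> x d)) + (adj H (x c) \<circ> (T \<circ> x d))"
      using b S T by (simp add: comp_add_left comp_add_right)
    then have "L (S + T) c d = L S c d + L T c d"
      unfolding L_def using b S T states_add[OF f, of "adj H (x c) \<circ> (S \<circ> x d)" "adj H (x c) \<circ> (T \<circ> x d)"] by simp
    then show "ip K ((\<Phi> S + \<Phi> T) (e d)) (e c) = L (S + T) c d"
      using \<Phi>[OF S] \<Phi>[OF T] c d eV by simp
  qed (use S T \<Phi> in auto)
  have \<Phi>sc: "\<Phi> (a *\<^sub>C T) = a *\<^sub>C \<Phi> T" if T: "T \<in> bop H" for a T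
  proof (rule uniq)
    fix c d assume c: "c \<in> W" and d: "d \<in> W"
    note b = xb[OF c] xb[OF d]
    have "adj H (x c) \<circ> ((a *\<^sub>C T) \<circ> x d) = a *\<^sub>C (adj H (x c) \<circ> (T \<circ> x d))"
      using b T by (simp add: comp_scale_left comp_scale_right)
    then have "L (a *\<^sub>C T) c d = a * L T c d"
      unfolding L_def using b T states_scale[OF f, of "adj H (x c) \<circ> (T \<circ> x d)" a] by simp
    then show "ip K ((a *\<^sub>C \<Phi> T) (e d)) (e c) = L (a *\<^sub>C T) c d"
      using \<Phi>[OF T] c d eV by simp
  qed (use T \<Phi> in auto)
  have \<Phi>id: "\<Phi> (id_op H) = id_op K"
    by (rule uniq) (use ipe eV xb in \<open>auto simp: L_def\<close>)
  have \<Phi>adj: "adj K (\<Phi> T) = \<Phi> (adj H T)" if T: "T \<in> bop H" for T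
  proof (rule uniq[symmetric])
    fix c d assume c: "c \<in> W" and d: "d \<in> W"
    note b = xb[OF c] xb[OF d]
    have "ip K (adj K (\<Phi> T) (e d)) (e c) = ip K (e d) (\<Phi> T (e c))"
      using K.adj_ip'[OF \<Phi>(1)[OF T] eV[OF d] eV[OF c]] .
    also have "\<dots> = cnj (ip K (\<Phi> T (e c)) (e d))"
      using K.ip_sym[of "\<Phi> T (e c)" "e d"] \<Phi>(1)[OF T] eV c d by simp
    also have "\<dots> = cnj (f (adj H (x d) \<circ> (T \<circ> x c)))" using \<Phi>(2)[OF T d c] by (simp add: L_def)
    also have "\<dots> = f (adj H (adj H (x d) \<circ> (T \<circ> x c)))"
      by (rule positive_functional_adj[OF star_alg_bop states_positive[OF f], symmetric]) (use b T in auto)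
    also have "adj H (adj H (x d) \<circ> (T \<circ> x c)) = adj H (x c) \<circ> (adj H T \<circ> x d)"
      using b T by (simp add: adj_comp comp_assoc)
    finally show "ip K (adj K (\<Phi> T) (e d)) (e c) = L (adj H T) c d" unfolding L_def .
  qed (use T \<Phi> in auto)
  have \<Phi>Ad: "\<Phi> (Ad H (\<pi> k) T) = Ad K (\<rho> k) (\<Phi> T)" if k: "k \<in> carrier G" and T: "T \<in> bop H" for k T
  proof (rule uniq)
    fix c d assume c: "c \<in> W" and d: "d \<in> W"
    note b = xb[OF c] xb[OF d]
    let ?c = "shift G k c" and ?d = "shift G k d"
    have c': "?c \<in> W" and d': "?d \<in> W" using shift_finsupp k c d by (auto simp: W_def)
    have xs: "x ?c = \<pi> (inv k) \<circ> x c" "x ?d = \<pi> (inv k) \<circ> x d"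
      using lincomb_shift k c d by (auto simp: W_def x_def)
    have es: "e ?c = \<rho> (inv k) (e c)" "e ?d = \<rho> (inv k) (e d)"
      using K.lincomb_shift k c d by (auto simp: W_def e_def)
    have "ip K (Ad K (\<rho> k) (\<Phi> T) (e d)) (e c) = ip K (\<rho> k (\<Phi> T (e ?d))) (e c)"
      using k by (simp add: K.Ad_eq es)
    also have "\<dots> = ip K (\<Phi> T (e ?d)) (e ?c)"
      using K.adj_ip[of "\<rho> k" "\<Phi> T (e ?d)" "e c"] k \<Phi>(1)[OF T] eV d' c by (simp add: es(1))
    also have "\<dots> = L T ?c ?d" by (rule \<Phi>(2)[OF T c' d'])
    also have "\<dots> = L (Ad H (\<pi> k) T) c d"
      unfolding L_def xs using b T k by (simp add: adj_comp Ad_eq comp_assoc)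
    finally show "ip K (Ad K (\<rho> k) (\<Phi> T) (e d)) (e c) = L (Ad H (\<pi> k) T) c d" .
  qed (use k T \<Phi> in auto)
  obtain \<omega> where \<omega>: "state K (bop K) \<omega>" "\<And>g T. g \<in> carrier G \<Longrightarrow> T \<in> bop K \<Longrightarrow> \<omega> (Ad K (\<rho> g) T) = \<omega> T"
    using am unfolding amenable_rep_def by blast
  define \<omega>' where "\<omega>' T = (if T \<in> bop H then \<omega> (\<Phi> T) else 0)" for T
  have "\<omega> (\<Phi> (adj H T \<circ> T)) \<in> \<real>\<^sub>\<ge>\<^sub>0" if T: "T \<in> bop H" for T
  proof (rule K.state_nonneg[OF K.star_alg_bop K.op_closure_bop_subset \<omega>(1)])
    have TT: "adj H T \<circ> T \<in> bop H" using T by simp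
    show "\<Phi> (adj H T \<circ> T) \<in> bop K" by (rule \<Phi>(1)[OF TT])
    show "adj K (\<Phi> (adj H T \<circ> T)) = \<Phi> (adj H T \<circ> T)" unfolding \<Phi>adj[OF TT] adj_comp_self[OF T] ..
    fix v assume v: "v \<in> vecs K"
    show "0 \<le> Re (ip K (\<Phi> (adj H T \<circ> T) v) v)"
    proof (rule K.dense_form_nonneg[where W = W and e = e])
      fix c assume c: "c \<in> W"
      have "adj H (x c) \<circ> ((adj H T \<circ> T) \<circ> x c) = adj H (T \<circ> x c) \<circ> (T \<circ> x c)"
        using T xb[OF c] by (simp add: adj_comp comp_assoc)
      then have "ip K (\<Phi> (adj H T \<circ> T) (e c)) (e c) = f (adj H (T \<circ> x c) \<circ> (T \<circ> x c))"
        using \<Phi>(2)[OF TT c c] by (simp add: L_def)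
      also have "\<dots> \<in> \<real>\<^sub>\<ge>\<^sub>0" by (rule positive_functionalD(3)[OF states_positive[OF f]]) (use T xb[OF c] in simp)
      finally show "0 \<le> Re (ip K (\<Phi> (adj H T \<circ> T) (e c)) (e c))" by (simp add: complex_nonneg_Reals_iff)
    qed (fact eV dense \<Phi>(1)[OF TT] v)+
  qed
  then have "state H (bop H) \<omega>'"
    using \<omega>(1) \<Phi> \<Phi>add \<Phi>sc \<Phi>id unfolding state_def \<omega>'_def by (simp add: vanishes_off_def)
  moreover have "\<omega>' (Ad H (\<pi> g) T) = \<omega>' T" if "g \<in> carrier G" "T \<in> bop H" for g T
    using that \<omega>(2) \<Phi> \<Phi>Ad by (simp add: \<omega>'_def)
  ultimately show ?thesis unfolding amenable_rep_def by blast
qed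

end


section \<open>Characters that come from the representation\<close>

context rep begin

text \<open>
  The sesquilinear form on the group algebra from which the GNS space of \<open>u\<close> is built.
\<close>

definition gns_form :: "('g \<Rightarrow> complex) \<Rightarrow> ('g \<Rightarrow> complex) \<Rightarrow> ('g \<Rightarrow> complex) \<Rightarrow> complex" where
  "gns_form u c d = (\<Sum>g | c g \<noteq> 0. \<Sum>h | d h \<noteq> 0. cnj (c g) * d h * u (inv g \<otimes> h))"

lemma gns_form_alt: "gns_form u c d = cnj (lincomb c (\<lambda>g. cnj (lincomb d (\<lambda>h. u (inv g \<otimes> h)))))"
  unfolding gns_form_def lincomb_def by (simp add: sum_distrib_left mult.assoc)

lemma PD1_form_nonneg: assumes u: "u \<in> PD1 G" and c: "c \<in> finsupp (carrier G)" shows "gns_form u c c \<in> \<real>\<^sub>\<ge>\<^sub>0"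
  using u c unfolding gns_form_def PD1_def finsupp_def by blast

text \<open>
  The Cauchy-Schwarz inequality of the GNS form for \<open>c\<close> and the unit of the group algebra.
\<close>

lemma PD1_norm_le:
  assumes u: "u \<in> PD1 G" and c: "c \<in> finsupp (carrier G)"
  shows "(cmod (lincomb c u))\<^sup>2 \<le> Re (gns_form u c c)"
proof -
  define \<delta> where "\<delta> = (\<lambda>h. if h = \<one> then 1 else (0::complex))"
  have \<delta>: "\<delta> \<in> finsupp (carrier G)" unfolding \<delta>_def by (rule lincomb_single) simp
  have "(cmod (gns_form u \<delta> c))\<^sup>2 \<le> Re (gns_form u c c) * Re (gns_form u \<delta> \<delta>)"
  proof (rule positive_form_cauchy_schwarz[OF finsupp_subspace, where B = "\<lambda>x y. gns_form u y x"])
    fix x y z assume "x \<in> finsupp (carrier G)" "y \<in> finsupp (carrier G)" "z \<in> finsupp (carrier G)"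
    then show "gns_form u z (x + y) = gns_form u z x + gns_form u z y" "gns_form u (x + y) z = gns_form u x z + gns_form u y z"
      unfolding gns_form_alt by (simp_all add: lincomb_add[of x "carrier G" y])
        (simp add: lincomb_def algebra_simps sum.distrib)
  next
    fix a x y assume "x \<in> finsupp (carrier G)" "y \<in> finsupp (carrier G)"
    then show "gns_form u y (a *\<^sub>C x) = a * gns_form u y x"
      unfolding gns_form_alt by (simp add: lincomb_scale[of x "carrier G" a]) (simp add: lincomb_def sum_distrib_left mult_ac)
  next
    fix a x y assume "x \<in> finsupp (carrier G)" "y \<in> finsupp (carrier G)"
    then show "gns_form u (a *\<^sub>C y) x = cnj a * gns_form u y x"
      unfolding gns_form_alt by (simp add: lincomb_scale[of y "carrier G" a])
  qed (use PD1_form_nonneg u c \<delta> in auto)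
  moreover have "gns_form u \<delta> d = lincomb d (\<lambda>h. u (\<one> \<otimes> h))" for d
    unfolding gns_form_alt \<delta>_def lincomb_single(2) by simp
  moreover have "lincomb c (\<lambda>h. u (\<one> \<otimes> h)) = lincomb c u"
    unfolding lincomb_def by (rule sum.cong) (use c in \<open>auto simp: finsupp_def\<close>)
  moreover have "lincomb \<delta> (\<lambda>h. u (\<one> \<otimes> h)) = 1"
    unfolding \<delta>_def lincomb_single(2) using u by (simp add: PD1_def)
  ultimately show ?thesis by simp
qed

text \<open>
  Since \<open>(1 - t) u\<close> is dominated by \<open>f \<circ> \<pi>\<close>, the linear extension of \<open>u\<close> to the group algebra
  satisfies \<open>|u(c)|\<^sup>2 \<le> f(\<pi>(c)\<^sup>* \<pi>(c)) / (1 - t) \<le> \<parallel>\<pi>(c)\<parallel>\<^sup>2 / (1 - t)\<close>. So it factors through the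
  algebra spanned by \<open>\<pi>(\<Gamma>)\<close> as a bounded positive functional there, which extends to a state.
\<close>

theorem dominated_is_state:
  assumes f: "f \<in> states" and u: "u \<in> PD1 G" and v: "v \<in> PD1 G" and t: "0 \<le> t" "t < 1"
    and eq: "res f = (1 - t) *\<^sub>R u + t *\<^sub>R v" and V: "V \<noteq> {0}"
  shows "\<exists>f'\<in>states. res f' = u"
proof -
  define W where "W = finsupp (carrier G)"
  define M where "M = sqrt (1 / (1 - t))"
  have xb: "lincomb c \<pi> \<in> bop H" if "c \<in> W" for c using lincomb_pi_B B_sub that unfolding W_def by blast
  have bd: "cmod (lincomb c u) \<le> M * opnorm H (lincomb c \<pi>)" if c: "c \<in> W" for c
  proof -
    let ?x = "lincomb c \<pi>"
    have cW: "c \<in> finsupp (carrier G)" using c by (simp add: W_def)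
    have "f (adj H ?x \<circ> ?x) = gns_form (res f) c c" unfolding gns_form_def by (rule states_lincomb(2)[OF f cW cW])
    also have "\<dots> = of_real (1 - t) * gns_form u c c + of_real t * gns_form v c c"
      unfolding eq gns_form_def by (simp add: scaleR_conv_of_real algebra_simps sum.distrib sum_distrib_left sum_subtractf)
    finally have "Re (f (adj H ?x \<circ> ?x)) = (1 - t) * Re (gns_form u c c) + t * Re (gns_form v c c)" by simp
    moreover have "0 \<le> t * Re (gns_form v c c)"
      using PD1_form_nonneg[OF v cW] t by (simp add: complex_nonneg_Reals_iff)
    moreover have "Re (f (adj H ?x \<circ> ?x)) \<le> (opnorm H ?x)\<^sup>2"
    proof -
      have "Re (f (adj H ?x \<circ> ?x)) \<le> opnorm H (adj H ?x \<circ> ?x)"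
        using states_bound[OF f, of "adj H ?x \<circ> ?x"] complex_Re_le_cmod[of "f (adj H ?x \<circ> ?x)"] xb[OF c] by simp
      also have "\<dots> \<le> opnorm H (adj H ?x) * opnorm H ?x" using xb[OF c] by (intro opnorm_comp) auto
      also have "\<dots> \<le> opnorm H ?x * opnorm H ?x"
        using xb[OF c] opnorm_adj_le opnorm_nonneg by (intro mult_right_mono) auto
      finally show ?thesis by (simp add: power2_eq_square)
    qed
    ultimately have "(1 - t) * Re (gns_form u c c) \<le> (opnorm H ?x)\<^sup>2" by linarith
    then have "Re (gns_form u c c) \<le> (1 / (1 - t)) * (opnorm H ?x)\<^sup>2" using t by (simp add: field_simps)
    then have "(cmod (lincomb c u))\<^sup>2 \<le> (M * opnorm H ?x)\<^sup>2"
      using PD1_norm_le[OF u cW] t by (simp add: power_mult_distrib M_def)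
    then show ?thesis
      by (rule power2_le_imp_le) (use opnorm_nonneg[OF xb[OF c]] t in \<open>simp add: M_def\<close>)
  qed
  define \<phi> where "\<phi> T = lincomb (SOME c. c \<in> W \<and> T = lincomb c \<pi>) u" for T
  have \<phi>: "\<phi> (lincomb c \<pi>) = lincomb c u" if c: "c \<in> W" for c
  proof -
    let ?d = "SOME d. d \<in> W \<and> lincomb c \<pi> = lincomb d \<pi>"
    have d: "?d \<in> W" "lincomb c \<pi> = lincomb ?d \<pi>"
      using someI_ex[of "\<lambda>d. d \<in> W \<and> lincomb c \<pi> = lincomb d \<pi>"] c by auto
    have cd: "c - ?d \<in> W" using finsupp_subspace c d(1) unfolding W_def by (rule cvs.subspace_diff)
    have "lincomb (c - ?d) \<pi> = lincomb c \<pi> - lincomb ?d \<pi>"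
      using lincomb_diff c d(1) unfolding W_def by blast
    also have "\<dots> = 0" using d(2) by simp
    finally have "lincomb (c - ?d) u = 0" using bd[OF cd] by simp
    moreover have "lincomb (c - ?d) u = lincomb c u - lincomb ?d u"
      using lincomb_diff c d(1) unfolding W_def by blast
    ultimately show ?thesis unfolding \<phi>_def by simp
  qed
  have Bex: "\<exists>c\<in>W. T = lincomb c \<pi>" if "T \<in> B" for T using that unfolding cspan_eq_lincomb W_def by blast
  have add: "\<phi> (S + T) = \<phi> S + \<phi> T" if S: "S \<in> B" and T: "T \<in> B" for S T
  proof -
    obtain c d where c: "c \<in> W" "S = lincomb c \<pi>" and d: "d \<in> W" "T = lincomb d \<pi>" using Bex[OF S] Bex[OF T] by blast
    have cd: "c + d \<in> W" using finsupp_subspace c(1) d(1) unfolding W_def by (rule cvs.subspace_add)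
    have "S + T = lincomb (c + d) \<pi>" unfolding c(2) d(2) using lincomb_add c(1) d(1) unfolding W_def by metis
    then show ?thesis using \<phi>[OF cd] \<phi>[OF c(1)] \<phi>[OF d(1)] c d lincomb_add[of c "carrier G" d u] by (simp add: W_def)
  qed
  have sc: "\<phi> (a *\<^sub>C T) = a * \<phi> T" if T: "T \<in> B" for a T
  proof -
    obtain c where c: "c \<in> W" "T = lincomb c \<pi>" using Bex[OF T] by blast
    have ac: "a *\<^sub>C c \<in> W" using finsupp_subspace c(1) unfolding W_def by (rule cvs.subspace_scale)
    have "a *\<^sub>C T = lincomb (a *\<^sub>C c) \<pi>" unfolding c(2) using lincomb_scale c(1) unfolding W_def by metis
    then show ?thesis using \<phi>[OF ac] \<phi>[OF c(1)] c lincomb_scale[of c "carrier G" a u] by (simp add: W_def)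
  qed
  have gen: "\<phi> (\<pi> g) = u g" if g: "g \<in> carrier G" for g
    using \<phi>[of "\<lambda>h. if h = g then 1 else 0"] lincomb_single(1)[OF g] by (simp add: lincomb_single(2) W_def)
  have pos: "positive_functional H B \<phi>"
    unfolding positive_functional_def
  proof (intro conjI ballI allI)
    fix T assume T: "T \<in> B"
    obtain c where c: "c \<in> W" "T = lincomb c \<pi>" using Bex[OF T] by blast
    have cW: "c \<in> finsupp (carrier G)" using c by (simp add: W_def)
    have "\<phi> (adj H T \<circ> T) = gns_form u c c"
      unfolding c(2) gns_form_def by (rule functional_lincomb(2)[OF cvs.subspace_span add sc order_refl cW cW gen])
    then show "\<phi> (adj H T \<circ> T) \<in> \<real>\<^sub>\<ge>\<^sub>0" using PD1_form_nonneg[OF u cW] by simp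
  qed (use add sc in auto)
  have one: "\<phi> (id_op H) = 1" using gen[of \<one>] u by (simp add: PD1_def)
  have "cmod (\<phi> T) \<le> M * opnorm H T" if T: "T \<in> B" for T
    using Bex[OF T] \<phi> bd by force
  from extend_to_state[OF B_star_alg pos one this V]
  obtain f' where f': "state H (bop H) f'" "\<And>T. T \<in> B \<Longrightarrow> f' T = \<phi> T" by blast
  have "res f' = u"
  proof
    fix g
    show "res f' g = u g"
      using f'(2)[OF pi_B] gen u by (cases "g \<in> carrier G") (auto simp: res_def PD1_def vanishes_off_def)
  qed
  then show ?thesis using f'(1) by (auto simp: states_def)
qed

end

lemma closed_PD1: "closed (PD1 G)"
  unfolding PD1_def vanishes_off_def complex_nonneg_Reals_iff
  by (intro closed_Collect_conj closed_Collect_all closed_Collect_imp closed_Collect_eq closed_Collect_le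
      open_Collect_const continuous_intros continuous_on_product_coordinates)

lemma closed_characters: "closed (characters G)"
proof -
  have "continuous_on UNIV (\<lambda>\<phi>. conj_act G g \<phi> h)" for g h
    unfolding conj_act_def by (cases "h \<in> carrier G") (simp_all add: continuous_on_product_coordinates)
  then have c: "closed {\<phi>. \<forall>g. g \<in> carrier G \<longrightarrow> (\<forall>h. conj_act G g \<phi> h = \<phi> h)}"
    by (intro closed_Collect_all closed_Collect_imp closed_Collect_eq open_Collect_const
        continuous_intros continuous_on_product_coordinates)
  have eq: "characters G = PD1 G \<inter> {\<phi>. \<forall>g. g \<in> carrier G \<longrightarrow> (\<forall>h. conj_act G g \<phi> h = \<phi> h)}"
    by (auto simp: characters_def fun_eq_iff)
  show ?thesis unfolding eq by (rule closed_Int[OF closed_PD1 c])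
qed

locale charmenable_rep = rep G H \<pi>
  for G :: "('g, 'b) monoid_scheme" (structure) and H :: "'v::complex_vector hilbert"
    and \<pi> :: "'g \<Rightarrow> 'v \<Rightarrow> 'v" +
  assumes countable: "countable (carrier G)" and charmenable: "charmenable G"
    and trivial_radical: "amenable_radical G = {\<one>}" and nonzero: "V \<noteq> {0}"
    and nonamenable: "\<not> amenable_rep G H \<pi>"
begin

definition regular :: "(('v \<Rightarrow> 'v) \<Rightarrow> complex) \<Rightarrow> bool" where
  "regular f \<longleftrightarrow> (\<forall>g\<in>carrier G. f (\<pi> g) = (if g = \<one> then 1 else 0))"

text \<open>
  The set \<open>K\<close> of characters that come from states is a face of the set of all characters by
  \<open>dominated_is_state\<close>, so its extreme points are extremal characters. An extreme point that is
  non-zero at some \<open>g0 \<noteq> e\<close> would, as an extremal character outside the trivial radical, have an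
  amenable GNS representation, in contradiction to \<open>amenable_transfer\<close>.
\<close>

theorem character_regular:
  assumes f: "f \<in> states" and ch: "res f \<in> characters G"
  shows "regular f"
proof (rule ccontr)
  assume "\<not> regular f"
  then obtain g0 where g0: "g0 \<in> carrier G" "g0 \<noteq> \<one>" "f (\<pi> g0) \<noteq> 0"
    unfolding regular_def using states_one[OF f] by (metis pi_one)
  define K where "K = res ` states \<inter> characters G"
  have "compact K" unfolding K_def
    by (intro compact_Int_closed compact_continuous_image res_continuous compact_states_bop closed_characters)
  then have "\<exists>\<psi>. \<psi> extreme_point_of K \<and> \<psi> g0 \<noteq> 0"
  proof (rule extreme_point_with_nonzero_coordinate[OF _ countable])
    show "vanishes_off (carrier G) \<psi>" if "\<psi> \<in> K" for \<psi> using that by (auto simp: K_def vanishes_off_def res_def)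
    show "res f \<in> K" using f ch by (simp add: K_def)
    show "res f g0 \<noteq> 0" using g0 by (simp add: res_def)
  qed
  then obtain \<psi> where ext: "\<psi> extreme_point_of K" and \<psi>0: "\<psi> g0 \<noteq> 0" by blast
  have \<psi>K: "\<psi> \<in> K" using ext by (simp add: extreme_point_of_def)
  then obtain f1 where f1: "f1 \<in> states" "\<psi> = res f1" by (auto simp: K_def)
  have "\<psi> extreme_point_of characters G"
    unfolding extreme_point_of_def
  proof (intro conjI ballI notI)
    show "\<psi> \<in> characters G" using \<psi>K by (simp add: K_def)
    fix a b assume a: "a \<in> characters G" and b: "b \<in> characters G" and seg: "\<psi> \<in> open_segment a b"
    obtain t where t: "0 < t" "t < 1" "\<psi> = (1 - t) *\<^sub>R a + t *\<^sub>R b" using seg by (auto simp: in_segment)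
    have ab: "a \<in> PD1 G" "b \<in> PD1 G" using a b by (auto simp: characters_def)
    have "\<exists>f'\<in>states. res f' = a"
      by (rule dominated_is_state[OF f1(1) ab, of t]) (use t f1 nonzero in auto)
    moreover have "\<exists>f'\<in>states. res f' = b"
      by (rule dominated_is_state[OF f1(1) ab(2,1), of "1 - t"]) (use t f1 nonzero in \<open>auto simp: add.commute\<close>)
    ultimately have "a \<in> K" "b \<in> K" using a b by (auto simp: K_def)
    then show False using ext seg by (auto simp: extreme_point_of_def)
  qed
  then have "(\<forall>g\<in>carrier G - amenable_radical G. \<psi> g = 0) \<or> von_neumann_amenable G \<psi>"
    using charmenable unfolding charmenable_def by blast
  then show False
  proof
    assume "\<forall>g\<in>carrier G - amenable_radical G. \<psi> g = 0"
    then show False using \<psi>0 g0 trivial_radical by auto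
  next
    assume "von_neumann_amenable G \<psi>"
    then obtain K' :: "('g \<Rightarrow> complex) hilbert" and \<rho> \<xi> where gns: "gns_triple G \<psi> K' \<rho> \<xi>" and am: "amenable_rep G K' \<rho>"
      unfolding von_neumann_amenable_def by blast
    have "amenable_rep G H \<pi>"
      by (rule amenable_transfer[OF f1(1) gns _ am]) (simp add: f1(2) res_def)
    then show False using nonamenable by simp
  qed
qed

theorem invariant_contains_regular:
  assumes K: "K \<subseteq> states" "K \<noteq> {}" "compact K" "convex K"
    and inv: "\<And>g f. g \<in> carrier G \<Longrightarrow> f \<in> K \<Longrightarrow> act g f \<in> K"
  shows "\<exists>f\<in>K. regular f"
proof -
  have "res ` K \<inter> characters G \<noteq> {}"
  proof -
    have "convex (res ` K)" unfolding convex_alt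
    proof (intro ballI allI impI)
      fix x y and t :: real assume x: "x \<in> res ` K" and y: "y \<in> res ` K" and t: "0 \<le> t \<and> t \<le> 1"
      obtain f h where fh: "f \<in> K" "x = res f" "h \<in> K" "y = res h" using x y by blast
      have "(1 - t) *\<^sub>R x + t *\<^sub>R y = res ((1 - t) *\<^sub>R f + t *\<^sub>R h)" unfolding fh res_affine ..
      moreover have "(1 - t) *\<^sub>R f + t *\<^sub>R h \<in> K" using K(4) fh t by (simp add: convex_alt)
      ultimately show "(1 - t) *\<^sub>R x + t *\<^sub>R y \<in> res ` K" by blast
    qed
    moreover have "compact (res ` K)" by (intro compact_continuous_image res_continuous K)
    moreover have "res ` K \<subseteq> PD1 G" using res_PD1 K(1) by blast
    moreover have "\<forall>g\<in>carrier G. \<forall>\<phi>\<in>res ` K. conj_act G g \<phi> \<in> res ` K"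
    proof (intro ballI)
      fix g \<phi> assume g: "g \<in> carrier G" and "\<phi> \<in> res ` K"
      then obtain f where f: "f \<in> K" "\<phi> = res f" by blast
      show "conj_act G g \<phi> \<in> res ` K"
        unfolding f(2) res_act_conj[OF g, symmetric] using inv[OF inv_closed[OF g] f(1)] by (rule imageI)
    qed
    ultimately have "res ` K \<noteq> {} \<and> res ` K \<subseteq> PD1 G \<and> compact (res ` K) \<and> convex (res ` K) \<and>
        (\<forall>g\<in>carrier G. \<forall>\<phi>\<in>res ` K. conj_act G g \<phi> \<in> res ` K)"
      using K(2) by (intro conjI) simp_all
    then show ?thesis by (rule charmenable[unfolded charmenable_def, THEN conjunct1, THEN spec, THEN mp])
  qed
  then obtain f where "f \<in> K" "res f \<in> characters G" by blast
  then show ?thesis using character_regular K(1) by blast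
qed

text \<open>
  A state on \<open>B(H)\<close> that extends the regular trace. Only its values on \<open>A\<close> are canonical; having it
  on all of \<open>B(H)\<close> makes the facts about states applicable.
\<close>

definition tau where "tau = (SOME f. f \<in> states \<and> regular f)"

lemma tau: "tau \<in> states" "regular tau"
proof -
  have "\<exists>f\<in>states. regular f"
    by (rule invariant_contains_regular[OF order_refl states_nonempty[OF nonzero] compact_states_bop convex_states_bop act_states])
  then have "\<exists>f. f \<in> states \<and> regular f" by blast
  from someI_ex[OF this] show "tau \<in> states" "regular tau" unfolding tau_def by blast+
qed

lemma regular_eq_tau:
  assumes f: "f \<in> states" "regular f" and T: "T \<in> A"
  shows "f T = tau T"
proof -
  have "f T - tau T = 0"
  proof (rule vanish_on_A[where D = "\<lambda>T. f T - tau T" and C = 2, OF _ _ _ _ T])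
    fix T assume "T \<in> bop H"
    then show "cmod (f T - tau T) \<le> 2 * opnorm H T"
      using norm_triangle_ineq4[of "f T" "tau T"] states_bound[OF f(1), of T] states_bound[OF tau(1), of T] by simp
  qed (use f tau states_add states_scale in \<open>auto simp: regular_def algebra_simps\<close>)
  then show ?thesis by simp
qed

text \<open>
  Translates of regular states are regular, and regular states agree on \<open>A\<close>.
\<close>

lemma tau_Ad: assumes g: "g \<in> carrier G" and T: "T \<in> A" shows "tau (Ad H (\<pi> g) T) = tau T"
proof -
  have "regular (act g tau)"
    unfolding regular_def
  proof
    fix h assume h: "h \<in> carrier G"
    have "g \<otimes> h \<otimes> inv g = \<one> \<longleftrightarrow> h = \<one>"
      using g h by (metis inv_solve_right' l_one one_closed r_cancel_one' m_closed inv_closed l_cancel_one)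
    then show "act g tau (\<pi> h) = (if h = \<one> then 1 else 0)"
      using tau(2) g h by (simp add: act_def Ad_pi regular_def)
  qed
  from regular_eq_tau[OF act_states[OF g tau(1)] this T] show ?thesis
    using T A_sub by (auto simp: act_def)
qed

lemma tau_trace: assumes S: "S \<in> A" and T: "T \<in> A" shows "tau (S \<circ> T) = tau (T \<circ> S)"
proof -
  have Tb: "T \<in> bop H" using T A_sub by blast
  have "tau (S \<circ> T) - tau (T \<circ> S) = 0"
  proof (rule vanish_on_A[where D = "\<lambda>S. tau (S \<circ> T) - tau (T \<circ> S)" and C = "2 * opnorm H T", OF _ _ _ _ S])
    fix S assume Sb: "S \<in> bop H"
    show "cmod (tau (S \<circ> T) - tau (T \<circ> S)) \<le> 2 * opnorm H T * opnorm H S"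
      using norm_triangle_ineq4[of "tau (S \<circ> T)" "tau (T \<circ> S)"]
        states_bound[OF tau(1), of "S \<circ> T"] states_bound[OF tau(1), of "T \<circ> S"]
        opnorm_comp[OF Sb Tb] opnorm_comp[OF Tb Sb] Sb Tb by (simp add: mult.commute)
  next
    fix R S assume "R \<in> bop H" "S \<in> bop H"
    then show "tau ((R + S) \<circ> T) - tau (T \<circ> (R + S)) = tau (R \<circ> T) - tau (T \<circ> R) + (tau (S \<circ> T) - tau (T \<circ> S))"
      using Tb states_add[OF tau(1)] by (simp add: comp_add_left comp_add_right)
  next
    fix c S assume "S \<in> bop H"
    then show "tau ((c *\<^sub>C S) \<circ> T) - tau (T \<circ> (c *\<^sub>C S)) = c * (tau (S \<circ> T) - tau (T \<circ> S))"
      using Tb states_scale[OF tau(1)] by (simp add: comp_scale_left comp_scale_right right_diff_distrib)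
  next
    fix g assume g: "g \<in> carrier G"
    have "Ad H (\<pi> g) (T \<circ> \<pi> g) = \<pi> g \<circ> (T \<circ> (\<pi> g \<circ> \<pi> (inv g)))" using g by (simp add: Ad_eq comp_assoc)
    also have "\<dots> = \<pi> g \<circ> T" unfolding pi_inv(1)[OF g] using Tb by simp
    finally have "tau (\<pi> g \<circ> T) = tau (T \<circ> \<pi> g)"
      using tau_Ad[OF g, of "T \<circ> \<pi> g"] star_alg_in(5)[OF A_star_alg T pi_A[OF g]] by simp
    then show "tau (\<pi> g \<circ> T) - tau (T \<circ> \<pi> g) = 0" by simp
  qed
  then show ?thesis by simp
qed

section \<open>Averaging\<close>

text \<open>
  The convex hull of the maps \<open>Ad (\<pi> g)\<close>. Being a set of maps on all of \<open>B(H)\<close>, it allows one and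
  the same average to be applied to several operators, and averages to be composed.
\<close>

inductive_set Avg :: "(('v \<Rightarrow> 'v) \<Rightarrow> 'v \<Rightarrow> 'v) set" where
  Ad: "g \<in> carrier G \<Longrightarrow> Ad H (\<pi> g) \<in> Avg"
| mix: "P \<in> Avg \<Longrightarrow> R \<in> Avg \<Longrightarrow> 0 \<le> t \<Longrightarrow> t \<le> 1 \<Longrightarrow>
    (\<lambda>T. of_real (1 - t) *\<^sub>C P T + of_real t *\<^sub>C R T) \<in> Avg"

lemma states_mix:
  assumes f: "f \<in> states" and X: "X \<in> bop H" and Y: "Y \<in> bop H"
  shows "f (of_real (1 - t) *\<^sub>C X + of_real t *\<^sub>C Y) = of_real (1 - t) * f X + of_real t * f Y"
  by (simp only: states_add[OF f op_scale_in[OF X] op_scale_in[OF Y]] states_scale[OF f X] states_scale[OF f Y])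

lemma Avg_in: "P \<in> Avg \<Longrightarrow> T \<in> bop H \<Longrightarrow> P T \<in> bop H"
  by (induction rule: Avg.induct) auto

lemma Avg_A: "P \<in> Avg \<Longrightarrow> T \<in> A \<Longrightarrow> P T \<in> A"
proof (induction rule: Avg.induct)
  case (mix P R t)
  then show ?case using star_alg_in(2,4)[OF A_star_alg] by blast
qed (rule Ad_A)

lemma Avg_add: "P \<in> Avg \<Longrightarrow> X \<in> bop H \<Longrightarrow> Y \<in> bop H \<Longrightarrow> P (X + Y) = P X + P Y"
  by (induction rule: Avg.induct) (simp_all add: Ad_add cvs.scale_right_distrib)

lemma Avg_scale: "P \<in> Avg \<Longrightarrow> X \<in> bop H \<Longrightarrow> P (c *\<^sub>C X) = c *\<^sub>C P X"
  by (induction rule: Avg.induct) (simp_all add: Ad_scale cvs.scale_right_distrib mult.commute)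

lemma Avg_diff: "P \<in> Avg \<Longrightarrow> X \<in> bop H \<Longrightarrow> Y \<in> bop H \<Longrightarrow> P (X - Y) = P X - P Y"
  using Avg_add[of P "X - Y" Y] by simp

lemma Avg_id: "P \<in> Avg \<Longrightarrow> P (id_op H) = id_op H"
  by (induction rule: Avg.induct) (simp_all flip: cvs.scale_left_distrib)

lemma Avg_adj: "P \<in> Avg \<Longrightarrow> T \<in> bop H \<Longrightarrow> adj H (P T) = P (adj H T)"
  by (induction rule: Avg.induct) (simp_all add: Ad_adj adj_add adj_scale Avg_in)

lemma Avg_opnorm: "P \<in> Avg \<Longrightarrow> T \<in> bop H \<Longrightarrow> opnorm H (P T) \<le> opnorm H T"
proof (induction rule: Avg.induct)
  case (mix P R t)
  note b = Avg_in[OF mix(1,7)] Avg_in[OF mix(2,7)]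
  have "opnorm H (of_real (1 - t) *\<^sub>C P T + of_real t *\<^sub>C R T)
      \<le> opnorm H (of_real (1 - t) *\<^sub>C P T) + opnorm H (of_real t *\<^sub>C R T)"
    using b by (intro opnorm_triangle) auto
  also have "\<dots> \<le> (1 - t) * opnorm H (P T) + t * opnorm H (R T)"
  proof -
    have c1: "cmod (of_real (1 - t)) = 1 - t" using mix(4) by (subst norm_of_real) simp
    have c2: "cmod (of_real t) = t" using mix(3) by (subst norm_of_real) simp
    show ?thesis
      using opnorm_scale[OF b(1), of "of_real (1 - t)", unfolded c1] opnorm_scale[OF b(2), of "of_real t", unfolded c2]
      by linarith
  qed
  also have "\<dots> \<le> (1 - t) * opnorm H T + t * opnorm H T"
    using mix by (intro add_mono mult_left_mono) auto
  also have "\<dots> = opnorm H T" by (simp add: algebra_simps)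
  finally show ?case .
qed (rule opnorm_Ad)

lemma Avg_tau: "P \<in> Avg \<Longrightarrow> T \<in> A \<Longrightarrow> tau (P T) = tau T"
proof (induction rule: Avg.induct)
  case (mix P R t)
  have b: "P T \<in> bop H" "R T \<in> bop H" using mix Avg_in A_sub by blast+
  have "tau (of_real (1 - t) *\<^sub>C P T + of_real t *\<^sub>C R T) = tau T"
    unfolding states_mix[OF tau(1) b] mix(5)[OF mix(7)] mix(6)[OF mix(7)] by (simp add: algebra_simps)
  then show ?case .
qed (rule tau_Ad)

lemma Avg_state_le:
  assumes T: "T \<in> bop H" and le: "\<And>f. f \<in> states \<Longrightarrow> Re (f T) \<le> a" and P: "P \<in> Avg" and f: "f \<in> states"
  shows "Re (f (P T)) \<le> a"
  using P f
proof (induction arbitrary: f rule: Avg.induct)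
  case (Ad g)
  then show ?case using le[OF act_states[OF Ad]] T by (simp add: act_def)
next
  case (mix P R t)
  have b: "P T \<in> bop H" "R T \<in> bop H" using mix T Avg_in by blast+
  have "Re (f (of_real (1 - t) *\<^sub>C P T + of_real t *\<^sub>C R T)) = (1 - t) * Re (f (P T)) + t * Re (f (R T))"
    unfolding states_mix[OF mix(7) b] by simp
  also have "\<dots> \<le> (1 - t) * a + t * a" using mix by (intro add_mono mult_left_mono) auto
  also have "\<dots> = a" by (simp add: algebra_simps)
  finally show ?case .
qed

lemma Avg_comp: "P \<in> Avg \<Longrightarrow> R \<in> Avg \<Longrightarrow> \<exists>U\<in>Avg. \<forall>T\<in>bop H. U T = P (R T)"
proof (induction rule: Avg.induct)
  case (Ad g)
  from Ad(2) show ?case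
  proof (induction rule: Avg.induct)
    case (Ad h)
    then show ?case using Avg.Ad[of "g \<otimes> h"] Ad_mult[OF \<open>g \<in> carrier G\<close>] \<open>g \<in> carrier G\<close>
      by (intro bexI[of _ "Ad H (\<pi> (g \<otimes> h))"]) auto
  next
    case (mix P R t)
    obtain U1 U2 where U: "U1 \<in> Avg" "\<And>T. T \<in> bop H \<Longrightarrow> U1 T = Ad H (\<pi> g) (P T)"
      "U2 \<in> Avg" "\<And>T. T \<in> bop H \<Longrightarrow> U2 T = Ad H (\<pi> g) (R T)" using mix.IH by blast
    show ?case
    proof (rule bexI[OF _ Avg.mix[OF U(1,3) mix(3,4)]], rule ballI)
      fix T assume T: "T \<in> bop H"
      have b: "P T \<in> bop H" "R T \<in> bop H" using Avg_in mix T by blast+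
      show "of_real (1 - t) *\<^sub>C U1 T + of_real t *\<^sub>C U2 T = Ad H (\<pi> g) (of_real (1 - t) *\<^sub>C P T + of_real t *\<^sub>C R T)"
        by (simp only: U(2)[OF T] U(4)[OF T] Ad_add[OF Ad(1) op_scale_in[OF b(1)] op_scale_in[OF b(2)]]
            Ad_scale[OF Ad(1) b(1)] Ad_scale[OF Ad(1) b(2)])
    qed
  qed
next
  case (mix P1 P2 t)
  obtain U1 U2 where U: "U1 \<in> Avg" "\<And>T. T \<in> bop H \<Longrightarrow> U1 T = P1 (R T)"
    "U2 \<in> Avg" "\<And>T. T \<in> bop H \<Longrightarrow> U2 T = P2 (R T)" using mix by blast
  show ?case
    by (rule bexI[OF _ Avg.mix[OF U(1,3) mix(3,4)]]) (use U(2,4) in auto)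
qed

lemma Avg_convex_hull: "P \<in> Avg \<Longrightarrow> P T \<in> convex hull ((\<lambda>g. Ad H (\<pi> g) T) ` carrier G)"
proof (induction rule: Avg.induct)
  case (Ad g)
  then show ?case by (intro hull_inc) auto
next
  case (mix P R t)
  have "(1 - t) *\<^sub>R P T + t *\<^sub>R R T \<in> convex hull ((\<lambda>g. Ad H (\<pi> g) T) ` carrier G)"
    by (rule convexD_alt[OF convex_convex_hull mix(5,6,3,4)])
  then have "of_real (1 - t) *\<^sub>C P T + of_real t *\<^sub>C R T \<in> convex hull ((\<lambda>g. Ad H (\<pi> g) T) ` carrier G)"
    by (simp only: scaleR_scaleC)
  then show ?case .
qed

section \<open>The Powers property\<close>

text \<open>
  The states \<open>f\<close> with \<open>Re f(P y) \<ge> Re \<tau>(y) + e\<close> for every average \<open>P\<close> form an invariant compact convex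
  set. It contains no regular state, because regular states agree with \<open>\<tau>\<close> on \<open>y\<close>, hence it is empty.
  By compactness finitely many \<open>P\<close> suffice to exclude every state, and the minimax theorem combines
  them into one average that works for all states at once.
\<close>

lemma powers_one_sided:
  assumes y: "y \<in> A" and e: "e > 0"
  shows "\<exists>P\<in>Avg. \<forall>f\<in>states. Re (f (P y)) \<le> Re (tau y) + e"
proof -
  define a where "a = Re (tau y) + e"
  have yb: "y \<in> bop H" using y A_sub by blast
  define C where "C P = {f. a \<le> Re (f (P y))}" for P :: "('v \<Rightarrow> 'v) \<Rightarrow> 'v \<Rightarrow> 'v"
  have clC: "closed (C P)" for P
    unfolding C_def by (intro closed_Collect_le continuous_intros continuous_on_product_coordinates)
  have empty: "states \<inter> (\<Inter>P\<in>Avg. C P) = {}"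
  proof (rule ccontr)
    assume ne: "states \<inter> (\<Inter>P\<in>Avg. C P) \<noteq> {}"
    have "\<exists>f\<in>states \<inter> (\<Inter>P\<in>Avg. C P). regular f"
    proof (rule invariant_contains_regular[OF _ ne])
      show "compact (states \<inter> (\<Inter>P\<in>Avg. C P))" using clC by (intro compact_Int_closed compact_states_bop closed_INT) auto
      have "convex (C P)" for P unfolding convex_alt C_def
      proof (intro ballI allI impI, unfold mem_Collect_eq)
        fix f h and t :: real assume fh: "a \<le> Re (f (P y))" "a \<le> Re (h (P y))" and t: "0 \<le> t \<and> t \<le> 1"
        have "(1 - t) * a + t * a \<le> (1 - t) * Re (f (P y)) + t * Re (h (P y))"
          using fh t by (intro add_mono mult_left_mono) auto
        then show "a \<le> Re (((1 - t) *\<^sub>R f + t *\<^sub>R h) (P y))" by (simp add: algebra_simps)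
      qed
      then show "convex (states \<inter> (\<Inter>P\<in>Avg. C P))" by (intro convex_Int convex_states_bop convex_INT)
      fix g f assume g: "g \<in> carrier G" and f: "f \<in> states \<inter> (\<Inter>P\<in>Avg. C P)"
      have "a \<le> Re (act g f (P y))" if P: "P \<in> Avg" for P
      proof -
        obtain U where "U \<in> Avg" "U y = Ad H (\<pi> g) (P y)" using Avg_comp[OF Avg.Ad[OF g] P] yb by blast
        then show ?thesis using f Avg_in[OF P yb] by (auto simp: act_def C_def)
      qed
      then show "act g f \<in> states \<inter> (\<Inter>P\<in>Avg. C P)" using act_states[OF g] f by (auto simp: C_def)
    qed auto
    \<comment> \<open>The conjugation by \<open>\<pi>(e)\<close> is the trivial average.\<close>
    then obtain f where f: "f \<in> states" "regular f" "f \<in> C (Ad H (\<pi> \<one>))" using Avg.Ad[OF one_closed] by blast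
    then show False using regular_eq_tau[OF f(1,2) y] e yb by (simp add: C_def a_def)
  qed
  have "\<exists>I. finite I \<and> I \<subseteq> Avg \<and> states \<inter> (\<Inter>P\<in>I. C P) = {}"
  proof (rule ccontr)
    assume neg: "\<not> ?thesis"
    have "states \<inter> (\<Inter>P\<in>Avg. C P) \<noteq> {}"
      by (rule compact_imp_fip_image[OF compact_states_bop clC]) (use neg in blast)
    then show False using empty by blast
  qed
  then obtain I where I: "finite I" "I \<subseteq> Avg" "states \<inter> (\<Inter>P\<in>I. C P) = {}" by blast
  have "I \<noteq> {}" using I(3) states_nonempty[OF nonzero] by auto
  then have "\<exists>l. (\<forall>P\<in>I. 0 \<le> l P) \<and> sum l I = 1 \<and> (\<forall>f\<in>states. 0 \<le> (\<Sum>P\<in>I. l P * (a - Re (f (P y)))))"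
  proof (rule finite_function_alternative[OF I(1) _ convex_states_bop])
    fix f assume "f \<in> states"
    then obtain P where P: "P \<in> I" "f \<notin> C P" using I(3) by blast
    then show "\<exists>P\<in>I. 0 \<le> a - Re (f (P y))" by (intro bexI[OF _ P(1)]) (simp add: C_def)
  qed (simp add: algebra_simps)
  then obtain l where l: "\<And>P. P \<in> I \<Longrightarrow> 0 \<le> l P" "sum l I = 1"
    "\<And>f. f \<in> states \<Longrightarrow> 0 \<le> (\<Sum>P\<in>I. l P * (a - Re (f (P y))))" by blast
  have "convex ((\<lambda>P. P y) ` Avg)" unfolding convex_alt
  proof (intro ballI allI impI)
    fix x z and t :: real assume "x \<in> (\<lambda>P. P y) ` Avg" "z \<in> (\<lambda>P. P y) ` Avg" and t: "0 \<le> t \<and> t \<le> 1"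
    then obtain P R where PR: "P \<in> Avg" "x = P y" "R \<in> Avg" "z = R y" by blast
    have eq: "(1 - t) *\<^sub>R x + t *\<^sub>R z = (\<lambda>T. of_real (1 - t) *\<^sub>C P T + of_real t *\<^sub>C R T) y"
      unfolding PR by (simp only: scaleR_scaleC)
    have mem: "(\<lambda>T. of_real (1 - t) *\<^sub>C P T + of_real t *\<^sub>C R T) \<in> Avg" using PR t by (intro Avg.mix) auto
    show "(1 - t) *\<^sub>R x + t *\<^sub>R z \<in> (\<lambda>P. P y) ` Avg"
      unfolding eq by (rule imageI[OF mem, of "\<lambda>P. P y"])
  qed
  then have "(\<Sum>P\<in>I. l P *\<^sub>R P y) \<in> (\<lambda>P. P y) ` Avg"
    by (rule convex_sum[OF I(1)]) (use l I(2) in auto)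
  then obtain P where P: "P \<in> Avg" "P y = (\<Sum>P\<in>I. of_real (l P) *\<^sub>C P y)" by (auto simp: scaleR_scaleC)
  have "Re (f (P y)) \<le> a" if f: "f \<in> states" for f
  proof -
    have "f (P y) = (\<Sum>P\<in>I. of_real (l P) * f (P y))" unfolding P(2)
      by (rule positive_functional_sum[OF star_alg_bop states_positive[OF f]]) (use I(2) Avg_in yb in auto)
    then have "Re (f (P y)) = (\<Sum>P\<in>I. l P * Re (f (P y)))" by simp
    moreover have "0 \<le> a - (\<Sum>P\<in>I. l P * Re (f (P y)))"
      using l(3)[OF f] l(2) by (simp add: right_diff_distrib sum_subtractf flip: sum_distrib_right)
    ultimately show ?thesis by simp
  qed
  then show ?thesis using P(1) unfolding a_def by blast
qed

lemma states_bound_opnorm: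
  assumes y: "y \<in> bop H" "adj H y = y" and e: "0 \<le> e" and bd: "\<And>f. f \<in> states \<Longrightarrow> \<bar>Re (f y)\<bar> \<le> e"
  shows "opnorm H y \<le> e"
proof (rule self_adjoint_numerical_radius[OF y e])
  fix x assume x: "x \<in> V"
  show "\<bar>Re (ip H (y x) x)\<bar> \<le> e * (nrm x)\<^sup>2"
  proof (cases "x = 0")
    case False
    then have n: "nrm x > 0" using nrm_pos x by blast
    define w where "w = of_real (1 / nrm x) *\<^sub>C x"
    have c: "cmod (of_real (1 / nrm x)) = 1 / nrm x" using n by (simp only: norm_of_real) simp
    have w: "w \<in> V" "nrm w = 1" unfolding w_def using nrm_scale[OF x, of "of_real (1 / nrm x)"] c n x by auto
    have "\<bar>Re (ip H (y w) w)\<bar> \<le> e" using bd[of "\<lambda>T. if T \<in> bop H then ip H (T w) w else 0"] vector_state[OF w] y(1)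
      by (simp add: states_def)
    also have "ip H (y w) w = of_real ((1 / nrm x) * (1 / nrm x)) * ip H (y x) x"
      unfolding w_def using y(1) x by (simp add: bop_scale)
    also have "Re \<dots> = Re (ip H (y x) x) / (nrm x)\<^sup>2"
      by (simp only: Re_complex_of_real times_complex.sel Im_complex_of_real power2_eq_square) simp
    finally show ?thesis using n by (simp add: abs_divide divide_le_eq)
  qed (use y(1) in simp)
qed

text \<open>
  The one-sided bound is applied to \<open>y\<close>, and then to \<open>- P y\<close> for the average \<open>P\<close> so obtained.
  Averaging again preserves the upper bound by \<open>Avg_state_le\<close>.
\<close>

lemma powers_self_adjoint:
  assumes y: "y \<in> A" "adj H y = y" and e: "e > 0"
  shows "\<exists>P\<in>Avg. opnorm H (P y - tau y *\<^sub>C id_op H) \<le> e"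
proof -
  have yb: "y \<in> bop H" using y A_sub by blast
  obtain P where P: "P \<in> Avg" "\<And>f. f \<in> states \<Longrightarrow> Re (f (P y)) \<le> Re (tau y) + e"
    using powers_one_sided[OF y(1) e] by blast
  let ?z = "(-1) *\<^sub>C P y"
  have Py: "P y \<in> A" "P y \<in> bop H" using Avg_A[OF P(1) y(1)] A_sub by auto
  have z: "?z \<in> A" using star_alg_in(4)[OF A_star_alg Py(1)] .
  obtain R where R: "R \<in> Avg" "\<And>f. f \<in> states \<Longrightarrow> Re (f (R ?z)) \<le> Re (tau ?z) + e"
    using powers_one_sided[OF z e] by blast
  have tz: "tau ?z = - tau y" using states_scale[OF tau(1) Py(2), of "-1"] Avg_tau[OF P(1) y(1)] by simp
  have Rz: "R ?z = (-1) *\<^sub>C R (P y)" using Avg_scale[OF R(1) Py(2)] .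
  have RP: "R (P y) \<in> bop H" using Avg_in[OF R(1) Py(2)] .
  let ?w = "R (P y) - tau y *\<^sub>C id_op H"
  have tr: "tau y = of_real (Re (tau y))"
    by (rule positive_functional_self_adjoint_real[OF star_alg_bop states_positive[OF tau(1)] yb y(2)])
  have "opnorm H ?w \<le> e"
  proof (rule states_bound_opnorm)
    show "?w \<in> bop H" using RP by simp
    have "cnj (tau y) = tau y" using tr by (metis complex_cnj_complex_of_real)
    then show "adj H ?w = ?w" using RP Py yb P(1) R(1) y(2) by (simp add: adj_diff adj_scale Avg_adj)
    fix f assume f: "f \<in> states"
    have "f ?w = f (R (P y)) - tau y" using states_diff[OF f RP] states_scale[OF f] states_one[OF f] by simp
    moreover have "Re (f (R (P y))) \<le> Re (tau y) + e" by (rule Avg_state_le[where T = "P y" and P = R]) (use Py(2) P(2) R(1) f in auto)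
    moreover have "- Re (f (R (P y))) \<le> - Re (tau y) + e"
      using R(2)[OF f] states_scale[OF f RP, of "-1"] unfolding Rz tz by simp
    ultimately show "\<bar>Re (f ?w)\<bar> \<le> e" by (simp add: abs_le_iff)
  qed (use e in simp)
  moreover obtain U where "U \<in> Avg" "U y = R (P y)" using Avg_comp[OF R(1) P(1)] yb by blast
  ultimately show ?thesis by metis
qed

lemma Avg_contract:
  assumes R: "R \<in> Avg" and x: "x \<in> bop H" and d: "opnorm H (x - a *\<^sub>C id_op H) \<le> e"
  shows "opnorm H (R x - a *\<^sub>C id_op H) \<le> e"
proof -
  have "R x - a *\<^sub>C id_op H = R (x - a *\<^sub>C id_op H)"
    by (simp only: Avg_diff[OF R x op_scale_in[OF id_in]] Avg_scale[OF R id_in] Avg_id[OF R])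
  then show ?thesis using Avg_opnorm[OF R, of "x - a *\<^sub>C id_op H"] x d by simp
qed

text \<open>
  The elements are treated one after the other; by \<open>Avg_contract\<close> the averages taken for later
  elements do not spoil what has been achieved for the earlier ones.
\<close>

lemma powers_finite_self_adjoint:
  assumes "finite X" "\<And>x. x \<in> X \<Longrightarrow> x \<in> A \<and> adj H x = x" and e: "e > 0"
  shows "\<exists>P\<in>Avg. \<forall>x\<in>X. opnorm H (P x - tau x *\<^sub>C id_op H) \<le> e"
  using assms(1,2)
proof (induction X)
  case empty
  show ?case using Avg.Ad[OF one_closed] by blast
next
  case (insert x X)
  have "\<exists>P\<in>Avg. \<forall>x\<in>X. opnorm H (P x - tau x *\<^sub>C id_op H) \<le> e"
    by (rule insert.IH) (simp add: insert.prems)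
  then obtain P where P: "P \<in> Avg" "\<And>x. x \<in> X \<Longrightarrow> opnorm H (P x - tau x *\<^sub>C id_op H) \<le> e" by blast
  have x: "x \<in> A" "adj H x = x" "x \<in> bop H" using insert.prems A_sub by auto
  have "adj H (P x) = P x" using Avg_adj[OF P(1) x(3)] x(2) by simp
  then obtain R where R: "R \<in> Avg" "opnorm H (R (P x) - tau (P x) *\<^sub>C id_op H) \<le> e"
    using powers_self_adjoint[OF Avg_A[OF P(1) x(1)] _ e] by blast
  obtain U where U: "U \<in> Avg" "\<And>T. T \<in> bop H \<Longrightarrow> U T = R (P T)" using Avg_comp[OF R(1) P(1)] by blast
  have "opnorm H (U z - tau z *\<^sub>C id_op H) \<le> e" if z: "z \<in> insert x X" for z
  proof (cases "z = x")
    case True then show ?thesis using R(2) U(2)[OF x(3)] Avg_tau[OF P(1) x(1)] by simp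
  next
    case False
    then have zX: "z \<in> X" and zb: "z \<in> bop H" using z insert.prems A_sub by auto
    show ?thesis unfolding U(2)[OF zb] by (rule Avg_contract[OF R(1) Avg_in[OF P(1) zb] P(2)[OF zX]])
  qed
  then have "\<exists>P\<in>Avg. \<forall>x\<in>insert x X. opnorm H (P x - tau x *\<^sub>C id_op H) \<le> e" using U(1) by blast
  then show ?case .
qed

theorem powers_finite:
  assumes X: "finite X" "X \<subseteq> A" and e: "e > 0"
  shows "\<exists>P\<in>Avg. \<forall>x\<in>X. opnorm H (P x - tau x *\<^sub>C id_op H) \<le> e"
proof -
  define re where "re x = (1/2) *\<^sub>C (x + adj H x)" for x
  define k :: complex where "k = - \<i> / 2"
  have k: "cnj k = - k" "\<i> * k = 1 / 2" by (simp_all add: k_def)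
  define im where "im x = k *\<^sub>C (x - adj H x)" for x
  note Ain = star_alg_in[OF A_star_alg]
  have reA: "re x \<in> A \<and> adj H (re x) = re x" if x: "x \<in> A" for x
    unfolding re_def using Ain(1,2,4,6) x by (auto simp: adj_scale adj_add add.commute)
  have imA: "im x \<in> A \<and> adj H (im x) = im x" if x: "x \<in> A" for x
  proof -
    have "adj H (im x) = (- k) *\<^sub>C (adj H x - x)"
      unfolding im_def using Ain(1) x by (simp only: adj_scale op_diff_in adj_in adj_diff adj_adj k)
    also have "\<dots> = im x" unfolding im_def by (simp add: cvs.scale_right_diff_distrib)
    finally show ?thesis unfolding im_def using Ain(3,4,6) x by auto
  qed
  have dec: "x = re x + \<i> *\<^sub>C im x" for x
  proof -
    have "re x + \<i> *\<^sub>C im x = (1/2) *\<^sub>C (x + adj H x) + (1/2) *\<^sub>C (x - adj H x)" by (simp add: re_def im_def k)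
    also have "\<dots> = (1/2 + 1/2) *\<^sub>C x"
      unfolding cvs.scale_left_distrib by (simp add: cvs.scale_right_distrib cvs.scale_right_diff_distrib)
    finally show ?thesis by simp
  qed
  have fin: "finite (re ` X \<union> im ` X)" using X by simp
  have "\<exists>P\<in>Avg. \<forall>x\<in>re ` X \<union> im ` X. opnorm H (P x - tau x *\<^sub>C id_op H) \<le> e / 2"
    by (rule powers_finite_self_adjoint[OF fin]) (use reA imA X(2) e in auto)
  then obtain P where P: "P \<in> Avg" "\<And>x. x \<in> re ` X \<union> im ` X \<Longrightarrow> opnorm H (P x - tau x *\<^sub>C id_op H) \<le> e / 2" by blast
  have "opnorm H (P x - tau x *\<^sub>C id_op H) \<le> e" if x: "x \<in> X" for x
  proof -
    have xA: "re x \<in> bop H" "im x \<in> bop H" using reA imA X(2) x A_sub by auto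
    let ?r = "P (re x) - tau (re x) *\<^sub>C id_op H" and ?i = "P (im x) - tau (im x) *\<^sub>C id_op H"
    have ri: "?r \<in> bop H" "?i \<in> bop H" using xA Avg_in[OF P(1)] by auto
    have "P (re x + \<i> *\<^sub>C im x) - tau (re x + \<i> *\<^sub>C im x) *\<^sub>C id_op H = ?r + \<i> *\<^sub>C ?i"
    proof -
      have a: "P (re x + \<i> *\<^sub>C im x) = P (re x) + \<i> *\<^sub>C P (im x)"
        by (simp only: Avg_add[OF P(1) xA(1) op_scale_in[OF xA(2)]] Avg_scale[OF P(1) xA(2)])
      have b: "tau (re x + \<i> *\<^sub>C im x) = tau (re x) + \<i> * tau (im x)"
        by (simp only: states_add[OF tau(1) xA(1) op_scale_in[OF xA(2)]] states_scale[OF tau(1) xA(2)])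
      show ?thesis unfolding a b by (simp add: cvs.scale_left_distrib cvs.scale_right_diff_distrib)
    qed
    then have eq: "P x - tau x *\<^sub>C id_op H = ?r + \<i> *\<^sub>C ?i" unfolding dec[symmetric] .
    have "opnorm H (?r + \<i> *\<^sub>C ?i) \<le> opnorm H ?r + opnorm H (\<i> *\<^sub>C ?i)" using ri by (intro opnorm_triangle) auto
    moreover have "opnorm H (\<i> *\<^sub>C ?i) \<le> opnorm H ?i" using opnorm_scale[OF ri(2), of \<i>] by simp
    ultimately show ?thesis unfolding eq using P(2)[of "re x"] P(2)[of "im x"] x by fastforce
  qed
  then show ?thesis using P(1) by blast
qed

end


section \<open>Weak containment of the regular representation\<close>

lemma (in rep) left_regular_coefficient_has_sum:
  assumes \<xi>: "\<xi> \<in> vecs (ell2 G)" and g: "g \<in> carrier G"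
  shows "((\<lambda>x. \<xi> (inv g \<otimes> x) * cnj (\<xi> x)) has_sum ip (ell2 G) (left_regular G g \<xi>) \<xi>) (carrier G)"
proof -
  have sq: "(\<lambda>x. (cmod (\<xi> x))\<^sup>2) summable_on carrier G" using \<xi> by (simp add: ell2_def)
  have bij: "bij_betw (\<lambda>x. inv g \<otimes> x) (carrier G) (carrier G)"
    by (rule bij_betw_byWitness[where f' = "\<lambda>x. g \<otimes> x"]) (use g in \<open>auto simp: m_assoc[symmetric]\<close>)
  have sq': "(\<lambda>x. (cmod (\<xi> (inv g \<otimes> x)))\<^sup>2) summable_on carrier G"
    using summable_on_reindex_bij_betw[OF bij, of "\<lambda>x. (cmod (\<xi> x))\<^sup>2"] sq by simp
  have "(\<lambda>x. norm (\<xi> (inv g \<otimes> x) * cnj (\<xi> x))) summable_on carrier G"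
  proof (rule summable_on_comparison_test[OF summable_on_add[OF sq' sq]])
    fix x
    have "0 \<le> (cmod (\<xi> (inv g \<otimes> x)) - cmod (\<xi> x))\<^sup>2" by simp
    then have "2 * (cmod (\<xi> (inv g \<otimes> x)) * cmod (\<xi> x)) \<le> (cmod (\<xi> (inv g \<otimes> x)))\<^sup>2 + (cmod (\<xi> x))\<^sup>2"
      by (simp add: power2_diff)
    moreover have "0 \<le> cmod (\<xi> (inv g \<otimes> x)) * cmod (\<xi> x)" by simp
    ultimately show "norm (\<xi> (inv g \<otimes> x) * cnj (\<xi> x)) \<le> (cmod (\<xi> (inv g \<otimes> x)))\<^sup>2 + (cmod (\<xi> x))\<^sup>2"
      unfolding norm_mult complex_mod_cnj by linarith
  qed simp
  then have "(\<lambda>x. \<xi> (inv g \<otimes> x) * cnj (\<xi> x)) summable_on carrier G" by (rule abs_summable_summable)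
  moreover have "ip (ell2 G) (left_regular G g \<xi>) \<xi> = (\<Sum>\<^sub>\<infinity>x\<in>carrier G. \<xi> (inv g \<otimes> x) * cnj (\<xi> x))"
  proof -
    have "ip (ell2 G) (left_regular G g \<xi>) \<xi> = (\<Sum>\<^sub>\<infinity>x\<in>carrier G. left_regular G g \<xi> x * cnj (\<xi> x))"
      by (simp add: ell2_def)
    also have "\<dots> = (\<Sum>\<^sub>\<infinity>x\<in>carrier G. \<xi> (inv g \<otimes> x) * cnj (\<xi> x))"
      by (rule infsum_cong) (use \<xi> in \<open>simp add: left_regular_def\<close>)
    finally show ?thesis .
  qed
  ultimately show ?thesis by simp
qed

context charmenable_rep begin

text \<open>
  The right-hand side is the coefficient of \<open>c \<in> \<ell>\<^sup>2(\<Gamma>)\<close> in the regular representation.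
\<close>

lemma tau_coefficient:
  assumes c: "c \<in> finsupp (carrier G)" and g: "g \<in> carrier G"
  shows "tau (adj H (lincomb c \<pi>) \<circ> (\<pi> g \<circ> lincomb c \<pi>)) = (\<Sum>k | c k \<noteq> 0. c (inv g \<otimes> k) * cnj (c k))"
proof -
  let ?d = "shift G (inv g) c"
  have d: "?d \<in> finsupp (carrier G)" using shift_finsupp c g by simp
  have cG: "k \<in> carrier G" if "c k \<noteq> 0" for k using c that by (auto simp: finsupp_def)
  have dG: "k \<in> carrier G" if "?d k \<noteq> 0" for k using d that by (auto simp: finsupp_def)
  have fin: "finite {h. ?d h \<noteq> 0}" using d by (simp add: finsupp_def)
  have "\<pi> g \<circ> lincomb c \<pi> = lincomb ?d \<pi>" using lincomb_shift[of "inv g" c] c g by simp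
  then have "tau (adj H (lincomb c \<pi>) \<circ> (\<pi> g \<circ> lincomb c \<pi>))
      = (\<Sum>k | c k \<noteq> 0. \<Sum>h | ?d h \<noteq> 0. cnj (c k) * ?d h * res tau (inv k \<otimes> h))"
    using states_lincomb(2)[OF tau(1) c d] by simp
  also have "\<dots> = (\<Sum>k | c k \<noteq> 0. c (inv g \<otimes> k) * cnj (c k))"
  proof (rule sum.cong[OF refl])
    fix k assume "k \<in> {k. c k \<noteq> 0}"
    then have k: "k \<in> carrier G" using cG by simp
    have "res tau (inv k \<otimes> h) = (if h = k then 1 else 0)" if h: "h \<in> carrier G" for h
    proof -
      have "inv k \<otimes> h = \<one> \<longleftrightarrow> h = k"
      proof
        assume "inv k \<otimes> h = \<one>"
        then have "k \<otimes> (inv k \<otimes> h) = k" using k by simp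
        then show "h = k" using k h by (simp add: m_assoc[symmetric])
      qed (use k in simp)
      then show ?thesis using tau(2) k h by (simp add: res_def regular_def)
    qed
    then have "(\<Sum>h | ?d h \<noteq> 0. cnj (c k) * ?d h * res tau (inv k \<otimes> h)) = (\<Sum>h | ?d h \<noteq> 0. if h = k then cnj (c k) * ?d k else 0)"
      by (intro sum.cong[OF refl]) (use dG in auto)
    also have "\<dots> = cnj (c k) * ?d k" using fin by (simp add: sum.delta)
    finally show "(\<Sum>h | ?d h \<noteq> 0. cnj (c k) * ?d h * res tau (inv k \<otimes> h)) = c (inv g \<otimes> k) * cnj (c k)"
      using k by (simp add: shift_def)
  qed
  finally show ?thesis .
qed

text \<open>
  A coefficient of \<open>\<xi> \<in> \<ell>\<^sup>2(\<Gamma>)\<close> is approximated by one of a truncation \<open>c\<close> of \<open>\<xi>\<close>, hence by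
  \<open>\<tau>(\<pi>(c)\<^sup>* \<pi>(g) \<pi>(c))\<close>. If \<open>\<tau>\<close> is close to the sum of the vector functionals of \<open>\<eta> i\<close>, this value is
  close to the sum of the coefficients of \<open>\<pi>(c) (\<eta> i)\<close>.
\<close>

theorem weakly_contains_regular: "weakly_contains G H \<pi> (ell2 G) (left_regular G)"
  unfolding weakly_contains_def
proof (intro ballI allI impI)
  fix \<xi> F and e :: real assume \<xi>: "\<xi> \<in> vecs (ell2 G)" and F: "finite F \<and> F \<subseteq> carrier G \<and> e > 0"
  define a where "a g x = \<xi> (inv g \<otimes> x) * cnj (\<xi> x)" for g x
  define I where "I g = ip (ell2 G) (left_regular G g \<xi>) \<xi>" for g
  have "\<exists>E. finite E \<and> E \<subseteq> carrier G \<and> (\<forall>E'. finite E' \<and> E \<subseteq> E' \<and> E' \<subseteq> carrier G \<longrightarrow> dist (sum (a g) E') (I g) < e / 2)"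
    if g: "g \<in> F" for g
  proof -
    have "(sum (a g) \<longlongrightarrow> I g) (finite_subsets_at_top (carrier G))"
      using left_regular_coefficient_has_sum[OF \<xi>, of g] F g unfolding has_sum_def a_def I_def by auto
    then have "\<forall>\<^sub>F E in finite_subsets_at_top (carrier G). dist (sum (a g) E) (I g) < e / 2"
      using F by (intro tendstoD) auto
    then show ?thesis unfolding eventually_finite_subsets_at_top by blast
  qed
  then obtain E where E: "\<And>g. g \<in> F \<Longrightarrow> finite (E g)" "\<And>g. g \<in> F \<Longrightarrow> E g \<subseteq> carrier G"
    "\<And>g E'. g \<in> F \<Longrightarrow> finite E' \<Longrightarrow> E g \<subseteq> E' \<Longrightarrow> E' \<subseteq> carrier G \<Longrightarrow> dist (sum (a g) E') (I g) < e / 2"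
    by metis
  \<comment> \<open>The truncation has to contain the points \<open>x\<close> of the finite sets \<open>E g\<close> together with their
    translates \<open>g\<^sup>-\<^sup>1 x\<close>, as the coefficient pairs the values of \<open>\<xi>\<close> at both.\<close>
  define U where "U = (\<Union>g\<in>F. E g \<union> (\<lambda>x. inv g \<otimes> x) ` E g)"
  have U: "finite U" "U \<subseteq> carrier G" proof -
    show "finite U" unfolding U_def using F E(1) by auto
    have "E g \<union> (\<lambda>x. inv g \<otimes> x) ` E g \<subseteq> carrier G" if g: "g \<in> F" for g
      using E(2)[OF g] subsetD[of F "carrier G" g] F g by (auto intro!: m_closed)
    then show "U \<subseteq> carrier G" unfolding U_def by blast
  qed
  define c where "c h = (if h \<in> U then \<xi> h else 0)" for h
  have csub: "{h. c h \<noteq> 0} \<subseteq> U" by (auto simp: c_def)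
  have c: "c \<in> finsupp (carrier G)" using csub U by (auto simp: finsupp_def intro: finite_subset)
  let ?x = "lincomb c \<pi>"
  have xb: "?x \<in> bop H" using lincomb_pi_B[OF c] B_sub by blast
  have close: "cmod (tau (adj H ?x \<circ> (\<pi> g \<circ> ?x)) - I g) < e / 2" if g: "g \<in> F" for g
  proof -
    have gG: "g \<in> carrier G" using F g by auto
    let ?E = "{k \<in> U. inv g \<otimes> k \<in> U}"
    have "tau (adj H ?x \<circ> (\<pi> g \<circ> ?x)) = (\<Sum>k | c k \<noteq> 0. c (inv g \<otimes> k) * cnj (c k))"
      by (rule tau_coefficient[OF c gG])
    also have "\<dots> = (\<Sum>k\<in>U. c (inv g \<otimes> k) * cnj (c k))"
      by (rule sum.mono_neutral_left) (use U csub in auto)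
    also have "\<dots> = sum (a g) ?E"
      by (rule sum.mono_neutral_cong_right) (use U in \<open>auto simp: c_def a_def\<close>)
    finally have "tau (adj H ?x \<circ> (\<pi> g \<circ> ?x)) = sum (a g) ?E" .
    moreover have "dist (sum (a g) ?E) (I g) < e / 2"
    proof (rule E(3)[OF g])
      show "finite ?E" using U(1) by simp
      show "?E \<subseteq> carrier G" using U(2) by blast
      show "E g \<subseteq> ?E" using g unfolding U_def by blast
    qed
    ultimately show ?thesis by (simp add: dist_norm)
  qed
  have tau_state: "state H (bop H) tau" using tau(1) by (simp add: states_def)
  have "\<exists>(n::nat) \<eta>. (\<forall>i<n. \<eta> i \<in> V) \<and> (\<forall>T\<in>(\<lambda>g. adj H ?x \<circ> (\<pi> g \<circ> ?x)) ` F. cmod (tau T - (\<Sum>i<n. ip H (T (\<eta> i)) (\<eta> i))) < e / 2)"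
    by (rule state_vector_approximation[OF tau_state]) (use F xb in auto)
  then obtain n :: nat and \<eta> where \<eta>: "\<And>i. i < n \<Longrightarrow> \<eta> i \<in> V"
    "\<And>g. g \<in> F \<Longrightarrow> cmod (tau (adj H ?x \<circ> (\<pi> g \<circ> ?x)) - (\<Sum>i<n. ip H ((adj H ?x \<circ> (\<pi> g \<circ> ?x)) (\<eta> i)) (\<eta> i))) < e / 2"
    by blast
  show "\<exists>(n::nat) \<eta>. (\<forall>i<n. \<eta> i \<in> V) \<and>
      (\<forall>g\<in>F. cmod (ip (ell2 G) (left_regular G g \<xi>) \<xi> - (\<Sum>i<n. ip H (\<pi> g (\<eta> i)) (\<eta> i))) < e)"
  proof (intro exI conjI allI impI ballI)
    show "?x (\<eta> i) \<in> V" if "i < n" for i using \<eta>(1)[OF that] xb by simp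
    fix g assume g: "g \<in> F"
    have gG: "g \<in> carrier G" using F g by auto
    have eq: "(\<Sum>i<n. ip H ((adj H ?x \<circ> (\<pi> g \<circ> ?x)) (\<eta> i)) (\<eta> i)) = (\<Sum>i<n. ip H (\<pi> g (?x (\<eta> i))) (?x (\<eta> i)))"
    proof (rule sum.cong[OF refl])
      fix i assume "i \<in> {..<n}"
      then have i: "\<eta> i \<in> V" using \<eta>(1) by simp
      show "ip H ((adj H ?x \<circ> (\<pi> g \<circ> ?x)) (\<eta> i)) (\<eta> i) = ip H (\<pi> g (?x (\<eta> i))) (?x (\<eta> i))"
        using adj_ip'[OF xb, of "\<pi> g (?x (\<eta> i))" "\<eta> i"] i xb gG by simp
    qed
    have "cmod (I g - (\<Sum>i<n. ip H (\<pi> g (?x (\<eta> i))) (?x (\<eta> i)))) < e"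
      using close[OF g] \<eta>(2)[OF g, unfolded eq]
        norm_triangle_ineq[of "I g - tau (adj H ?x \<circ> (\<pi> g \<circ> ?x))" "tau (adj H ?x \<circ> (\<pi> g \<circ> ?x)) - (\<Sum>i<n. ip H (\<pi> g (?x (\<eta> i))) (?x (\<eta> i)))"]
        norm_minus_commute[of "I g" "tau (adj H ?x \<circ> (\<pi> g \<circ> ?x))"] by simp
    then show "cmod (ip (ell2 G) (left_regular G g \<xi>) \<xi> - (\<Sum>i<n. ip H (\<pi> g (?x (\<eta> i))) (?x (\<eta> i)))) < e"
      by (simp add: I_def)
  qed
qed

end

section \<open>Stationary states\<close>

lemma expectation_bind_pmf:
  fixes b :: "'a \<Rightarrow> real"
  assumes "\<And>x. \<bar>b x\<bar> \<le> M"
  shows "measure_pmf.expectation (bind_pmf p q) b = measure_pmf.expectation p (\<lambda>x. measure_pmf.expectation (q x) b)"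
  unfolding measure_pmf_bind
proof (rule integral_bind[where K = "count_space UNIV" and B = M and B' = 1])
  show "finite_measure (measure_pmf p)" by unfold_locales
  show "(\<lambda>x. measure_pmf (q x)) \<in> measurable (measure_pmf p) (subprob_algebra (count_space UNIV))"
    using measure_pmf_in_subprob_algebra[of "q _"] by (intro measurableI) (auto simp: space_subprob_algebra subprob_space_measure_pmf)
qed (use assms in \<open>auto simp: measure_pmf.emeasure_space_1\<close>)

lemma pmf_expectation_has_sum:
  fixes b :: "'a \<Rightarrow> real"
  assumes b: "\<And>x. \<bar>b x\<bar> \<le> M"
  shows "((\<lambda>x. pmf p x * b x) has_sum measure_pmf.expectation p b) UNIV"
proof -
  have "integrable (measure_pmf p) b"
    by (rule measure_pmf.integrable_const_bound[where B = M]) (use b in auto)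
  then have i: "integrable (count_space UNIV) (\<lambda>x. pmf p x * b x)"
    unfolding measure_pmf_eq_density by (subst (asm) integrable_density) auto
  have abs: "Infinite_Set_Sum.abs_summable_on (\<lambda>x. pmf p x * b x) UNIV"
    unfolding Infinite_Set_Sum.abs_summable_on_def by (rule i)
  have "measure_pmf.expectation p b = infsetsum (\<lambda>x. pmf p x * b x) UNIV"
    unfolding measure_pmf_eq_density infsetsum_def by (subst integral_density) auto
  also have "\<dots> = infsum (\<lambda>x. pmf p x * b x) UNIV" by (rule infsetsum_infsum[OF abs])
  finally have e: "measure_pmf.expectation p b = infsum (\<lambda>x. pmf p x * b x) UNIV" .
  have "(\<lambda>x. norm (pmf p x * b x)) summable_on UNIV" using abs unfolding abs_summable_equivalent[symmetric] .
  then have "(\<lambda>x. pmf p x * b x) summable_on UNIV" by (rule abs_summable_summable)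
  then show ?thesis unfolding e by (rule has_sum_infsum)
qed

context charmenable_rep begin

text \<open>
  The real part of \<open>f\<close> along the orbit of \<open>T\<close>. Integrals of bounded real functions against a measure
  on the group express both stationarity and averages; the value outside the group carries no mass.
\<close>

definition orbit :: "(('v \<Rightarrow> 'v) \<Rightarrow> complex) \<Rightarrow> ('v \<Rightarrow> 'v) \<Rightarrow> 'g \<Rightarrow> real" where
  "orbit f T g = (if g \<in> carrier G then Re (f (Ad H (\<pi> (inv g)) T)) else 0)"

lemma orbit_bound: assumes f: "f \<in> states" and T: "T \<in> bop H" shows "\<bar>orbit f T g\<bar> \<le> opnorm H T"
proof (cases "g \<in> carrier G")
  case True
  then have "\<bar>orbit f T g\<bar> \<le> cmod (f (Ad H (\<pi> (inv g)) T))" by (simp add: orbit_def abs_Re_le_cmod)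
  also have "\<dots> \<le> opnorm H (Ad H (\<pi> (inv g)) T)" using f T True by (intro states_bound) auto
  also have "\<dots> \<le> opnorm H T" using T True by (intro opnorm_Ad) auto
  finally show ?thesis .
qed (simp add: orbit_def opnorm_nonneg T)

text \<open>
  The measure \<open>\<nu>\<close> implements the average \<open>P\<close>. The inverse in \<open>orbit\<close> makes the point mass at
  \<open>g\<^sup>-\<^sup>1\<close> implement \<open>Ad (\<pi> g)\<close>.
\<close>

definition realizes :: "'g pmf \<Rightarrow> (('v \<Rightarrow> 'v) \<Rightarrow> 'v \<Rightarrow> 'v) \<Rightarrow> bool" where
  "realizes \<nu> P \<longleftrightarrow> set_pmf \<nu> \<subseteq> carrier G \<and>
     (\<forall>f\<in>states. \<forall>T\<in>bop H. measure_pmf.expectation \<nu> (orbit f T) = Re (f (P T)))"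

lemma realizes_mix:
  assumes 1: "realizes \<nu>1 P" and 2: "realizes \<nu>2 R" and PR: "P \<in> Avg" "R \<in> Avg" and t: "0 \<le> t" "t \<le> 1"
  shows "realizes (bind_pmf (bernoulli_pmf t) (\<lambda>b. if b then \<nu>2 else \<nu>1))
    (\<lambda>T. of_real (1 - t) *\<^sub>C P T + of_real t *\<^sub>C R T)"
  unfolding realizes_def
proof (intro conjI ballI)
  show "set_pmf (bind_pmf (bernoulli_pmf t) (\<lambda>b. if b then \<nu>2 else \<nu>1)) \<subseteq> carrier G"
    using 1 2 by (auto simp: realizes_def set_bind_pmf split: if_splits)
  fix f T assume f: "f \<in> states" and T: "T \<in> bop H"
  have b: "P T \<in> bop H" "R T \<in> bop H" using PR T Avg_in by blast+
  have "measure_pmf.expectation (bind_pmf (bernoulli_pmf t) (\<lambda>b. if b then \<nu>2 else \<nu>1)) (orbit f T)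
      = measure_pmf.expectation (bernoulli_pmf t) (\<lambda>b. measure_pmf.expectation (if b then \<nu>2 else \<nu>1) (orbit f T))"
    by (rule expectation_bind_pmf[OF orbit_bound[OF f T]])
  also have "\<dots> = Re (f (R T)) * t + Re (f (P T)) * (1 - t)"
    using 1 2 f T t by (simp add: realizes_def)
  also have "\<dots> = Re (f (of_real (1 - t) *\<^sub>C P T + of_real t *\<^sub>C R T))"
    unfolding states_mix[OF f b] by simp
  finally show "measure_pmf.expectation (bind_pmf (bernoulli_pmf t) (\<lambda>b. if b then \<nu>2 else \<nu>1)) (orbit f T)
      = Re (f (of_real (1 - t) *\<^sub>C P T + of_real t *\<^sub>C R T))" .
qed

lemma Avg_realized: "P \<in> Avg \<Longrightarrow> \<exists>\<nu>. realizes \<nu> P"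
proof (induction rule: Avg.induct)
  case (Ad g)
  then have "realizes (return_pmf (inv g)) (Ad H (\<pi> g))" by (simp add: realizes_def orbit_def)
  then show ?case by blast
next
  case (mix P R t)
  then show ?case using realizes_mix by blast
qed

text \<open>
  Following the average by \<open>Ad (\<pi> h)\<close> translates the measure on the right by \<open>h\<^sup>-\<^sup>1\<close>.
\<close>

lemma realizes_translate:
  assumes r: "realizes \<nu> P" and P: "P \<in> Avg" and h: "h \<in> carrier G"
    and U: "\<And>T. T \<in> bop H \<Longrightarrow> U T = Ad H (\<pi> h) (P T)"
  shows "realizes (map_pmf (\<lambda>g. g \<otimes> inv h) \<nu>) U"
  unfolding realizes_def
proof (intro conjI ballI)
  have \<nu>: "set_pmf \<nu> \<subseteq> carrier G" using r by (simp add: realizes_def)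
  then show "set_pmf (map_pmf (\<lambda>g. g \<otimes> inv h) \<nu>) \<subseteq> carrier G" using h by auto
  fix f T assume f: "f \<in> states" and T: "T \<in> bop H"
  have "measure_pmf.expectation (map_pmf (\<lambda>g. g \<otimes> inv h) \<nu>) (orbit f T) = measure_pmf.expectation \<nu> (\<lambda>g. orbit f T (g \<otimes> inv h))"
    by simp
  also have "\<dots> = measure_pmf.expectation \<nu> (orbit (act h f) T)"
  proof (rule integral_cong_AE)
    show "AE g in measure_pmf \<nu>. orbit f T (g \<otimes> inv h) = orbit (act h f) T g"
    proof (rule AE_pmfI)
      fix g assume "g \<in> set_pmf \<nu>"
      then have g: "g \<in> carrier G" using \<nu> by blast
      have "inv (g \<otimes> inv h) = h \<otimes> inv g" using g h by (simp add: inv_mult_group)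
      then show "orbit f T (g \<otimes> inv h) = orbit (act h f) T g"
        using g h T by (simp add: orbit_def act_def Ad_mult)
    qed
  qed auto
  also have "\<dots> = Re (act h f (P T))" using r act_states[OF h f] T by (simp add: realizes_def)
  also have "\<dots> = Re (f (U T))" using U[OF T] Avg_in[OF P T] by (simp add: act_def)
  finally show "measure_pmf.expectation (map_pmf (\<lambda>g. g \<otimes> inv h) \<nu>) (orbit f T) = Re (f (U T))" .
qed

text \<open>
  The Powers property gives an average \<open>P\<close> that shrinks the elements of \<open>X\<close>. Half of it is replaced by
  \<open>P\<close> followed by \<open>Ad (\<pi> h)\<close>: the norms do not grow, and the support then contains both some \<open>g\<close> and
  \<open>g h\<^sup>-\<^sup>1\<close>, so it generates a subgroup containing \<open>h\<close>.
\<close>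

lemma contracting_average:
  assumes X: "finite X" "X \<subseteq> A" "\<And>x. x \<in> X \<Longrightarrow> tau x = 0" and h: "h \<in> carrier G"
  shows "\<exists>P \<nu>. P \<in> Avg \<and> realizes \<nu> P \<and> h \<in> generate G (set_pmf \<nu>) \<and> (\<forall>x\<in>X. opnorm H (P x) \<le> 1)"
proof -
  obtain P where P: "P \<in> Avg" "\<And>x. x \<in> X \<Longrightarrow> opnorm H (P x - tau x *\<^sub>C id_op H) \<le> 1"
    using powers_finite[OF X(1,2), of 1] by auto
  have P1: "opnorm H (P x) \<le> 1" if "x \<in> X" for x using P(2)[OF that] X(3)[OF that] by simp
  obtain \<nu> where \<nu>: "realizes \<nu> P" using Avg_realized[OF P(1)] by blast
  obtain U where U: "U \<in> Avg" "\<And>T. T \<in> bop H \<Longrightarrow> U T = Ad H (\<pi> h) (P T)"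
    using Avg_comp[OF Avg.Ad[OF h] P(1)] by blast
  let ?R = "\<lambda>T. of_real (1 - 1/2) *\<^sub>C P T + of_real (1/2) *\<^sub>C U T"
  let ?\<nu> = "bind_pmf (bernoulli_pmf (1/2)) (\<lambda>b. if b then map_pmf (\<lambda>g. g \<otimes> inv h) \<nu> else \<nu>)"
  have R: "?R \<in> Avg" by (rule Avg.mix[OF P(1) U(1)]) auto
  have "realizes ?\<nu> ?R"
    by (rule realizes_mix[OF \<nu> realizes_translate[OF \<nu> P(1) h U(2)] P(1) U(1)]) auto
  moreover have "h \<in> generate G (set_pmf ?\<nu>)"
  proof -
    obtain g where g: "g \<in> set_pmf \<nu>" using set_pmf_not_empty[of \<nu>] by blast
    then have gG: "g \<in> carrier G" using \<nu> by (auto simp: realizes_def)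
    have "set_pmf ?\<nu> = (\<lambda>g. g \<otimes> inv h) ` set_pmf \<nu> \<union> set_pmf \<nu>"
      unfolding set_bind_pmf by (simp add: set_pmf_bernoulli UNIV_bool Un_commute)
    then have "inv (g \<otimes> inv h) \<in> generate G (set_pmf ?\<nu>)" "g \<in> generate G (set_pmf ?\<nu>)"
      using g by (auto intro: generate.intros)
    then have "inv (g \<otimes> inv h) \<otimes> g \<in> generate G (set_pmf ?\<nu>)" by (rule generate.eng)
    moreover have "inv (g \<otimes> inv h) \<otimes> g = h" using gG h by (simp add: inv_mult_group m_assoc)
    ultimately show ?thesis by simp
  qed
  moreover have "opnorm H (?R x) \<le> 1" if x: "x \<in> X" for x
  proof -
    have xb: "x \<in> bop H" using x X(2) A_sub by blast
    have b: "P x \<in> bop H" "U x \<in> bop H" using xb P(1) U(1) Avg_in by blast+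
    have "opnorm H (U x) \<le> 1" using opnorm_Ad[OF h b(1)] P1[OF x] U(2)[OF xb] by simp
    moreover have "opnorm H (?R x) \<le> opnorm H (of_real (1 - 1/2) *\<^sub>C P x) + opnorm H (of_real (1/2) *\<^sub>C U x)"
      using b by (intro opnorm_triangle) auto
    moreover have "opnorm H (of_real (1 - 1/2) *\<^sub>C P x) \<le> 1/2 * opnorm H (P x)" "opnorm H (of_real (1/2) *\<^sub>C U x) \<le> 1/2 * opnorm H (U x)"
      using opnorm_scale[OF b(1), of "of_real (1 - 1/2)"] opnorm_scale[OF b(2), of "of_real (1/2)"] by simp_all
    ultimately show ?thesis using P1[OF x] by linarith
  qed
  ultimately show ?thesis using R by blast
qed

text \<open>
  The sum of the first \<open>j\<close> terms of the average \<open>\<Sum>\<^sub>i 2\<^sup>-\<^sup>i\<^sup>-\<^sup>1 P\<^sub>i\<close>. It has norm at most \<open>1 - 2\<^sup>-\<^sup>j\<close>, so that its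
  Neumann series converges.
\<close>

definition partial_avg :: "nat \<Rightarrow> (nat \<Rightarrow> ('v \<Rightarrow> 'v) \<Rightarrow> 'v \<Rightarrow> 'v) \<Rightarrow> ('v \<Rightarrow> 'v) \<Rightarrow> 'v \<Rightarrow> 'v" where
  "partial_avg j P T = (\<Sum>i<j. of_real ((1/2) ^ Suc i) *\<^sub>C P i T)"

text \<open>
  The truncated Neumann series of \<open>S = partial_avg j P\<close>: an approximate solution \<open>w\<close> of
  \<open>w - S w = T\<close>, with the error \<open>S\<^sup>N T\<close> by \<open>partial_avg_neumann\<close>.
\<close>

definition neumann :: "nat \<Rightarrow> nat \<Rightarrow> (nat \<Rightarrow> ('v \<Rightarrow> 'v) \<Rightarrow> 'v \<Rightarrow> 'v) \<Rightarrow> ('v \<Rightarrow> 'v) \<Rightarrow> 'v \<Rightarrow> 'v" where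
  "neumann N j P T = (\<Sum>n<N. (partial_avg j P ^^ n) T)"

lemma sum_halves: "(\<Sum>i<j. (1/2::real) ^ Suc i) = 1 - (1/2) ^ j"
  by (induction j) auto

lemma partial_avg_A:
  assumes P: "\<And>i. i < j \<Longrightarrow> P i \<in> Avg" and T: "T \<in> A"
  shows "partial_avg j P T \<in> A" and "tau T = 0 \<Longrightarrow> tau (partial_avg j P T) = 0"
proof -
  have W: "csubspace A" using A_star_alg by (simp add: star_alg_def)
  have PT: "P i T \<in> A" if "i < j" for i using P[OF that] T Avg_A by blast
  show "partial_avg j P T \<in> A" unfolding partial_avg_def using W PT by (intro cvs.subspace_sum cvs.subspace_scale) auto
  assume t: "tau T = 0"
  have "tau (partial_avg j P T) = (\<Sum>i<j. of_real ((1/2) ^ Suc i) * tau (P i T))"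
    unfolding partial_avg_def by (rule positive_functional_sum[OF star_alg_bop states_positive[OF tau(1)]]) (use PT A_sub in auto)
  also have "\<dots> = 0" by (rule sum.neutral) (use Avg_tau[OF P T] t in auto)
  finally show "tau (partial_avg j P T) = 0" .
qed

lemma partial_avg_pow_A:
  assumes P: "\<And>i. i < j \<Longrightarrow> P i \<in> Avg" and T: "T \<in> A"
  shows "(partial_avg j P ^^ n) T \<in> A" and "tau T = 0 \<Longrightarrow> tau ((partial_avg j P ^^ n) T) = 0"
proof -
  have "(partial_avg j P ^^ n) T \<in> A \<and> (tau T = 0 \<longrightarrow> tau ((partial_avg j P ^^ n) T) = 0)"
  proof (induction n)
    case 0
    have "(partial_avg j P ^^ 0) T = T" by simp
    then show ?case using T by metis
  next
    case (Suc n)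
    have "(partial_avg j P ^^ Suc n) T = partial_avg j P ((partial_avg j P ^^ n) T)" by simp
    then show ?case using partial_avg_A[of j P "(partial_avg j P ^^ n) T"] P Suc by metis
  qed
  then show "(partial_avg j P ^^ n) T \<in> A" "tau T = 0 \<Longrightarrow> tau ((partial_avg j P ^^ n) T) = 0" by blast+
qed

lemma neumann_A:
  assumes P: "\<And>i. i < j \<Longrightarrow> P i \<in> Avg" and T: "T \<in> A" "tau T = 0"
  shows "neumann N j P T \<in> A" and "tau (neumann N j P T) = 0"
proof -
  have W: "csubspace A" using A_star_alg by (simp add: star_alg_def)
  show "neumann N j P T \<in> A" unfolding neumann_def
    using W partial_avg_pow_A(1)[of j P T] P T(1) by (intro cvs.subspace_sum) auto
  have "tau (\<Sum>n<N. 1 *\<^sub>C (partial_avg j P ^^ n) T) = (\<Sum>n<N. 1 * tau ((partial_avg j P ^^ n) T))"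
    by (rule positive_functional_sum[OF star_alg_bop states_positive[OF tau(1)]])
      (use partial_avg_pow_A(1)[of j P T] P T(1) A_sub in auto)
  also have "\<dots> = 0" by (rule sum.neutral) (use partial_avg_pow_A(2)[of j P T] P T in auto)
  finally show "tau (neumann N j P T) = 0" unfolding neumann_def cvs.scale_one .
qed

lemma partial_avg_opnorm:
  assumes P: "\<And>i. i < j \<Longrightarrow> P i \<in> Avg" and T: "T \<in> bop H"
  shows "partial_avg j P T \<in> bop H" and "opnorm H (partial_avg j P T) \<le> (1 - (1/2) ^ j) * opnorm H T"
proof -
  have "partial_avg j P T \<in> bop H \<and> opnorm H (partial_avg j P T) \<le> (\<Sum>i<j. (1/2) ^ Suc i) * opnorm H T"
    using P
  proof (induction j)
    case 0
    have z: "partial_avg 0 P T = 0" by (simp add: partial_avg_def)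
    have "partial_avg 0 P T \<in> bop H \<and> opnorm H (partial_avg 0 P T) \<le> (\<Sum>i<0. (1/2) ^ Suc i) * opnorm H T"
      unfolding z by simp
    then show ?case .
  next
    case (Suc j)
    have eq: "partial_avg (Suc j) P T = partial_avg j P T + of_real ((1/2) ^ Suc j) *\<^sub>C P j T"
      unfolding partial_avg_def by (simp only: sum.lessThan_Suc)
    have IH: "partial_avg j P T \<in> bop H" "opnorm H (partial_avg j P T) \<le> (\<Sum>i<j. (1/2) ^ Suc i) * opnorm H T"
      using Suc.IH Suc.prems by auto
    have Pj: "P j \<in> Avg" using Suc.prems by simp
    have PT: "P j T \<in> bop H" using Avg_in[OF Pj T] .
    have c: "cmod (of_real ((1/2) ^ Suc j)) = (1/2) ^ Suc j" by (subst norm_of_real) simp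
    have "opnorm H (of_real ((1/2) ^ Suc j) *\<^sub>C P j T) \<le> (1/2) ^ Suc j * opnorm H (P j T)"
      using opnorm_scale[OF PT, of "of_real ((1/2) ^ Suc j)", unfolded c] .
    also have "\<dots> \<le> (1/2) ^ Suc j * opnorm H T" using Avg_opnorm[OF Pj T] by (intro mult_left_mono) auto
    finally have "opnorm H (partial_avg (Suc j) P T) \<le> (\<Sum>i<j. (1/2) ^ Suc i) * opnorm H T + (1/2) ^ Suc j * opnorm H T"
      unfolding eq using opnorm_triangle[OF IH(1) op_scale_in[OF PT], of "of_real ((1/2) ^ Suc j)"] IH(2) by linarith
    also have "\<dots> = (\<Sum>i<Suc j. (1/2) ^ Suc i) * opnorm H T" by (simp add: algebra_simps)
    finally have "opnorm H (partial_avg (Suc j) P T) \<le> (\<Sum>i<Suc j. (1/2) ^ Suc i) * opnorm H T" .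
    moreover have "partial_avg (Suc j) P T \<in> bop H" unfolding eq by (rule op_add_in[OF IH(1) op_scale_in[OF PT]])
    ultimately have "partial_avg (Suc j) P T \<in> bop H \<and> opnorm H (partial_avg (Suc j) P T) \<le> (\<Sum>i<Suc j. (1/2) ^ Suc i) * opnorm H T" by (rule conjI[rotated])
    then show ?case .
  qed
  then show "partial_avg j P T \<in> bop H" "opnorm H (partial_avg j P T) \<le> (1 - (1/2) ^ j) * opnorm H T"
    unfolding sum_halves by auto
qed

lemma partial_avg_pow_opnorm:
  assumes P: "\<And>i. i < j \<Longrightarrow> P i \<in> Avg" and T: "T \<in> bop H"
  shows "(partial_avg j P ^^ n) T \<in> bop H" and "opnorm H ((partial_avg j P ^^ n) T) \<le> (1 - (1/2) ^ j) ^ n * opnorm H T"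
proof -
  have s0: "0 \<le> 1 - (1/2::real) ^ j" by (simp add: power_le_one)
  have "(partial_avg j P ^^ n) T \<in> bop H \<and> opnorm H ((partial_avg j P ^^ n) T) \<le> (1 - (1/2) ^ j) ^ n * opnorm H T"
  proof (induction n)
    case 0
    have "(partial_avg j P ^^ 0) T = T" by simp
    then show ?case using T by simp
  next
    case (Suc n)
    let ?Y = "(partial_avg j P ^^ n) T"
    have eq: "(partial_avg j P ^^ Suc n) T = partial_avg j P ?Y" by simp
    have Y: "?Y \<in> bop H" "opnorm H ?Y \<le> (1 - (1/2) ^ j) ^ n * opnorm H T" using Suc by auto
    have "opnorm H (partial_avg j P ?Y) \<le> (1 - (1/2) ^ j) * opnorm H ?Y" by (rule partial_avg_opnorm(2)[OF P Y(1)])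
    also have "\<dots> \<le> (1 - (1/2) ^ j) * ((1 - (1/2) ^ j) ^ n * opnorm H T)" using Y(2) s0 by (rule mult_left_mono)
    finally have "opnorm H (partial_avg j P ?Y) \<le> (1 - (1/2) ^ j) ^ Suc n * opnorm H T" by (simp add: mult.assoc)
    then have "partial_avg j P ?Y \<in> bop H \<and> opnorm H (partial_avg j P ?Y) \<le> (1 - (1/2) ^ j) ^ Suc n * opnorm H T"
      using partial_avg_opnorm(1)[OF P Y(1)] by simp
    then show ?case unfolding eq .
  qed
  then show "(partial_avg j P ^^ n) T \<in> bop H" "opnorm H ((partial_avg j P ^^ n) T) \<le> (1 - (1/2) ^ j) ^ n * opnorm H T" by blast+
qed

text \<open>
  Applying \<open>partial_avg j P\<close> shifts the Neumann sum by one place, so the difference telescopes. It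
  is only needed, and computed, after applying a state.
\<close>

lemma partial_avg_neumann:
  assumes P: "\<And>i. i < j \<Longrightarrow> P i \<in> Avg" and T: "T \<in> bop H" and f: "f \<in> states"
  shows "f (neumann N j P T) - f (partial_avg j P (neumann N j P T)) = f T - f ((partial_avg j P ^^ N) T)"
proof -
  have pb: "(partial_avg j P ^^ n) T \<in> bop H" for n by (rule partial_avg_pow_opnorm(1)[OF P T])
  have f_avg: "f (partial_avg j P X) = (\<Sum>i<j. of_real ((1/2) ^ Suc i) * f (P i X))" if X: "X \<in> bop H" for X
    unfolding partial_avg_def
    by (rule positive_functional_sum[OF star_alg_bop states_positive[OF f]]) (use X P Avg_in in auto)
  have fadd: "f (partial_avg j P (X + Y)) = f (partial_avg j P X) + f (partial_avg j P Y)" if X: "X \<in> bop H" and Y: "Y \<in> bop H" for X Y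
  proof -
    have "f (P i (X + Y)) = f (P i X) + f (P i Y)" if "i < j" for i
      using Avg_add[OF P[OF that] X Y] states_add[OF f Avg_in[OF P[OF that] X] Avg_in[OF P[OF that] Y]] by simp
    then have "(\<Sum>i<j. of_real ((1/2) ^ Suc i) * f (P i (X + Y))) = (\<Sum>i<j. of_real ((1/2) ^ Suc i) * f (P i X) + of_real ((1/2) ^ Suc i) * f (P i Y))"
      by (intro sum.cong) (auto simp: algebra_simps)
    then show ?thesis unfolding f_avg[OF op_add_in[OF X Y]] f_avg[OF X] f_avg[OF Y] sum.distrib .
  qed
  have zero: "f (partial_avg j P 0) = 0"
    using fadd[of 0 0] by simp
  have "neumann N j P T \<in> bop H \<and> f (neumann N j P T) - f (partial_avg j P (neumann N j P T)) = f T - f ((partial_avg j P ^^ N) T)" for N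
  proof (induction N)
    case 0
    have z: "neumann 0 j P T = 0" "(partial_avg j P ^^ 0) T = T" by (simp_all add: neumann_def)
    have "f 0 = 0" using states_scale[OF f op_zero_in, of 0] by simp
    then have "neumann 0 j P T \<in> bop H \<and> f (neumann 0 j P T) - f (partial_avg j P (neumann 0 j P T)) = f T - f ((partial_avg j P ^^ 0) T)"
      unfolding z zero by simp
    then show ?case .
  next
    case (Suc N)
    let ?w = "neumann N j P T" and ?y = "(partial_avg j P ^^ N) T"
    have eq: "neumann (Suc N) j P T = ?w + ?y" unfolding neumann_def by (simp only: sum.lessThan_Suc)
    have eq2: "(partial_avg j P ^^ Suc N) T = partial_avg j P ?y" by simp
    have w: "?w \<in> bop H" by (rule conjunct1[OF Suc.IH])
    have IH: "f ?w - f (partial_avg j P ?w) = f T - f ?y" by (rule conjunct2[OF Suc.IH])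
    have "f (?w + ?y) - f (partial_avg j P (?w + ?y)) = f T - f (partial_avg j P ?y)"
      unfolding fadd[OF w pb[of N]] states_add[OF f w pb[of N]] using IH by (simp add: algebra_simps)
    then have "neumann (Suc N) j P T \<in> bop H \<and>
        f (neumann (Suc N) j P T) - f (partial_avg j P (neumann (Suc N) j P T)) = f T - f ((partial_avg j P ^^ Suc N) T)"
      unfolding eq eq2 using op_add_in[OF w pb[of N]] by (intro conjI)
    then show ?case .
  qed
  then show ?thesis by blast
qed

text \<open>
  The elements \<open>x i\<close> are the \<open>\<pi>(g) - \<tau>(\<pi>(g)) 1\<close> and their multiples by the imaginary unit, so a
  state is regular if the real part of its value at every \<open>x i\<close> vanishes. The averages \<open>P\<^sub>k\<close> are
  chosen recursively: for \<open>i < j \<le> k\<close> the truncated Neumann series \<open>w\<close> of \<open>x i\<close> for the first \<open>j\<close>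
  averages is known before \<open>P\<^sub>k\<close> is chosen, and \<open>P\<^sub>k\<close> is chosen to make \<open>\<parallel>P\<^sub>k w\<parallel> \<le> 1\<close>. The \<open>k\<close>-th
  measure also takes care of the \<open>k\<close>-th element \<open>e k\<close> of the group in the generation of \<open>\<Gamma>\<close>. The weights
  \<open>2\<^sup>-\<^sup>k\<^sup>-\<^sup>1\<close> are those of the geometric distribution.
\<close>

theorem unique_stationary_measure:
  "\<exists>\<mu>. set_pmf \<mu> \<subseteq> carrier G \<and> generate G (set_pmf \<mu>) = carrier G \<and>
     (\<forall>f\<in>states. (\<forall>T\<in>A. Re (f T) = measure_pmf.expectation \<mu> (orbit f T)) \<longrightarrow> regular f)"
proof -
  have ne: "carrier G \<noteq> {}" using one_closed by blast
  define e where "e = from_nat_into (carrier G)"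
  have eG: "e i \<in> carrier G" for i unfolding e_def using from_nat_into[OF ne] .
  have e_onto: "\<exists>i. e i = g" if "g \<in> carrier G" for g
    using range_from_nat_into[OF ne countable] that unfolding e_def by (metis rangeE)
  define x where "x i = (if even i then 1 else \<i>) *\<^sub>C (\<pi> (e (i div 2)) - tau (\<pi> (e (i div 2))) *\<^sub>C id_op H)" for i
  note Ain = star_alg_in[OF A_star_alg]
  have xA: "x i \<in> A" for i unfolding x_def by (intro Ain(3,4,7) pi_A eG)
  have xt: "tau (x i) = 0" for i
    unfolding x_def
    using states_scale[OF tau(1) op_diff_in[OF pi_in[OF eG] op_scale_in[OF id_in]]]
      states_diff[OF tau(1) pi_in[OF eG] op_scale_in[OF id_in]] states_scale[OF tau(1) id_in] states_one[OF tau(1)] by simp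
  \<comment> \<open>The number of terms of the Neumann series that makes the error at most \<open>2\<^sup>-\<^sup>j \<parallel>x\<parallel>\<close>.\<close>
  have "\<exists>N. (1 - (1/2::real) ^ j) ^ N < (1/2) ^ j" for j
    by (rule real_arch_pow_inv) auto
  then obtain N where N: "\<And>j. (1 - (1/2::real) ^ j) ^ N j < (1/2) ^ j" by metis
  define good where "good F k r = (fst r \<in> Avg \<and> realizes (snd r) (fst r) \<and> e k \<in> generate G (set_pmf (snd r)) \<and>
      (\<forall>j\<le>k. \<forall>i<j. opnorm H (fst r (neumann (N j) j (\<lambda>i. fst (F i)) (x i))) \<le> 1))"
    for F :: "nat \<Rightarrow> ((('v \<Rightarrow> 'v) \<Rightarrow> 'v \<Rightarrow> 'v) \<times> 'g pmf)" and k r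
  have "\<exists>F. \<forall>k. good F k (F k)"
  proof (rule dependent_wf_choice[OF wf_less_than])
    fix F F' :: "nat \<Rightarrow> ((('v \<Rightarrow> 'v) \<Rightarrow> 'v \<Rightarrow> 'v) \<times> 'g pmf)" and k r
    assume "\<And>z. (z, k) \<in> less_than \<Longrightarrow> F z = F' z"
    then have FF: "F i = F' i" if "i < k" for i using that by simp
    have "partial_avg j (\<lambda>i. fst (F i)) = partial_avg j (\<lambda>i. fst (F' i))" if "j \<le> k" for j
    proof
      fix T show "partial_avg j (\<lambda>i. fst (F i)) T = partial_avg j (\<lambda>i. fst (F' i)) T"
        unfolding partial_avg_def by (rule sum.cong) (use FF that in auto)
    qed
    then have "neumann (N j) j (\<lambda>i. fst (F i)) T = neumann (N j) j (\<lambda>i. fst (F' i)) T" if "j \<le> k" for j T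
      unfolding neumann_def using that by simp
    then show "good F k r = good F' k r" unfolding good_def by metis
  next
    fix k and F :: "nat \<Rightarrow> ((('v \<Rightarrow> 'v) \<Rightarrow> 'v \<Rightarrow> 'v) \<times> 'g pmf)"
    assume prev: "\<And>y. (y, k) \<in> less_than \<Longrightarrow> good F y (F y)"
    have FA: "fst (F i) \<in> Avg" if "i < k" for i using prev[of i] that by (simp add: good_def)
    define X where "X = (\<lambda>(j, i). neumann (N j) j (\<lambda>i. fst (F i)) (x i)) ` (SIGMA j:{..k}. {..<j})"
    have "finite X" unfolding X_def by simp
    moreover have "z \<in> A \<and> tau z = 0" if z: "z \<in> X" for z
    proof -
      obtain j i where ji: "j \<le> k" "z = neumann (N j) j (\<lambda>i. fst (F i)) (x i)" using z by (auto simp: X_def)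
      show ?thesis unfolding ji(2) using neumann_A[of j "\<lambda>i. fst (F i)" "x i" "N j"] FA ji(1) xA xt by simp
    qed
    ultimately obtain P \<nu> where P: "P \<in> Avg" "realizes \<nu> P" "e k \<in> generate G (set_pmf \<nu>)" "\<And>z. z \<in> X \<Longrightarrow> opnorm H (P z) \<le> 1"
      using contracting_average[of X "e k"] eG by (metis subsetI)
    have "good F k (P, \<nu>)" unfolding good_def fst_conv snd_conv
    proof (intro conjI allI impI)
      fix j i assume "j \<le> k" "i < j"
      then show "opnorm H (P (neumann (N j) j (\<lambda>i. fst (F i)) (x i))) \<le> 1"
        by (intro P(4)) (auto simp: X_def)
    qed (fact P)+
    then show "\<exists>r. good F k r" by blast
  qed
  then obtain F where F: "\<And>k. good F k (F k)" by blast
  define P where "P k = fst (F k)" for k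
  define \<nu> where "\<nu> k = snd (F k)" for k
  have PA: "P k \<in> Avg" and real: "realizes (\<nu> k) (P k)" and gen: "e k \<in> generate G (set_pmf (\<nu> k))" for k
    using F[of k] by (auto simp: good_def P_def \<nu>_def)
  have small: "opnorm H (P k (neumann (N j) j P (x i))) \<le> 1" if "j \<le> k" "i < j" for i j k
  proof -
    have "P = (\<lambda>i. fst (F i))" by (simp add: P_def fun_eq_iff)
    then show ?thesis using F[of k] that by (simp add: good_def)
  qed
  define \<mu> where "\<mu> = bind_pmf (geometric_pmf (1/2)) \<nu>"
  have supp: "set_pmf \<mu> = (\<Union>k. set_pmf (\<nu> k))" unfolding \<mu>_def by (simp add: set_bind_pmf set_pmf_geometric)
  have suppG: "set_pmf \<mu> \<subseteq> carrier G" unfolding supp using real by (auto simp: realizes_def)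
  have "generate G (set_pmf \<mu>) = carrier G"
  proof
    show "generate G (set_pmf \<mu>) \<subseteq> carrier G" using suppG by (rule generate_incl)
    show "carrier G \<subseteq> generate G (set_pmf \<mu>)"
    proof
      fix g assume "g \<in> carrier G"
      then obtain k where k: "e k = g" using e_onto by blast
      have "set_pmf (\<nu> k) \<subseteq> set_pmf \<mu>" unfolding supp by blast
      then show "g \<in> generate G (set_pmf \<mu>)" using gen[of k] mono_generate unfolding k by blast
    qed
  qed
  moreover have "regular f" if f: "f \<in> states" and stat: "\<And>T. T \<in> A \<Longrightarrow> Re (f T) = measure_pmf.expectation \<mu> (orbit f T)" for f
  proof -
    have sums: "(\<lambda>k. (1/2) ^ Suc k * Re (f (P k T))) sums Re (f T)" if T: "T \<in> A" for T
    proof -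
      have Tb: "T \<in> bop H" using T A_sub by blast
      have bd: "\<bar>Re (f (P k T))\<bar> \<le> opnorm H T" for k
        using abs_Re_le_cmod[of "f (P k T)"] states_bound[OF f Avg_in[OF PA Tb], of k] Avg_opnorm[OF PA Tb, of k] by linarith
      have "Re (f T) = measure_pmf.expectation (geometric_pmf (1/2)) (\<lambda>k. measure_pmf.expectation (\<nu> k) (orbit f T))"
        unfolding stat[OF T] \<mu>_def by (rule expectation_bind_pmf[OF orbit_bound[OF f Tb]])
      also have "\<dots> = measure_pmf.expectation (geometric_pmf (1/2)) (\<lambda>k. Re (f (P k T)))"
        using real f Tb by (simp add: realizes_def)
      finally have E: "Re (f T) = measure_pmf.expectation (geometric_pmf (1/2)) (\<lambda>k. Re (f (P k T)))" .
      have "((\<lambda>k. pmf (geometric_pmf (1/2)) k * Re (f (P k T))) has_sum Re (f T)) UNIV"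
        unfolding E by (rule pmf_expectation_has_sum[OF bd])
      then have "(\<lambda>k. pmf (geometric_pmf (1/2)) k * Re (f (P k T))) sums Re (f T)" by (rule has_sum_imp_sums)
      then show ?thesis by (simp add: mult.commute)
    qed
    \<comment> \<open>Stationarity expresses \<open>f(w) - f(S w)\<close> as the tail of the series from \<open>j\<close> on, where every term is
      controlled by the choice of the averages.\<close>
    have bound: "\<bar>Re (f (x i))\<bar> \<le> (1 + opnorm H (x i)) * (1/2) ^ j" if ij: "i < j" for i j
    proof -
      let ?w = "neumann (N j) j P (x i)"
      have xb: "x i \<in> bop H" using xA A_sub by blast
      have wA: "?w \<in> A" by (rule neumann_A(1)[OF PA xA xt])
      have wb: "?w \<in> bop H" using wA A_sub by blast
      let ?a = "\<lambda>k. (1/2) ^ Suc k * Re (f (P k ?w))"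
      have s: "?a sums Re (f ?w)" by (rule sums[OF wA])
      have "f (partial_avg j P ?w) = (\<Sum>k<j. of_real ((1/2) ^ Suc k) * f (P k ?w))"
        unfolding partial_avg_def
        by (rule positive_functional_sum[OF star_alg_bop states_positive[OF f]]) (use wb PA Avg_in in auto)
      then have "Re (f (partial_avg j P ?w)) = (\<Sum>k<j. ?a k)"
        by (simp only: Re_sum times_complex.sel Re_complex_of_real Im_complex_of_real mult_zero_left diff_zero)
      then have "(\<lambda>k. ?a (k + j)) sums (Re (f ?w) - Re (f (partial_avg j P ?w)))"
        using sums_split_initial_segment[OF s, of j] by simp
      moreover have "(\<lambda>k. (1/2::real) ^ Suc (k + j)) sums (1/2) ^ j"
      proof -
        have "(\<lambda>k. (1/2) ^ Suc j * (1/2::real) ^ k) sums ((1/2) ^ Suc j * (1 / (1 - 1/2)))"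
          by (intro sums_mult geometric_sums) simp
        then show ?thesis by (simp add: power_add mult_ac)
      qed
      moreover have "norm (?a (k + j)) \<le> (1/2) ^ Suc (k + j)" for k
      proof -
        have "\<bar>Re (f (P (k + j) ?w))\<bar> \<le> 1"
          using abs_Re_le_cmod[of "f (P (k + j) ?w)"] states_bound[OF f Avg_in[OF PA wb], of "k + j"] small[of j "k + j" i] ij
          by linarith
        then have "(1/2::real) ^ Suc (k + j) * \<bar>Re (f (P (k + j) ?w))\<bar> \<le> (1/2) ^ Suc (k + j) * 1"
          by (intro mult_left_mono) auto
        then show ?thesis by (simp add: abs_mult)
      qed
      ultimately have tail: "\<bar>Re (f ?w) - Re (f (partial_avg j P ?w))\<bar> \<le> (1/2) ^ j"
        using norm_sums_le by fastforce
      have "Re (f ?w) - Re (f (partial_avg j P ?w)) = Re (f (x i)) - Re (f ((partial_avg j P ^^ N j) (x i)))"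
        using arg_cong[OF partial_avg_neumann[where j = j and P = P and N = "N j", OF PA xb f], of Re] by simp
      moreover have "\<bar>Re (f ((partial_avg j P ^^ N j) (x i)))\<bar> \<le> (1/2) ^ j * opnorm H (x i)"
      proof -
        note pw = partial_avg_pow_opnorm[where j = j and P = P and n = "N j", OF PA xb]
        have "\<bar>Re (f ((partial_avg j P ^^ N j) (x i)))\<bar> \<le> (1 - (1/2) ^ j) ^ N j * opnorm H (x i)"
          using abs_Re_le_cmod[of "f ((partial_avg j P ^^ N j) (x i))"] states_bound[OF f pw(1)] pw(2) by linarith
        also have "\<dots> \<le> (1/2) ^ j * opnorm H (x i)"
          using N[of j] opnorm_nonneg[OF xb] by (intro mult_right_mono) auto
        finally show ?thesis .
      qed
      ultimately have "\<bar>Re (f (x i))\<bar> \<le> (1/2) ^ j + (1/2) ^ j * opnorm H (x i)" using tail by linarith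
      then show ?thesis by (simp add: algebra_simps)
    qed
    have zero: "Re (f (x i)) = 0" for i
    proof -
      have "(\<lambda>j. (1 + opnorm H (x i)) * (1/2::real) ^ j) \<longlonglongrightarrow> (1 + opnorm H (x i)) * 0"
        by (intro tendsto_intros LIMSEQ_realpow_zero) auto
      then have "\<bar>Re (f (x i))\<bar> \<le> (1 + opnorm H (x i)) * 0"
        by (rule LIMSEQ_le_const) (use bound[of i] in \<open>auto intro!: exI[of _ "Suc i"]\<close>)
      then show ?thesis by simp
    qed
    have fx: "f (x i) = (if even i then 1 else \<i>) * (f (\<pi> (e (i div 2))) - tau (\<pi> (e (i div 2))))" for i
      unfolding x_def
      using states_scale[OF f op_diff_in[OF pi_in[OF eG] op_scale_in[OF id_in]]]
        states_diff[OF f pi_in[OF eG] op_scale_in[OF id_in]] states_scale[OF f id_in] states_one[OF f] by simp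
    have "f (\<pi> (e m)) = tau (\<pi> (e m))" for m
      using zero[of "2 * m"] zero[of "2 * m + 1"] unfolding fx by (simp add: complex_eq_iff)
    then have "f (\<pi> g) = tau (\<pi> g)" if "g \<in> carrier G" for g using e_onto[OF that] by blast
    then show "regular f" using tau(2) by (simp add: regular_def)
  qed
  ultimately show ?thesis using suppG by blast
qed

end


context charmenable_rep begin

section \<open>The regular trace\<close>

text \<open>
  The restriction of \<open>tau\<close> to \<open>A\<close>, in the encoding of functionals on \<open>A\<close> that vanish elsewhere.
\<close>

definition regular_trace_on_A :: "('v \<Rightarrow> 'v) \<Rightarrow> complex" where
  "regular_trace_on_A T = (if T \<in> A then tau T else 0)"

lemma regular_trace_on_A_eq: "T \<in> A \<Longrightarrow> regular_trace_on_A T = tau T"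
  by (simp add: regular_trace_on_A_def)

lemma state_regular_trace_on_A: "state H A regular_trace_on_A"
  unfolding state_def
proof (intro conjI ballI allI)
  note Ain = star_alg_in[OF A_star_alg]
  note e = regular_trace_on_A_eq
  show "vanishes_off A regular_trace_on_A" by (simp add: vanishes_off_def regular_trace_on_A_def)
  show "regular_trace_on_A (id_op H) = 1" by (simp only: e[OF Ain(7)] states_one[OF tau(1)])
  fix T assume T: "T \<in> A"
  show "regular_trace_on_A (c *\<^sub>C T) = c * regular_trace_on_A T" for c
    by (simp only: e[OF Ain(4)[OF T]] e[OF T] states_scale[OF tau(1) Ain(1)[OF T]])
  show "regular_trace_on_A (adj H T \<circ> T) \<in> \<real>\<^sub>\<ge>\<^sub>0"
    unfolding e[OF Ain(5)[OF Ain(6)[OF T] T]] by (rule positive_functionalD(3)[OF states_positive[OF tau(1)] Ain(1)[OF T]])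
  fix S assume S: "S \<in> A"
  show "regular_trace_on_A (S + T) = regular_trace_on_A S + regular_trace_on_A T"
    by (simp only: e[OF Ain(2)[OF S T]] e[OF S] e[OF T] states_add[OF tau(1) Ain(1)[OF S] Ain(1)[OF T]])
qed

lemma regular_trace_regular_trace_on_A: "regular_trace G H \<pi> regular_trace_on_A"
  unfolding regular_trace_def tracial_state_def
proof (intro conjI ballI)
  note Ain = star_alg_in[OF A_star_alg]
  show "state H A regular_trace_on_A" by (rule state_regular_trace_on_A)
  show "regular_trace_on_A (S \<circ> T) = regular_trace_on_A (T \<circ> S)" if "S \<in> A" "T \<in> A" for S T
    by (simp only: regular_trace_on_A_eq[OF Ain(5)[OF that]] regular_trace_on_A_eq[OF Ain(5)[OF that(2,1)]] tau_trace[OF that])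
  show "regular_trace_on_A (\<pi> g) = (if g = \<one> then 1 else 0)" if "g \<in> carrier G" for g
    using tau(2) that by (simp only: regular_trace_on_A_eq[OF pi_A[OF that]] regular_def)
qed

lemma state_extends:
  assumes st: "state H A \<phi>"
  shows "\<exists>f\<in>states. \<forall>T\<in>A. f T = \<phi> T"
proof -
  have "\<exists>f. state H (bop H) f \<and> (\<forall>T\<in>A. f T = \<phi> T)"
  proof (rule extend_to_state[OF A_star_alg state_imp_positive_functional[OF st] _ _ nonzero])
    show "\<phi> (id_op H) = 1" using st by (simp add: state_def)
    show "cmod (\<phi> T) \<le> 1 * opnorm H T" if "T \<in> A" for T
      using state_norm_le[OF A_star_alg A_closed st that] by simp
  qed
  then show ?thesis by (simp add: states_def)
qed

lemma state_eq_regular_trace: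
  assumes st: "state H A \<phi>" and f: "f \<in> states" "\<And>T. T \<in> A \<Longrightarrow> f T = \<phi> T" and r: "regular f"
  shows "\<phi> = regular_trace_on_A"
proof
  fix T show "\<phi> T = regular_trace_on_A T"
  proof (cases "T \<in> A")
    case True
    then show ?thesis using f(2)[OF True] regular_eq_tau[OF f(1) r True] by (simp add: regular_trace_on_A_eq)
  next
    case False
    then show ?thesis using st by (simp add: state_def vanishes_off_def regular_trace_on_A_def)
  qed
qed

text \<open>
  The trace property makes the restriction of an extension of \<open>\<sigma>\<close> conjugation invariant, that is, a
  character.
\<close>

theorem unique_trace:
  assumes tr: "tracial_state H A \<sigma>"
  shows "\<sigma> = regular_trace_on_A"
proof -
  have st: "state H A \<sigma>" using tr by (simp add: tracial_state_def)
  obtain f where f: "f \<in> states" "\<And>T. T \<in> A \<Longrightarrow> f T = \<sigma> T" using state_extends[OF st] by blast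
  have "conj_act G g (res f) h = res f h" if g: "g \<in> carrier G" for g h
  proof (cases "h \<in> carrier G")
    case True
    have "\<sigma> (\<pi> (inv g \<otimes> h) \<circ> \<pi> g) = \<sigma> (\<pi> g \<circ> \<pi> (inv g \<otimes> h))"
      using tr pi_A g True by (simp add: tracial_state_def)
    moreover have "\<pi> (inv g \<otimes> h) \<circ> \<pi> g = \<pi> (inv g \<otimes> h \<otimes> g)" using g True by (simp flip: pi_mult)
    moreover have "\<pi> g \<circ> \<pi> (inv g \<otimes> h) = \<pi> h" using g True by (simp flip: pi_mult m_assoc)
    ultimately show ?thesis using g True f(2)[OF pi_A] by (simp add: conj_act_def res_def)
  next
    case False
    then show ?thesis by (simp add: conj_act_def res_def)
  qed
  then have "res f \<in> characters G" using res_PD1[OF f(1)] by (auto simp: characters_def)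
  then show ?thesis by (intro state_eq_regular_trace[OF st f character_regular[OF f(1)]])
qed

text \<open>
  The averages of \<open>x\<^sup>* x\<close> stay in the ideal and come close to \<open>\<tau>(x\<^sup>* x) 1\<close>. So if \<open>\<tau>(x\<^sup>* x) \<noteq> 0\<close>, the
  closed ideal contains the identity.
\<close>

theorem ideal_in_trace_kernel:
  assumes J: "closed_ideal H A J" "J \<noteq> A" and x: "x \<in> J"
  shows "tau (adj H x \<circ> x) = 0"
proof (rule ccontr)
  note Ain = star_alg_in[OF A_star_alg]
  let ?y = "adj H x \<circ> x"
  assume t: "tau ?y \<noteq> 0"
  have JA: "J \<subseteq> A" and W: "csubspace J" and cl: "op_closure H J = J"
    and id: "\<And>T S. T \<in> A \<Longrightarrow> S \<in> J \<Longrightarrow> T \<circ> S \<in> J" "\<And>T S. T \<in> A \<Longrightarrow> S \<in> J \<Longrightarrow> S \<circ> T \<in> J"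
    using J(1) by (auto simp: closed_ideal_def)
  have y: "?y \<in> J" using id(1)[OF Ain(6) x] x JA by blast
  have avg: "P ?y \<in> J" if "P \<in> Avg" for P
    using that
  proof (induction rule: Avg.induct)
    case (Ad g)
    have "\<pi> g \<circ> ?y \<circ> \<pi> (inv g) \<in> J" by (rule id(2)[OF pi_A id(1)[OF pi_A y]]) (use Ad in auto)
    then show ?case unfolding Ad_eq[OF Ad] .
  next
    case (mix P R t)
    show ?case by (rule cvs.subspace_add[OF W cvs.subspace_scale[OF W mix(5)] cvs.subspace_scale[OF W mix(6)]])
  qed
  have "tau ?y *\<^sub>C id_op H \<in> op_closure H J"
    unfolding op_closure_def
  proof (intro CollectI conjI allI impI)
    show "tau ?y *\<^sub>C id_op H \<in> bop H" by (rule op_scale_in[OF id_in])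
    fix e :: real assume e: "e > 0"
    obtain P where P: "P \<in> Avg" "opnorm H (P ?y - tau ?y *\<^sub>C id_op H) \<le> e / 2"
      using powers_finite[of "{?y}" "e / 2"] y JA e by auto
    have "opnorm H (tau ?y *\<^sub>C id_op H - P ?y) = opnorm H (P ?y - tau ?y *\<^sub>C id_op H)"
      using avg[OF P(1)] JA A_sub by (intro opnorm_minus_commute op_scale_in[OF id_in]) auto
    then show "\<exists>S\<in>J. opnorm H (tau ?y *\<^sub>C id_op H - S) < e"
      using avg[OF P(1)] P(2) e by (intro bexI[of _ "P ?y"]) auto
  qed
  then have "(1 / tau ?y) *\<^sub>C (tau ?y *\<^sub>C id_op H) \<in> J" unfolding cl by (rule cvs.subspace_scale[OF W])
  then have idJ: "id_op H \<in> J" using t by simp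
  have "T \<in> J" if T: "T \<in> A" for T
    using id(1)[OF T idJ] Ain(1)[OF T] by simp
  then show False using JA J(2) by blast
qed

theorem powers_property:
  assumes x: "x \<in> A"
  shows "tau x *\<^sub>C id_op H \<in> op_closure H (convex hull ((\<lambda>g. Ad H (\<pi> g) x) ` carrier G))"
  unfolding op_closure_def
proof (intro CollectI conjI allI impI)
  have xb: "x \<in> bop H" using x A_sub by blast
  show "tau x *\<^sub>C id_op H \<in> bop H" by (rule op_scale_in[OF id_in])
  fix e :: real assume e: "e > 0"
  obtain P where P: "P \<in> Avg" "opnorm H (P x - tau x *\<^sub>C id_op H) \<le> e / 2"
    using powers_finite[of "{x}" "e / 2"] x e by auto
  have "opnorm H (tau x *\<^sub>C id_op H - P x) = opnorm H (P x - tau x *\<^sub>C id_op H)"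
    by (intro opnorm_minus_commute op_scale_in[OF id_in] Avg_in[OF P(1) xb])
  then show "\<exists>S\<in>convex hull ((\<lambda>g. Ad H (\<pi> g) x) ` carrier G). opnorm H (tau x *\<^sub>C id_op H - S) < e"
    using P(2) e by (intro bexI[OF _ Avg_convex_hull[OF P(1)]]) auto
qed

lemma stationary_regular_trace_on_A:
  assumes \<mu>: "set_pmf \<mu> \<subseteq> carrier G"
  shows "stationary G H \<pi> \<mu> regular_trace_on_A"
  unfolding stationary_def
proof
  fix T assume T: "T \<in> A"
  have "((\<lambda>g. pmf \<mu> g * 1) has_sum measure_pmf.expectation \<mu> (\<lambda>_. 1)) UNIV"
    by (rule pmf_expectation_has_sum[where M = 1]) simp
  then have "(pmf \<mu> has_sum 1) UNIV" by simp
  also have "(pmf \<mu> has_sum 1) UNIV \<longleftrightarrow> (pmf \<mu> has_sum 1) (carrier G)"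
    by (rule has_sum_cong_neutral) (use \<mu> in \<open>auto simp: set_pmf_iff\<close>)
  finally have "((\<lambda>g. complex_of_real (pmf \<mu> g)) has_sum of_real 1) (carrier G)" by (rule has_sum_of_real)
  then have "((\<lambda>g. complex_of_real (pmf \<mu> g) * regular_trace_on_A T) has_sum of_real 1 * regular_trace_on_A T) (carrier G)"
    by (rule has_sum_cmult_left)
  then have s: "((\<lambda>g. complex_of_real (pmf \<mu> g) * regular_trace_on_A T) has_sum regular_trace_on_A T) (carrier G)"
    by (simp only: of_real_1 mult_1)
  have inv: "regular_trace_on_A (Ad H (\<pi> (inv g)) T) = regular_trace_on_A T" if g: "g \<in> carrier G" for g
    using tau_Ad[OF inv_closed[OF g] T] by (simp only: regular_trace_on_A_eq[OF T] regular_trace_on_A_eq[OF Ad_A[OF inv_closed[OF g] T]])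
  show "((\<lambda>g. complex_of_real (pmf \<mu> g) * regular_trace_on_A (Ad H (\<pi> (inv g)) T)) has_sum regular_trace_on_A T) (carrier G)"
    by (rule iffD1[OF has_sum_cong s]) (simp only: inv)
qed

lemma stationary_expectation:
  assumes \<mu>: "set_pmf \<mu> \<subseteq> carrier G" and st: "stationary G H \<pi> \<mu> \<phi>" and f: "f \<in> states" "\<And>T. T \<in> A \<Longrightarrow> f T = \<phi> T"
    and T: "T \<in> A"
  shows "Re (f T) = measure_pmf.expectation \<mu> (orbit f T)"
proof -
  have "((\<lambda>g. complex_of_real (pmf \<mu> g) * \<phi> (Ad H (\<pi> (inv g)) T)) has_sum \<phi> T) (carrier G)"
    using st T by (simp add: stationary_def)
  then have "((\<lambda>g. Re (complex_of_real (pmf \<mu> g) * \<phi> (Ad H (\<pi> (inv g)) T))) has_sum Re (\<phi> T)) (carrier G)"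
    by (rule has_sum_Re)
  also have "?this \<longleftrightarrow> ((\<lambda>g. pmf \<mu> g * orbit f T g) has_sum Re (\<phi> T)) UNIV"
    by (rule has_sum_cong_neutral) (use \<mu> f(2)[OF Ad_A[OF inv_closed T]] in \<open>auto simp: set_pmf_iff orbit_def\<close>)
  finally have "((\<lambda>g. pmf \<mu> g * orbit f T g) has_sum Re (f T)) UNIV" unfolding f(2)[OF T] .
  moreover have "((\<lambda>g. pmf \<mu> g * orbit f T g) has_sum measure_pmf.expectation \<mu> (orbit f T)) UNIV"
    by (rule pmf_expectation_has_sum[OF orbit_bound[OF f(1)]]) (use T A_sub in blast)
  ultimately show ?thesis by (rule has_sum_unique)
qed

theorem unique_stationary_state:
  "\<exists>\<mu> :: 'g pmf. set_pmf \<mu> \<subseteq> carrier G \<and> generate G (set_pmf \<mu>) = carrier G \<and>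
     (\<forall>\<phi>. state H A \<phi> \<and> stationary G H \<pi> \<mu> \<phi> \<longleftrightarrow> \<phi> = regular_trace_on_A)"
proof -
  obtain \<mu> where \<mu>: "set_pmf \<mu> \<subseteq> carrier G" "generate G (set_pmf \<mu>) = carrier G"
    "\<And>f. f \<in> states \<Longrightarrow> (\<forall>T\<in>A. Re (f T) = measure_pmf.expectation \<mu> (orbit f T)) \<Longrightarrow> regular f"
    using unique_stationary_measure by blast
  have "\<phi> = regular_trace_on_A" if st: "state H A \<phi>" "stationary G H \<pi> \<mu> \<phi>" for \<phi>
  proof -
    obtain f where f: "f \<in> states" "\<And>T. T \<in> A \<Longrightarrow> f T = \<phi> T" using state_extends[OF st(1)] by blast
    have r: "regular f" by (rule \<mu>(3)[OF f(1)]) (use stationary_expectation[OF \<mu>(1) st(2) f] in blast)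
    show ?thesis by (rule state_eq_regular_trace[OF st(1) f(1) f(2) r])
  qed
  moreover have "state H A regular_trace_on_A \<and> stationary G H \<pi> \<mu> regular_trace_on_A"
    using state_regular_trace_on_A stationary_regular_trace_on_A[OF \<mu>(1)] by blast
  ultimately have "\<forall>\<phi>. state H A \<phi> \<and> stationary G H \<pi> \<mu> \<phi> \<longleftrightarrow> \<phi> = regular_trace_on_A" by blast
  then show ?thesis using \<mu>(1,2) by blast
qed

end

theorem proposition3p7:
  fixes G :: "('g, 'b) monoid_scheme"
    and H :: "'v::complex_vector hilbert"
    and \<pi> :: "'g \<Rightarrow> 'v \<Rightarrow> 'v"
    and A :: "('v \<Rightarrow> 'v) set"
  assumes "group G" and "countable (carrier G)"
    and "charmenable G"
    and "amenable_radical G = {\<one>\<^bsub>G\<^esub>}"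
    and "hilbert_space H" and "vecs H \<noteq> {0}"
    and "unitary_rep G H \<pi>"
    and "A = cstar_alg G H \<pi>"
    and "\<not> amenable_rep G H \<pi>"
  shows
    "weakly_contains G H \<pi> (ell2 G) (left_regular G) \<and>
     (\<exists>\<tau>. regular_trace G H \<pi> \<tau> \<and>
        (\<forall>\<sigma>. tracial_state H A \<sigma> \<longrightarrow> \<sigma> = \<tau>) \<and>
        (\<forall>J. closed_ideal H A J \<and> J \<noteq> A \<longrightarrow> J \<subseteq> {x \<in> A. \<tau> (adj H x \<circ> x) = 0}) \<and>
        (\<forall>x\<in>A. \<tau> x *\<^sub>C id_op H \<in> op_closure H (convex hull ((\<lambda>g. Ad H (\<pi> g) x) ` carrier G))) \<and>
        (\<exists>\<mu> :: 'g pmf. set_pmf \<mu> \<subseteq> carrier G \<and> generate G (set_pmf \<mu>) = carrier G \<and>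
           (\<forall>\<phi>. state H A \<phi> \<and> stationary G H \<pi> \<mu> \<phi> \<longleftrightarrow> \<phi> = \<tau>)))"
proof -
  interpret group G by fact
  interpret charmenable_rep G H \<pi> by unfold_locales fact+
  have A: "A = cstar_alg G H \<pi>" by fact
  show ?thesis unfolding A
  proof (intro conjI exI[of _ regular_trace_on_A] allI impI ballI)
    show "weakly_contains G H \<pi> (ell2 G) (left_regular G)" by (rule weakly_contains_regular)
    show "regular_trace G H \<pi> regular_trace_on_A" by (rule regular_trace_regular_trace_on_A)
    show "\<sigma> = regular_trace_on_A" if "tracial_state H (cstar_alg G H \<pi>) \<sigma>" for \<sigma>
      using that by (rule unique_trace)
    show "J \<subseteq> {x \<in> cstar_alg G H \<pi>. regular_trace_on_A (adj H x \<circ> x) = 0}"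
      if J: "closed_ideal H (cstar_alg G H \<pi>) J \<and> J \<noteq> cstar_alg G H \<pi>" for J
    proof
      fix x assume x: "x \<in> J"
      then have "x \<in> cstar_alg G H \<pi>" using J by (auto simp: closed_ideal_def)
      then show "x \<in> {x \<in> cstar_alg G H \<pi>. regular_trace_on_A (adj H x \<circ> x) = 0}"
        using ideal_in_trace_kernel[OF conjunct1[OF J] conjunct2[OF J] x] by (simp add: regular_trace_on_A_def)
    qed
    show "regular_trace_on_A x *\<^sub>C id_op H \<in> op_closure H (convex hull ((\<lambda>g. Ad H (\<pi> g) x) ` carrier G))"
      if "x \<in> cstar_alg G H \<pi>" for x
      unfolding regular_trace_on_A_eq[OF that] by (rule powers_property[OF that])
    show "\<exists>\<mu> :: 'g pmf. set_pmf \<mu> \<subseteq> carrier G \<and> generate G (set_pmf \<mu>) = carrier G \<and>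
        (\<forall>\<phi>. state H (cstar_alg G H \<pi>) \<phi> \<and> stationary G H \<pi> \<mu> \<phi> \<longleftrightarrow> \<phi> = regular_trace_on_A)"
      by (rule unique_stationary_state)
  qed
qed


end
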